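(* Let $1<p<\infty$, let $\mathcal{A}_1,\mathcal{A}_2$ be separable Banach spaces, let $\psi,\psi^{(-1)}:\mathcal{A}_2\to B(l^p)$ be maps, let $\eta:\mathcal{A}_2\to B(l^p\oplus l^p)$ be a bounded linear map, and for each $t\in[0,1]$ let $\tau_t:\mathcal{A}_1\to\mathcal{A}_2$ be a bounded linear map. Assume (1) $\eta(a)-\psi(a)\oplus\psi^{(-1)}(a)$ is compact for all $a\in\mathcal{A}_2$, and (2) for each $a\in\mathcal{A}_1$ the function $t\mapsto\tau_t(a)$ is continuous from $[0,1]$ to $\mathcal{A}_2$. Then there exist dyadic numbers $v(1),v(2),\ldots$ in $[0,1]$ such that $(\psi\circ\tau_0)\oplus\big(\bigoplus_{k\ge1}\eta\circ\tau_{v(k)}\big)$ is $16$-similar modulo compact operators to $(\psi\circ\tau_1)\oplus\big(\bigoplus_{k\ge1}\eta\circ\tau_{v(k)}\big)$. If $p=2$, they are unitarily equivalent modulo compact operators.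
   Context: Direct sums are $l^p$-direct sums of spaces and operators. Maps $\rho_1:\Lambda\to B(\mathcal{Y}_1)$, $\rho_2:\Lambda\to B(\mathcal{Y}_2)$ are $\lambda$-similar modulo compact operators if there is an invertible $S:\mathcal{Y}_1\to\mathcal{Y}_2$ with $\|S\|\|S^{-1}\|\le\lambda$ and $\rho_2(a)-S\rho_1(a)S^{-1}$ compact for all $a$; unitary equivalence modulo compact operators means the same with $S$ unitary. *)

theory Defs
  imports "HOL-Analysis.Analysis"
begin

text \<open>Complex l^p spaces over an index type 'i, as sets of functions 'i => complex.
  l^p-direct sums are l^p spaces over disjoint unions / products of index types.\<close>

definition lp :: "real \<Rightarrow> ('i \<Rightarrow> complex) set" where
  "lp p = {x. (\<lambda>i. norm (x i) powr p) summable_on UNIV}"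

definition lpnorm :: "real \<Rightarrow> ('i \<Rightarrow> complex) \<Rightarrow> real" where
  "lpnorm p x = (infsum (\<lambda>i. norm (x i) powr p) UNIV) powr (1 / p)"

text \<open>Bounded (complex-)linear operators on l^p('i); only the action on l^p matters.\<close>
definition bop :: "real \<Rightarrow> (('i \<Rightarrow> complex) \<Rightarrow> ('i \<Rightarrow> complex)) \<Rightarrow> bool" where
  "bop p T \<longleftrightarrow>
     (\<forall>x\<in>lp p. T x \<in> lp p) \<and>
     (\<forall>x\<in>lp p. \<forall>y\<in>lp p. T (\<lambda>i. x i + y i) = (\<lambda>i. T x i + T y i)) \<and>
     (\<forall>c. \<forall>x\<in>lp p. T (\<lambda>i. c * x i) = (\<lambda>i. c * T x i)) \<and>
     (\<exists>C. \<forall>x\<in>lp p. lpnorm p (T x) \<le> C * lpnorm p x)"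

definition opnorm :: "real \<Rightarrow> (('i \<Rightarrow> complex) \<Rightarrow> ('i \<Rightarrow> complex)) \<Rightarrow> real" where
  "opnorm p T = Sup {lpnorm p (T x) | x. x \<in> lp p \<and> lpnorm p x \<le> 1}"

definition compact_op :: "real \<Rightarrow> (('i \<Rightarrow> complex) \<Rightarrow> ('i \<Rightarrow> complex)) \<Rightarrow> bool" where
  "compact_op p T \<longleftrightarrow> bop p T \<and>
     (\<forall>x::nat \<Rightarrow> 'i \<Rightarrow> complex. (\<forall>n. x n \<in> lp p) \<and> (\<exists>M. \<forall>n. lpnorm p (x n) \<le> M) \<longrightarrow>
        (\<exists>r y. strict_mono r \<and> y \<in> lp p \<and>
               (\<lambda>n. lpnorm p (\<lambda>i. T (x (r n)) i - y i)) \<longlonglongrightarrow> 0))"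

text \<open>Direct sum of two operators: l^p('i) (+) l^p('j) = l^p('i + 'j).\<close>
definition dsum :: "(('i \<Rightarrow> complex) \<Rightarrow> ('i \<Rightarrow> complex)) \<Rightarrow> (('j \<Rightarrow> complex) \<Rightarrow> ('j \<Rightarrow> complex))
    \<Rightarrow> (('i + 'j \<Rightarrow> complex) \<Rightarrow> ('i + 'j \<Rightarrow> complex))" where
  "dsum T S x = (\<lambda>k. case k of Inl i \<Rightarrow> T (\<lambda>i'. x (Inl i')) i
                             | Inr j \<Rightarrow> S (\<lambda>j'. x (Inr j')) j)"

text \<open>Countable direct sum of operators: (+)_k l^p('j) = l^p(nat * 'j).\<close>
definition bigsum :: "(nat \<Rightarrow> ('j \<Rightarrow> complex) \<Rightarrow> ('j \<Rightarrow> complex))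
    \<Rightarrow> ((nat \<times> 'j \<Rightarrow> complex) \<Rightarrow> (nat \<times> 'j \<Rightarrow> complex))" where
  "bigsum T x = (\<lambda>(k, j). T k (\<lambda>j'. x (k, j')) j)"

definition similar_mod_compact ::
  "real \<Rightarrow> real \<Rightarrow> ('a \<Rightarrow> ('i \<Rightarrow> complex) \<Rightarrow> ('i \<Rightarrow> complex))
        \<Rightarrow> ('a \<Rightarrow> ('i \<Rightarrow> complex) \<Rightarrow> ('i \<Rightarrow> complex)) \<Rightarrow> bool" where
  "similar_mod_compact p lam \<rho>1 \<rho>2 \<longleftrightarrow>
     (\<exists>S Sinv. bop p S \<and> bop p Sinv \<and>
        (\<forall>x\<in>lp p. Sinv (S x) = x \<and> S (Sinv x) = x) \<and>
        opnorm p S * opnorm p Sinv \<le> lam \<and>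
        (\<forall>a. compact_op p (\<lambda>x i. \<rho>2 a x i - S (\<rho>1 a (Sinv x)) i)))"

definition unitarily_equiv_mod_compact ::
  "real \<Rightarrow> ('a \<Rightarrow> ('i \<Rightarrow> complex) \<Rightarrow> ('i \<Rightarrow> complex))
        \<Rightarrow> ('a \<Rightarrow> ('i \<Rightarrow> complex) \<Rightarrow> ('i \<Rightarrow> complex)) \<Rightarrow> bool" where
  "unitarily_equiv_mod_compact p \<rho>1 \<rho>2 \<longleftrightarrow>
     (\<exists>S Sinv. bop p S \<and> bop p Sinv \<and>
        (\<forall>x\<in>lp p. Sinv (S x) = x \<and> S (Sinv x) = x) \<and>
        (\<forall>x\<in>lp p. lpnorm p (S x) = lpnorm p x) \<and>
        (\<forall>a. compact_op p (\<lambda>x i. \<rho>2 a x i - S (\<rho>1 a (Sinv x)) i)))"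

definition bounded_linear_into_B ::
  "real \<Rightarrow> ('a::real_normed_vector \<Rightarrow> ('i \<Rightarrow> complex) \<Rightarrow> ('i \<Rightarrow> complex)) \<Rightarrow> bool" where
  "bounded_linear_into_B p \<eta> \<longleftrightarrow>
     (\<forall>a. bop p (\<eta> a)) \<and>
     (\<forall>a b. \<forall>x\<in>lp p. \<eta> (a + b) x = (\<lambda>i. \<eta> a x i + \<eta> b x i)) \<and>
     (\<forall>r a. \<forall>x\<in>lp p. \<eta> (r *\<^sub>R a) x = (\<lambda>i. complex_of_real r * \<eta> a x i)) \<and>
     (\<exists>C. \<forall>a. opnorm p (\<eta> a) \<le> C * norm a)"

definition dyadic :: "real \<Rightarrow> bool" where
  "dyadic t \<longleftrightarrow> (\<exists>m n::nat. t = real m / 2 ^ n)"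

end

theory Submission
  imports Defs "HOL-Library.Function_Algebras"
begin

text \<open>
  Replace \<open>\<psi>\<close> by the compression of \<open>\<eta>\<close> to the first summand, which changes it by compact operators only.
  Along a partition \<open>0 = t\<^sub>0 < t\<^sub>1 < \<dots> < t\<^sub>r = 1\<close> the sum of \<open>\<psi> \<circ> \<tau>\<^sub>0\<close> and of the \<open>\<eta> \<circ> \<tau>\<close> at the partition
  points becomes, up to compact operators and an error of the size of the mesh, the corresponding sum starting with
  \<open>\<psi> \<circ> \<tau>\<^sub>1\<close> when the \<open>\<psi>\<close>-parts are permuted cyclically. To make the error compact, the partition
  is refined dyadically while one moves out to infinity in the coordinate \<open>i\<close> of \<open>l\<^sup>p\<close>: far out, the intertwiner
  acts on the fibre over \<open>i\<close> as the cyclic permutation \<open>\<sigma>\<^sub>n\<close> of \<open>2\<^sup>n\<close> slots, where \<open>n\<close> grows with \<open>i\<close>.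
  The permutations are chosen such that \<open>\<sigma>\<^sub>n\<close> and \<open>\<sigma>\<^bsub>n+1\<^esub>\<close> differ by an involution; hence they are joined by a path
  of unitaries \<open>(1 + u) / 2 \<sigma>\<^sub>n + (1 - u) / 2 \<sigma>\<^bsub>n+1\<^esub>\<close>, \<open>\<bar>u\<bar> = 1\<close>. If \<open>u\<close> varies slowly enough with \<open>i\<close>, it almost
  commutes with the finitely many operators that matter at stage \<open>n\<close>, because for \<open>1 < p < \<infinity>\<close> these are almost
  block tridiagonal. Each fibre map is a combination of two permutations with coefficients of modulus at most one,
  so that it and its inverse have norm at most two.
\<close>

section \<open>The spaces \<open>l\<^sup>p\<close>\<close>

text \<open>The map \<open>\<psi>\<close> carries no linearity. The compression of
  \<open>\<eta>\<close> that replaces it is linear and bounded, so an intertwiner built from a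
  countable dense subset of the first Banach space serves all elements by approximation. The
  operators that matter at stage \<open>n\<close> belong to the first \<open>n + 1\<close> dense
  elements and the first \<open>2 ^ (n + 1)\<close> slots. Two obstacles shape the estimates. First,
  the jumps of \<open>t \<mapsto> \<tau> t a\<close> across gaps of length \<open>1 / 2 ^ n\<close>
  tend to zero at no prescribed rate, so the resulting errors cannot be summed as norms. Each of
  them lives, however, on the coordinates of two neighbouring stages, and operators with such almost
  disjoint supports add up to a multiple of the largest bound. The commutator errors lack this
  support property, but the choice of the stages makes them geometrically small. Second, the
  off-diagonal part of each \<open>\<eta>\<close> is compact but need not become small as the slot
  number grows. A slot with large number is moved only at coordinates so far out that this part is
  negligible there.\<close>

definition mul :: "('i \<Rightarrow> complex) \<Rightarrow> ('i \<Rightarrow> complex) \<Rightarrow> 'i \<Rightarrow> complex" where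
  "mul f x = (\<lambda>j. f j * x j)"

definition cut :: "'i set \<Rightarrow> ('i \<Rightarrow> complex) \<Rightarrow> 'i \<Rightarrow> complex" where
  "cut A x = (\<lambda>j. if j \<in> A then x j else 0)"

definition extend :: "('i \<Rightarrow> 'j) \<Rightarrow> ('i \<Rightarrow> complex) \<Rightarrow> 'j \<Rightarrow> complex" where
  "extend f x = (\<lambda>j. if j \<in> range f then x (inv f j) else 0)"

lemma cut_eq_mul: "cut A x = mul (indicator A) x"
  by (auto simp: cut_def mul_def)

lemma cut_cut: "cut A (cut B x) = cut (A \<inter> B) x"
  by (auto simp: cut_def)

lemma cut_add_compl: "cut A x + cut (- A) x = x"
  by (auto simp: cut_def fun_eq_iff)

lemma extend_apply [simp]: "inj f \<Longrightarrow> extend f x (f i) = x i"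
  by (simp add: extend_def)

locale lp_exponent =
  fixes p :: real
  assumes p_gt_1: "1 < p"
begin

lemma p_pos: "0 < p"
  using p_gt_1 by simp

lemma powr_inverse_cancel [simp]: "0 \<le> a \<Longrightarrow> (a powr p) powr (1 / p) = a" for a :: real
  using p_pos by (simp add: powr_powr)

lemma powr_inverse_cancel' [simp]: "0 \<le> a \<Longrightarrow> (a powr (1 / p)) powr p = a" for a :: real
  using p_pos by (simp add: powr_powr)

lemma lpnorm_nonneg [simp]: "0 \<le> lpnorm p x"
  by (simp add: lpnorm_def)

lemma lpnorm_powr: "lpnorm p x powr p = infsum (\<lambda>i. norm (x i) powr p) UNIV"
  unfolding lpnorm_def by (rule powr_inverse_cancel') (simp add: infsum_nonneg)

lemma lp_summable: "x \<in> lp p \<Longrightarrow> (\<lambda>i. norm (x i) powr p) summable_on A"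
  unfolding lp_def by (auto intro: summable_on_subset_banach)

lemma sum_le_lpnorm:
  assumes "x \<in> lp p" "finite F"
  shows "(\<Sum>i\<in>F. norm (x i) powr p) \<le> lpnorm p x powr p"
  unfolding lpnorm_powr using assms by (intro finite_sum_le_infsum lp_summable) auto

text \<open>Norm estimates go through finite partial sums: a uniform bound on them yields
  summability and the norm estimate at once.\<close>

lemma lp_boundedI:
  assumes "\<And>F. finite F \<Longrightarrow> (\<Sum>i\<in>F. norm (x i) powr p) \<le> B powr p" and "0 \<le> B"
  shows "x \<in> lp p" "lpnorm p x \<le> B"
proof -
  have s: "(\<lambda>i. norm (x i) powr p) summable_on UNIV"
    by (rule nonneg_bdd_above_summable_on) (use assms in \<open>auto intro!: bdd_aboveI\<close>)
  then show "x \<in> lp p" by (simp add: lp_def)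
  have "lpnorm p x powr p \<le> B powr p"
    unfolding lpnorm_powr by (rule infsum_le_finite_sums[OF s]) (use assms in auto)
  then show "lpnorm p x \<le> B"
    using p_pos assms(2) powr_less_mono2[of p B "lpnorm p x"] by linarith
qed

lemma lp_dominated:
  assumes "x \<in> lp p" "\<And>i. norm (y i) \<le> norm (x i)"
  shows "y \<in> lp p" "lpnorm p y \<le> lpnorm p x"
proof -
  have "(\<Sum>i\<in>F. norm (y i) powr p) \<le> lpnorm p x powr p" if "finite F" for F
    by (rule order_trans[OF sum_mono sum_le_lpnorm[OF assms(1) that]])
      (use assms p_pos in \<open>auto intro: powr_mono2\<close>)
  from lp_boundedI[OF this] show "y \<in> lp p" "lpnorm p y \<le> lpnorm p x" by auto
qed

lemma norm_le_lpnorm: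
  assumes "x \<in> lp p" shows "norm (x i) \<le> lpnorm p x"
proof (rule ccontr)
  assume "\<not> ?thesis"
  then have "lpnorm p x powr p < norm (x i) powr p"
    using p_pos by (intro powr_less_mono2) auto
  with sum_le_lpnorm[OF assms, of "{i}"] show False by simp
qed

lemma lp_zero [simp]: "0 \<in> lp p" "lpnorm p 0 = 0"
  using p_pos by (simp_all add: lp_def lpnorm_def)

lemma lpnorm_eq_0D: "x \<in> lp p \<Longrightarrow> lpnorm p x = 0 \<Longrightarrow> x = 0"
  using norm_le_lpnorm by (fastforce simp: fun_eq_iff)

lemma powr_convex_nonneg:
  fixes s t a b :: real
  assumes "0 \<le> s" "0 \<le> t" "s + t = 1" "0 \<le> a" "0 \<le> b"
  shows "(s * a + t * b) powr p \<le> s * a powr p + t * b powr p"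
proof -
  have *: "(s * a) powr p \<le> s * a powr p" if "0 \<le> s" "s \<le> 1" "0 \<le> a" for s a :: real
  proof -
    have "s powr p \<le> s powr 1"
      using that p_gt_1 by (intro powr_mono') auto
    then show ?thesis using that by (simp add: powr_mult mult_right_mono)
  qed
  consider "a = 0" | "b = 0" | "0 < a" "0 < b" using assms by fastforce
  then show ?thesis
  proof cases
    case 3
    then show ?thesis
      using convex_onD[OF powr_convex[of p], of t a b] assms p_gt_1
      by (simp add: eq_diff_eq[symmetric])
  qed (use *[of t b] *[of s a] assms p_pos in auto)
qed

text \<open>Minkowski's inequality by convexity: with norms \<open>a\<close>, \<open>b\<close> the
  sum is \<open>a + b\<close> times a convex combination of the normalized vectors, with weights
  \<open>a / (a + b)\<close> and \<open>b / (a + b)\<close>. The normalization forces the separate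
  case of a zero norm.\<close>

lemma lp_add:
  assumes "x \<in> lp p" "y \<in> lp p"
  shows "x + y \<in> lp p" "lpnorm p (x + y) \<le> lpnorm p x + lpnorm p y"
proof -
  define a b where "a = lpnorm p x" and "b = lpnorm p y"
  have "x + y \<in> lp p \<and> lpnorm p (x + y) \<le> a + b"
  proof (cases "a = 0 \<or> b = 0")
    case True
    then show ?thesis using assms lpnorm_eq_0D[of x] lpnorm_eq_0D[of y] by (auto simp: a_def b_def)
  next
    case False
    then have ab: "0 < a" "0 < b"
      using lpnorm_nonneg[of x] lpnorm_nonneg[of y] by (auto simp: a_def b_def less_le)
    define s t where "s = a / (a + b)" and "t = b / (a + b)"
    have st: "0 \<le> s" "0 \<le> t" "s + t = 1" using ab by (auto simp: s_def t_def add_divide_distrib[symmetric])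
    have e: "(a + b) * s = a" "(a + b) * t = b" using ab by (auto simp: s_def t_def)
    have pt: "norm ((x + y) i) powr p
        \<le> (a + b) powr p * (s * (norm (x i) powr p / a powr p) + t * (norm (y i) powr p / b powr p))" for i
    proof -
      have "norm ((x + y) i) \<le> (a + b) * (s * (norm (x i) / a) + t * (norm (y i) / b))"
        using ab norm_triangle_ineq[of "x i" "y i"] by (simp add: distrib_left mult.assoc[symmetric] e)
      then have "norm ((x + y) i) powr p \<le> ((a + b) * (s * (norm (x i) / a) + t * (norm (y i) / b))) powr p"
        using p_pos by (intro powr_mono2) auto
      also have "\<dots> = (a + b) powr p * (s * (norm (x i) / a) + t * (norm (y i) / b)) powr p"
        by (rule powr_mult)
      also have "\<dots> \<le> (a + b) powr p * (s * (norm (x i) / a) powr p + t * (norm (y i) / b) powr p)"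
        using ab st by (intro mult_left_mono powr_convex_nonneg) auto
      finally show ?thesis using ab by (simp add: powr_divide)
    qed
    have "(\<Sum>i\<in>F. norm ((x + y) i) powr p) \<le> (a + b) powr p" if "finite F" for F
    proof -
      have "(\<Sum>i\<in>F. norm ((x + y) i) powr p)
        \<le> (\<Sum>i\<in>F. (a + b) powr p * (s * (norm (x i) powr p / a powr p) + t * (norm (y i) powr p / b powr p)))"
        by (intro sum_mono pt)
      also have "\<dots> = (a + b) powr p * (s * ((\<Sum>i\<in>F. norm (x i) powr p) / a powr p)
            + t * ((\<Sum>i\<in>F. norm (y i) powr p) / b powr p))"
        by (simp only: sum_distrib_left[symmetric] sum.distrib sum_divide_distrib)
      also have "\<dots> \<le> (a + b) powr p * (s * 1 + t * 1)"
        using ab st sum_le_lpnorm[OF assms(1) that] sum_le_lpnorm[OF assms(2) that]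
        by (intro mult_left_mono add_mono) (auto simp: a_def b_def)
      finally show ?thesis using st by simp
    qed
    then show ?thesis using ab by (intro conjI lp_boundedI[of "x + y" "a + b"]) auto
  qed
  then show "x + y \<in> lp p" "lpnorm p (x + y) \<le> lpnorm p x + lpnorm p y"
    by (auto simp: a_def b_def)
qed

lemma lp_mul:
  assumes "x \<in> lp p" "\<And>j. norm (f j) \<le> C"
  shows "mul f x \<in> lp p" "lpnorm p (mul f x) \<le> C * lpnorm p x"
proof -
  have C: "0 \<le> C" using assms(2) norm_ge_zero order_trans by blast
  have "(\<Sum>i\<in>F. norm (mul f x i) powr p) \<le> (C * lpnorm p x) powr p" if "finite F" for F
  proof -
    have "(\<Sum>i\<in>F. norm (mul f x i) powr p) \<le> (\<Sum>i\<in>F. C powr p * norm (x i) powr p)"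
      using assms(2) p_pos C
      by (intro sum_mono) (auto simp: mul_def norm_mult powr_mult[symmetric] intro!: powr_mono2 mult_right_mono)
    also have "\<dots> \<le> C powr p * lpnorm p x powr p"
      using sum_le_lpnorm[OF assms(1) that] by (simp add: sum_distrib_left[symmetric] mult_left_mono)
    finally show ?thesis using C by (simp add: powr_mult)
  qed
  from lp_boundedI[OF this] C
  show "mul f x \<in> lp p" "lpnorm p (mul f x) \<le> C * lpnorm p x" by auto
qed

lemma lp_scale [simp]: "x \<in> lp p \<Longrightarrow> mul (\<lambda>_. c) x \<in> lp p"
  by (rule lp_mul) auto

lemma lpnorm_scale: assumes "x \<in> lp p" shows "lpnorm p (mul (\<lambda>_. c) x) = norm c * lpnorm p x"
proof (cases "c = 0")
  case False
  have "lpnorm p (mul (\<lambda>_. 1 / c) (mul (\<lambda>_. c) x)) \<le> 1 / norm c * lpnorm p (mul (\<lambda>_. c) x)"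
    by (intro lp_mul) (use assms in \<open>auto simp: norm_divide\<close>)
  moreover have "mul (\<lambda>_. 1 / c) (mul (\<lambda>_. c) x) = x" using False by (auto simp: mul_def)
  ultimately have "norm c * lpnorm p x \<le> lpnorm p (mul (\<lambda>_. c) x)" using False by (simp add: field_simps)
  moreover have "lpnorm p (mul (\<lambda>_. c) x) \<le> norm c * lpnorm p x" by (intro lp_mul) (use assms in auto)
  ultimately show ?thesis by simp
qed (simp add: mul_def zero_fun_def[symmetric])

lemma uminus_eq_scale: "- x = mul (\<lambda>_. - 1) x"
  by (auto simp: mul_def fun_eq_iff)

lemma lp_uminus [simp]: "x \<in> lp p \<Longrightarrow> - x \<in> lp p"
  by (simp add: uminus_eq_scale)

lemma lpnorm_uminus [simp]: "x \<in> lp p \<Longrightarrow> lpnorm p (- x) = lpnorm p x"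
  by (simp add: uminus_eq_scale lpnorm_scale)

lemma lp_diff:
  assumes "x \<in> lp p" "y \<in> lp p"
  shows "x - y \<in> lp p" "lpnorm p (x - y) \<le> lpnorm p x + lpnorm p y"
  using lp_add[of x "- y"] assms by auto

lemma lp_cut:
  assumes "x \<in> lp p"
  shows "cut A x \<in> lp p" "lpnorm p (cut A x) \<le> lpnorm p x"
  by (auto intro!: lp_dominated[OF assms] simp: cut_def)

lemma lp_reindex:
  assumes "x \<in> lp p" "inj f"
  shows "x \<circ> f \<in> lp p" "lpnorm p (x \<circ> f) \<le> lpnorm p x"
proof -
  have "(\<Sum>i\<in>F. norm ((x \<circ> f) i) powr p) \<le> lpnorm p x powr p" if "finite F" for F
    using sum_le_lpnorm[OF assms(1), of "f ` F"] that sum.reindex[of f F "\<lambda>i. norm (x i) powr p"] assms(2)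
    by (simp add: inj_on_def)
  then show "x \<circ> f \<in> lp p" "lpnorm p (x \<circ> f) \<le> lpnorm p x"
    by (rule lp_boundedI; simp)+
qed

lemma lp_extend:
  assumes "x \<in> lp p" "inj f"
  shows "extend f x \<in> lp p" "lpnorm p (extend f x) \<le> lpnorm p x"
proof -
  have "(\<Sum>j\<in>F. norm (extend f x j) powr p) \<le> lpnorm p x powr p" if "finite F" for F
  proof -
    have fin: "finite (f -` F)" using that assms(2) by (simp add: finite_vimageI)
    have "(\<Sum>j\<in>F. norm (extend f x j) powr p) = (\<Sum>j\<in>f ` (f -` F). norm (extend f x j) powr p)"
      by (intro sum.mono_neutral_right) (use that in \<open>auto simp: extend_def\<close>)
    also have "\<dots> = (\<Sum>i\<in>f -` F. norm (x i) powr p)"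
      using assms(2) by (subst sum.reindex) (auto simp: inj_on_def)
    finally show ?thesis using sum_le_lpnorm[OF assms(1) fin] by simp
  qed
  from lp_boundedI[OF this] show "extend f x \<in> lp p" "lpnorm p (extend f x) \<le> lpnorm p x" by auto
qed

lemma lp_tail_small:
  assumes "x \<in> lp p" "0 < e"
  obtains F where "finite F" "lpnorm p (cut (- F) x) \<le> e"
proof -
  have ep: "0 < e powr p" using assms(2) by simp
  obtain F where F: "finite F" "dist (\<Sum>i\<in>F. norm (x i) powr p) (infsum (\<lambda>i. norm (x i) powr p) UNIV) \<le> e powr p"
    using infsum_finite_approximation[OF lp_summable[OF assms(1)] ep, of UNIV] by auto
  have "(\<Sum>i\<in>G. norm (cut (- F) x i) powr p) \<le> e powr p" if "finite G" for G
  proof -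
    have "(\<Sum>i\<in>G. norm (cut (- F) x i) powr p) = (\<Sum>i\<in>G - F. norm (x i) powr p)"
      by (rule sum.mono_neutral_cong_right) (use that p_pos in \<open>auto simp: cut_def\<close>)
    moreover have "(\<Sum>i\<in>F. norm (x i) powr p) + (\<Sum>i\<in>G - F. norm (x i) powr p) \<le> lpnorm p x powr p"
      using sum_le_lpnorm[OF assms(1), of "F \<union> (G - F)"] F(1) that by (subst sum.union_disjoint[symmetric]) auto
    ultimately show ?thesis using F(2) by (auto simp: dist_real_def lpnorm_powr)
  qed
  from lp_boundedI[OF this] assms(2) have "lpnorm p (cut (- F) x) \<le> e" by auto
  with F(1) that show thesis by blast
qed

text \<open>Fatou's lemma: a finite partial sum depends continuously on finitely many coordinates,
  so no convergence in norm is needed.\<close>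

lemma lp_pointwise_limit:
  assumes "\<And>n. y n \<in> lp p" "\<And>n. lpnorm p (y n) \<le> B" "\<And>i. (\<lambda>n. y n i) \<longlonglongrightarrow> z i"
  shows "z \<in> lp p" "lpnorm p z \<le> B"
proof -
  have B: "0 \<le> B" using assms(2)[of 0] lpnorm_nonneg order_trans by blast
  have "(\<Sum>i\<in>F. norm (z i) powr p) \<le> B powr p" if "finite F" for F
  proof (rule LIMSEQ_le_const2)
    show "(\<lambda>n. \<Sum>i\<in>F. norm (y n i) powr p) \<longlonglongrightarrow> (\<Sum>i\<in>F. norm (z i) powr p)"
      using p_pos by (intro tendsto_sum tendsto_powr' tendsto_norm assms(3) tendsto_const) auto
    have "(\<Sum>i\<in>F. norm (y n i) powr p) \<le> B powr p" for n
      using sum_le_lpnorm[OF assms(1)[of n] that] powr_mono2[of p "lpnorm p (y n)" B] assms(2)[of n] p_pos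
      by simp
    then show "\<exists>N. \<forall>n\<ge>N. (\<Sum>i\<in>F. norm (y n i) powr p) \<le> B powr p" by blast
  qed
  from lp_boundedI[OF this B] show "z \<in> lp p" "lpnorm p z \<le> B" by auto
qed

end

section \<open>Bounded and compact operators\<close>

context lp_exponent
begin

text \<open>The bound is part of the predicate, so estimates compose by arithmetic on
  \<open>C\<close>. Domain and codomain may have different index types, as the embeddings of
  summands require.\<close>

definition opb :: "real \<Rightarrow> (('i \<Rightarrow> complex) \<Rightarrow> ('j \<Rightarrow> complex)) \<Rightarrow> bool" where
  "opb C T \<longleftrightarrow> 0 \<le> C \<and>
     (\<forall>x\<in>lp p. T x \<in> lp p) \<and> (\<forall>x\<in>lp p. lpnorm p (T x) \<le> C * lpnorm p x) \<and>
     (\<forall>x\<in>lp p. \<forall>y\<in>lp p. T (x + y) = T x + T y) \<and>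
     (\<forall>c. \<forall>x\<in>lp p. T (mul (\<lambda>_. c) x) = mul (\<lambda>_. c) (T x))"

lemma opbI:
  assumes "0 \<le> C" "\<And>x. x \<in> lp p \<Longrightarrow> T x \<in> lp p" "\<And>x. x \<in> lp p \<Longrightarrow> lpnorm p (T x) \<le> C * lpnorm p x"
    "\<And>x y. x \<in> lp p \<Longrightarrow> y \<in> lp p \<Longrightarrow> T (x + y) = T x + T y"
    "\<And>c x. x \<in> lp p \<Longrightarrow> T (mul (\<lambda>_. c) x) = mul (\<lambda>_. c) (T x)"
  shows "opb C T"
  using assms by (simp add: opb_def)

lemma opbD:
  assumes "opb C T"
  shows opb_const_nonneg: "0 \<le> C"
    and opb_lp: "x \<in> lp p \<Longrightarrow> T x \<in> lp p"
    and opb_bound: "x \<in> lp p \<Longrightarrow> lpnorm p (T x) \<le> C * lpnorm p x"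
    and opb_add: "x \<in> lp p \<Longrightarrow> y \<in> lp p \<Longrightarrow> T (x + y) = T x + T y"
    and opb_scale: "x \<in> lp p \<Longrightarrow> T (mul (\<lambda>_. c) x) = mul (\<lambda>_. c) (T x)"
  using assms by (auto simp: opb_def)

lemma bop_iff_opb: "bop p T \<longleftrightarrow> (\<exists>C. opb C T)"
proof
  assume *: "bop p T"
  then obtain C where C: "\<And>x. x \<in> lp p \<Longrightarrow> lpnorm p (T x) \<le> C * lpnorm p x"
    unfolding bop_def by blast
  have "opb (max C 0) T"
  proof (rule opbI)
    fix x :: "'a \<Rightarrow> complex" assume "x \<in> lp p"
    then show "lpnorm p (T x) \<le> max C 0 * lpnorm p x"
      using C[of x] mult_right_mono[of C "max C 0" "lpnorm p x"] by auto
  qed (use * in \<open>auto simp: bop_def mul_def plus_fun_def\<close>)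
  then show "\<exists>C. opb C T" ..
qed (auto simp: bop_def opb_def mul_def plus_fun_def)

lemma opb_uminus: assumes "opb C T" "x \<in> lp p" shows "T (- x) = - T x"
  using opb_scale[OF assms, of "- 1"] by (simp add: uminus_eq_scale)

lemma opb_diff: assumes "opb C T" "x \<in> lp p" "y \<in> lp p" shows "T (x - y) = T x - T y"
  using opb_add[OF assms(1), of x "- y"] opb_uminus[OF assms(1,3)] assms by simp

lemma opb_zero: assumes "opb C T" shows "T 0 = 0"
  using opb_add[OF assms, of 0 0] by simp

lemma lp_sum: "finite A \<Longrightarrow> (\<And>n. n \<in> A \<Longrightarrow> x n \<in> lp p) \<Longrightarrow> (\<Sum>n\<in>A. x n) \<in> lp p"
  by (induction rule: finite_induct) (auto intro: lp_add)

lemma opb_sum: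
  assumes "opb C T" "finite A" "\<And>n. n \<in> A \<Longrightarrow> x n \<in> lp p"
  shows "T (\<Sum>n\<in>A. x n) = (\<Sum>n\<in>A. T (x n))"
  using assms(2,3) by (induction rule: finite_induct) (auto simp: opb_zero[OF assms(1)] opb_add[OF assms(1)] lp_sum)

lemma opb_mono: "opb C T \<Longrightarrow> C \<le> D \<Longrightarrow> opb D T"
  unfolding opb_def by (meson lpnorm_nonneg mult_right_mono order_trans)

lemma opb_cong:
  assumes "opb C T" "\<And>x. x \<in> lp p \<Longrightarrow> T' x = T x"
  shows "opb C T'"
  using assms by (auto simp: opb_def lp_add)

lemma opb_comp:
  assumes "opb C T" "opb D S" shows "opb (C * D) (\<lambda>x. T (S x))"
proof (rule opbI)
  fix x :: "'c \<Rightarrow> complex" assume "x \<in> lp p"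
  then show "lpnorm p (T (S x)) \<le> C * D * lpnorm p x"
    using opb_bound[OF assms(1) opb_lp[OF assms(2)]]
      mult_left_mono[OF opb_bound[OF assms(2)] opb_const_nonneg[OF assms(1)]]
    by (fastforce simp: mult.assoc)
qed (simp_all add: opb_lp[OF assms(1)] opb_lp[OF assms(2)] opb_add[OF assms(1)] opb_add[OF assms(2)]
    opb_scale[OF assms(1)] opb_scale[OF assms(2)] opb_const_nonneg[OF assms(1)] opb_const_nonneg[OF assms(2)])

lemma mul_add: "mul f (x + y) = mul f x + mul f y"
  by (auto simp: mul_def fun_eq_iff algebra_simps)

lemma opb_plus:
  assumes "opb C T" "opb D S" shows "opb (C + D) (\<lambda>x. T x + S x)"
proof (rule opbI)
  fix x :: "'a \<Rightarrow> complex" assume x: "x \<in> lp p"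
  show "lpnorm p (T x + S x) \<le> (C + D) * lpnorm p x"
    using lp_add(2)[OF opb_lp[OF assms(1) x] opb_lp[OF assms(2) x]]
      opb_bound[OF assms(1) x] opb_bound[OF assms(2) x] by (simp add: distrib_right)
qed (simp_all add: opb_lp[OF assms(1)] opb_lp[OF assms(2)] opb_add[OF assms(1)] opb_add[OF assms(2)] lp_add
    opb_scale[OF assms(1)] opb_scale[OF assms(2)] opb_const_nonneg[OF assms(1)] opb_const_nonneg[OF assms(2)]
    algebra_simps mul_add)

lemma opb_neg: "opb C T \<Longrightarrow> opb C (\<lambda>x. - T x)"
  by (auto simp: opb_def mul_def fun_eq_iff)

lemma opb_minus: "opb C T \<Longrightarrow> opb D S \<Longrightarrow> opb (C + D) (\<lambda>x. T x - S x)"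
  using opb_plus[OF _ opb_neg, of C T D S] by simp

lemma opb_zero_op: "opb 0 (\<lambda>x. 0)"
  by (auto simp: opb_def mul_def fun_eq_iff)

lemma opb_id: "opb 1 (\<lambda>x. x)"
  by (auto simp: opb_def)

lemma opb_sum_op:
  assumes "finite A" "\<And>n. n \<in> A \<Longrightarrow> opb (C n) (T n)"
  shows "opb (\<Sum>n\<in>A. C n) (\<lambda>x. \<Sum>n\<in>A. T n x)"
  using assms by (induction rule: finite_induct) (auto intro: opb_zero_op opb_plus)

lemma opb_mul: "(\<And>j. norm (f j) \<le> C) \<Longrightarrow> opb C (mul f)"
  by (intro opbI lp_mul) (auto intro: order_trans[OF norm_ge_zero] simp: mul_def fun_eq_iff algebra_simps)

lemma opb_cut: "opb 1 (cut A)"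
  unfolding cut_eq_mul[abs_def] by (rule opb_mul) (auto simp: indicator_def)

lemma opb_reindex: "inj f \<Longrightarrow> opb 1 (\<lambda>x. x \<circ> f)"
  by (intro opbI) (auto intro: lp_reindex simp: lp_reindex mul_def fun_eq_iff)

lemma opb_extend: "inj f \<Longrightarrow> opb 1 (extend f)"
  by (intro opbI) (simp_all add: lp_extend, auto simp: mul_def extend_def fun_eq_iff)

text \<open>Coordinatewise convergence preserves the bound by the Fatou argument. This allows a
  series of operators that converges only coordinatewise to be estimated through its finite
  sections.\<close>

lemma opb_limit:
  assumes "\<And>n. opb C (T n)" "\<And>x j. x \<in> lp p \<Longrightarrow> (\<lambda>n. T n x j) \<longlonglongrightarrow> S x j"
  shows "opb C S"
proof (rule opbI)
  show "0 \<le> C" using assms(1)[of 0] by (rule opb_const_nonneg)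
  show "S x \<in> lp p" "lpnorm p (S x) \<le> C * lpnorm p x" if "x \<in> lp p" for x
    by (rule lp_pointwise_limit[OF opb_lp[OF assms(1) that] opb_bound[OF assms(1) that] assms(2)[OF that]])+
  show "S (x + y) = S x + S y" if "x \<in> lp p" "y \<in> lp p" for x y
  proof
    fix j
    have "(\<lambda>n. T n x j + T n y j) \<longlonglongrightarrow> S x j + S y j" by (intro tendsto_add assms that)
    moreover have "(\<lambda>n. T n x j + T n y j) \<longlonglongrightarrow> S (x + y) j"
      using assms(2)[OF lp_add(1)[OF that], of j] that by (simp add: opb_add[OF assms(1)])
    ultimately show "S (x + y) j = (S x + S y) j" by (simp add: LIMSEQ_unique)
  qed
  show "S (mul (\<lambda>_. c) x) = mul (\<lambda>_. c) (S x)" if "x \<in> lp p" for c x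
  proof
    fix j
    have "(\<lambda>n. c * T n x j) \<longlonglongrightarrow> c * S x j" by (intro tendsto_mult tendsto_const assms that)
    moreover have "(\<lambda>n. c * T n x j) \<longlonglongrightarrow> S (mul (\<lambda>_. c) x) j"
      using assms(2)[OF lp_scale[OF that], of c j] that by (simp add: opb_scale[OF assms(1)]) (simp add: mul_def)
    ultimately show "S (mul (\<lambda>_. c) x) j = mul (\<lambda>_. c) (S x) j" by (simp add: LIMSEQ_unique mul_def)
  qed
qed

text \<open>On countable index types this is equivalent to \<open>compact_op\<close>, see \<open>compact_op_if_cpt\<close> and
  \<open>cpt_if_compact_op\<close>; it says that the operator is a norm limit of its truncations to finitely many rows.\<close>

definition cpt :: "(('i \<Rightarrow> complex) \<Rightarrow> ('j \<Rightarrow> complex)) \<Rightarrow> bool" where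
  "cpt T \<longleftrightarrow> (\<exists>C. opb C T) \<and> (\<forall>e>0. \<exists>F. finite F \<and> opb e (\<lambda>x. cut (- F) (T x)))"

lemma cut_add: "cut A (x + y) = cut A x + cut A y"
  and cut_diff: "cut A (x - y) = cut A x - cut A y"
  and cut_zero: "cut A 0 = 0"
  and cut_minus: "cut A (- x) = - cut A x"
  and cut_scale: "cut A (mul f x) = mul f (cut A x)"
  by (auto simp: cut_def fun_eq_iff mul_def)

lemma cut_empty: "cut {} x = 0"
  by (auto simp: cut_def fun_eq_iff)

lemma opb_cut_subset:
  assumes "opb e (\<lambda>x. cut (- F) (T x))" "F \<subseteq> G"
  shows "opb e (\<lambda>x. cut (- G) (T x))"
proof -
  have "cut (- G) y = cut (- G) (cut (- F) y)" for y :: "'b \<Rightarrow> complex"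
    using assms(2) by (auto simp: cut_cut cut_def fun_eq_iff)
  then show ?thesis using opb_comp[OF opb_cut assms(1), of "- G"] by (simp flip: opb_def)
qed

lemma cpt_opb: "cpt T \<Longrightarrow> \<exists>C. opb C T"
  by (simp add: cpt_def)

lemma cpt_cong:
  assumes "cpt T" "\<And>x. x \<in> lp p \<Longrightarrow> T' x = T x"
  shows "cpt T'"
proof -
  have "opb C T'" if "opb C T" for C using opb_cong[OF that] assms(2) by blast
  moreover have "opb C (\<lambda>x. cut (- F) (T' x))" if "opb C (\<lambda>x. cut (- F) (T x))" for C F
    using opb_cong[OF that] assms(2) by auto
  ultimately show ?thesis using assms(1) unfolding cpt_def by blast
qed

lemma cpt_approx:
  assumes "opb C T" "\<And>e. 0 < e \<Longrightarrow> \<exists>K. cpt K \<and> opb e (\<lambda>x. T x - K x)"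
  shows "cpt T"
  unfolding cpt_def
proof (intro conjI allI impI)
  fix e :: real assume e: "0 < e"
  then obtain K where K: "cpt K" "opb (e / 2) (\<lambda>x. T x - K x)" using assms(2)[of "e / 2"] by auto
  then obtain F where F: "finite F" "opb (e / 2) (\<lambda>x. cut (- F) (K x))"
    using e unfolding cpt_def by (meson half_gt_zero)
  have "opb (1 * (e / 2) + e / 2) (\<lambda>x. cut (- F) (T x - K x) + cut (- F) (K x))"
    by (intro opb_plus F opb_comp[OF opb_cut] K)
  then show "\<exists>F. finite F \<and> opb e (\<lambda>x. cut (- F) (T x))"
    using F(1) by (auto simp: cut_add[symmetric])
qed (use assms(1) in blast)

lemma cpt_plus:
  assumes "cpt T" "cpt S" shows "cpt (\<lambda>x. T x + S x)"
  unfolding cpt_def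
proof (intro conjI allI impI)
  fix e :: real assume e: "0 < e"
  then obtain F G where F: "finite F" "opb (e / 2) (\<lambda>x. cut (- F) (T x))"
    and G: "finite G" "opb (e / 2) (\<lambda>x. cut (- G) (S x))"
    using assms unfolding cpt_def by (meson half_gt_zero)
  have "opb (e / 2 + e / 2) (\<lambda>x. cut (- (F \<union> G)) (T x) + cut (- (F \<union> G)) (S x))"
    by (intro opb_plus opb_cut_subset[OF F(2)] opb_cut_subset[OF G(2)]) auto
  then show "\<exists>F. finite F \<and> opb e (\<lambda>x. cut (- F) (T x + S x))"
    using F(1) G(1) by (auto simp: cut_add intro!: exI[of _ "F \<union> G"])
qed (use assms opb_plus[of _ T _ S] in \<open>unfold cpt_def, blast\<close>)

lemma cpt_neg: "cpt T \<Longrightarrow> cpt (\<lambda>x. - T x)"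
  unfolding cpt_def cut_minus using opb_neg[of _ T] opb_neg[of _ "\<lambda>x. cut _ (T x)"] by blast

lemma cpt_minus: "cpt T \<Longrightarrow> cpt S \<Longrightarrow> cpt (\<lambda>x. T x - S x)"
  using cpt_plus[OF _ cpt_neg, of T S] by simp

lemma cpt_zero: "cpt (\<lambda>x. 0)"
  unfolding cpt_def by (auto simp: cut_zero intro: opb_zero_op opb_mono[OF opb_zero_op])

lemma cpt_sum_op: "finite A \<Longrightarrow> (\<And>n. n \<in> A \<Longrightarrow> cpt (T n)) \<Longrightarrow> cpt (\<lambda>x. \<Sum>n\<in>A. T n x)"
  by (induction rule: finite_induct) (auto intro: cpt_zero cpt_plus)

lemma cpt_comp_right:
  assumes "cpt T" "opb D S" shows "cpt (\<lambda>x. T (S x))"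
  unfolding cpt_def
proof (intro conjI allI impI)
  fix e :: real assume e: "0 < e"
  have D: "0 \<le> D" using assms(2) by (rule opb_const_nonneg)
  then have "0 < e / (D + 1)" using e by simp
  then obtain F where F: "finite F" "opb (e / (D + 1)) (\<lambda>x. cut (- F) (T x))"
    using assms(1) unfolding cpt_def by blast
  have "e / (D + 1) * D \<le> e" using D e by (simp add: field_simps)
  with opb_mono[OF opb_comp[OF F(2) assms(2)]]
  show "\<exists>F. finite F \<and> opb e (\<lambda>x. cut (- F) (T (S x)))" using F(1) by blast
qed (use assms opb_comp[of _ T _ S] in \<open>unfold cpt_def, blast\<close>)

lemma cpt_rank_one:
  assumes "y \<in> lp p" shows "cpt (\<lambda>x. mul (\<lambda>_. x i) y)"
proof -
  have *: "opb (lpnorm p z) (\<lambda>x. mul (\<lambda>_. x i) z)" if "z \<in> lp p" for z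
  proof (rule opbI)
    show "lpnorm p (mul (\<lambda>_. x i) z) \<le> lpnorm p z * lpnorm p x" if "x \<in> lp p" for x
      using norm_le_lpnorm[OF that, of i] \<open>z \<in> lp p\<close> by (simp add: lpnorm_scale mult.commute[of "norm _"] mult_left_mono)
  qed (simp_all add: that, auto simp: mul_def fun_eq_iff algebra_simps)
  show ?thesis
    unfolding cpt_def
  proof (intro conjI allI impI)
    fix e :: real assume "0 < e"
    then obtain F where "finite F" "lpnorm p (cut (- F) y) \<le> e" using lp_tail_small[OF assms] by blast
    then show "\<exists>F. finite F \<and> opb e (\<lambda>x. cut (- F) (mul (\<lambda>_. x i) y))"
      using opb_mono[OF *[OF lp_cut(1)[OF assms]]] by (auto simp: cut_scale)
  qed (use *[OF assms] in blast)
qed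

lemma lp_finite_support: assumes "finite F" shows "cut F x \<in> lp p"
proof -
  have "(\<lambda>i. norm (cut F x i) powr p) summable_on UNIV"
    by (rule summable_on_cong_neutral[where T = F, THEN iffD2])
      (use assms p_pos in \<open>auto simp: cut_def\<close>)
  then show ?thesis by (simp add: lp_def)
qed

text \<open>Finite rank: the operator is the sum over \<open>i \<in> F\<close> of the maps sending
  \<open>x\<close> to \<open>x i\<close> times the image of the \<open>i\<close>-th unit
  vector.\<close>

lemma cpt_comp_cut:
  assumes "opb C T" "finite F" shows "cpt (\<lambda>x. T (cut F x))"
proof -
  have "cpt (\<lambda>x. \<Sum>i\<in>F. mul (\<lambda>_. x i) (T (cut {i} (\<lambda>_. 1))))"
    by (intro cpt_sum_op assms cpt_rank_one opb_lp[OF assms(1)] lp_finite_support) auto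
  then show ?thesis
  proof (rule cpt_cong)
    fix x :: "'a \<Rightarrow> complex" assume "x \<in> lp p"
    have "cut F x = (\<Sum>i\<in>F. mul (\<lambda>_. x i) (cut {i} (\<lambda>_. 1)))"
    proof
      fix j
      have "(\<Sum>i\<in>F. mul (\<lambda>_. x i) (cut {i} (\<lambda>_. 1))) j = (\<Sum>i\<in>F. if i = j then x i else 0)"
        by (induction F rule: infinite_finite_induct) (auto simp: mul_def cut_def)
      then show "cut F x j = (\<Sum>i\<in>F. mul (\<lambda>_. x i) (cut {i} (\<lambda>_. 1))) j"
        using assms(2) by (simp add: cut_def)
    qed
    then show "T (cut F x) = (\<Sum>i\<in>F. mul (\<lambda>_. x i) (T (cut {i} (\<lambda>_. 1))))"
      by (simp add: opb_sum[OF assms] opb_scale[OF assms(1)] lp_finite_support)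
  qed
qed

text \<open>Truncating rows does not commute with \<open>S\<close>, so \<open>T\<close> is truncated
  first: \<open>S (cut F (T x))\<close> factors through finitely many coordinates, and the remainder
  is small in norm.\<close>

lemma cpt_comp_left:
  assumes "opb C S" "cpt T" shows "cpt (\<lambda>x. S (T x))"
proof -
  obtain D where D: "opb D T" using assms(2) cpt_opb by blast
  have C: "0 \<le> C" using assms(1) by (rule opb_const_nonneg)
  show ?thesis
  proof (rule cpt_approx[OF opb_comp[OF assms(1) D]])
    fix e :: real assume e: "0 < e"
    then have "0 < e / (C + 1)" using C by simp
    then obtain F where F: "finite F" "opb (e / (C + 1)) (\<lambda>x. cut (- F) (T x))"
      using assms(2) unfolding cpt_def by blast
    have le: "C * (e / (C + 1)) \<le> e" using C e by (simp add: field_simps)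
    have "cpt (\<lambda>x. S (cut F (T x)))"
      using cpt_comp_right[OF cpt_comp_cut[OF assms(1) F(1)] D] .
    moreover have "opb e (\<lambda>x. S (T x) - S (cut F (T x)))"
    proof (rule opb_cong[OF opb_mono[OF opb_comp[OF assms(1) F(2)] le]])
      fix x :: "'c \<Rightarrow> complex" assume x: "x \<in> lp p"
      have "cut (- F) (T x) = T x - cut F (T x)" by (metis cut_add_compl add_diff_cancel_left')
      then show "S (T x) - S (cut F (T x)) = S (cut (- F) (T x))"
        using opb_diff[OF assms(1)] opb_lp[OF D x] lp_cut(1) by metis
    qed
    ultimately show "\<exists>K. cpt K \<and> opb e (\<lambda>x. S (T x) - K x)" by blast
  qed
qed

lemma cpt_cut_comp:
  assumes "opb C T" "finite F" shows "cpt (\<lambda>x. cut F (T x))"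
  unfolding cpt_def
proof (intro conjI allI impI)
  show "\<exists>C. opb C (\<lambda>x. cut F (T x))" using opb_comp[OF opb_cut assms(1)] by blast
  fix e :: real assume "0 < e"
  then have "opb e (\<lambda>x. cut (- F) (cut F (T x)))"
    using opb_mono[OF opb_zero_op, of e] unfolding cut_cut Compl_disjoint2 cut_empty by simp
  then show "\<exists>F'. finite F' \<and> opb e (\<lambda>x. cut (- F') (cut F (T x)))"
    using assms(2) by blast
qed

section \<open>Tails of rows and of compact operators\<close>

lemma lp_disjoint_add:
  assumes "x \<in> lp p" "y \<in> lp p" "\<And>j. x j = 0 \<or> y j = 0"
  shows "lpnorm p (x + y) powr p \<le> lpnorm p x powr p + lpnorm p y powr p"
proof -
  have "norm ((x + y) j) powr p = norm (x j) powr p + norm (y j) powr p" for j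
    using assms(3)[of j] p_pos by auto
  then show ?thesis
    unfolding lpnorm_powr using infsum_add[OF lp_summable[OF assms(1)] lp_summable[OF assms(2)]] by simp
qed

text \<open>This is where \<open>p > 1\<close> is needed: if a functional \<open>\<phi>\<close> had norm about \<open>L > 0\<close> on every tail,
  then two almost norming vectors with disjoint supports in a tail would give \<open>2 L \<le> 2 powr (1 / p) * L\<close>.\<close>

lemma row_tail_functional:
  assumes T: "opb C T" and e: "0 < e"
  shows "\<exists>G. finite G \<and> (\<forall>x\<in>lp p. norm (T (cut (- G) x) i) \<le> e * lpnorm p x)"
proof -
  define B where "B G r \<longleftrightarrow> (\<forall>x\<in>lp p. norm (T (cut (- G) x) i) \<le> r * lpnorm p x)" for G r
  define E where "E = {r. 0 \<le> r \<and> (\<exists>G. finite G \<and> B G r)}"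
  \<comment> \<open>The limiting norm of the functional on tails; everything below shows that it
    vanishes.\<close>
  define L where "L = Inf E"
  have C: "0 \<le> C" using T by (rule opb_const_nonneg)
  have phi: "norm (T x i) \<le> C * lpnorm p x" if "x \<in> lp p" for x
    using norm_le_lpnorm[OF opb_lp[OF T that], of i] opb_bound[OF T that] by simp
  have "B {} C"
    unfolding B_def using phi by (simp add: cut_def)
  then have "C \<in> E" using C by (auto simp: E_def)
  then have E: "E \<noteq> {}" "bdd_below E" by (auto simp: E_def intro: bdd_belowI[of _ 0])
  have L0: "0 \<le> L" unfolding L_def by (rule cInf_greatest) (use E in \<open>auto simp: E_def\<close>)
  have "L \<le> 0"
  proof (rule ccontr)
    assume "\<not> L \<le> 0"
    define q where "q = (2::real) powr (1 / p)"
    have q: "0 < q" "q < 2"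
      using powr_less_mono[of "1 / p" 1 2] p_gt_1 by (auto simp: q_def)
    \<comment> \<open>The final inequality \<open>(2 - q) * L < (3 + q) * d\<close> is then absurd,
      as \<open>q < 2\<close> gives \<open>(3 + q) * d < 6 * d = (2 - q) * L\<close>.\<close>
    define d where "d = (2 - q) * L / 6"
    have d: "0 < d" using \<open>\<not> L \<le> 0\<close> q by (simp add: d_def)
    have "6 * d \<le> 2 * L" using \<open>\<not> L \<le> 0\<close> q by (simp add: d_def)
    then have dL: "0 \<le> L - d" using d \<open>\<not> L \<le> 0\<close> by simp
    have witness: "\<exists>x\<in>lp p. lpnorm p x = 1 \<and> T (cut (- G) x) i = of_real (norm (T (cut (- G) x) i))
        \<and> L - d < norm (T (cut (- G) x) i)" if "finite G" for G
    proof -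
      have "\<not> B G (L - d)"
      proof
        assume "B G (L - d)"
        then have "L - d \<in> E" using that dL by (auto simp: E_def)
        then have "L \<le> L - d" unfolding L_def using E(2) by (rule cInf_lower)
        then show False using d by simp
      qed
      then obtain x where x: "x \<in> lp p" "(L - d) * lpnorm p x < norm (T (cut (- G) x) i)"
        by (auto simp: B_def not_le)
      define w where "w = T (cut (- G) x) i"
      have "0 \<le> (L - d) * lpnorm p x" using dL by simp
      then have w: "w \<noteq> 0" using x(2) by (auto simp: w_def)
      have xn: "lpnorm p x \<noteq> 0"
        using w lpnorm_eq_0D[OF x(1)] opb_zero[OF T] by (auto simp: w_def cut_zero)
      have xp: "0 < lpnorm p x" using xn lpnorm_nonneg[of x] by linarith
      \<comment> \<open>The scalar normalizes \<open>x\<close> and rotates the value of the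
        functional onto the positive real axis, so that two such values add up without
        cancellation.\<close>
      define c where "c = of_real (norm w / lpnorm p x) / w"
      have nc: "norm c = 1 / lpnorm p x" using w xp by (simp add: c_def norm_divide norm_mult)
      have Tc: "T (cut (- G) (mul (\<lambda>_. c) x)) i = of_real (norm w / lpnorm p x)"
        using opb_scale[OF T lp_cut(1)[OF x(1)]] w
        by (simp add: cut_scale) (simp add: mul_def c_def w_def)
      show ?thesis
      proof (rule bexI[of _ "mul (\<lambda>_. c) x"])
        show "mul (\<lambda>_. c) x \<in> lp p" using x(1) by simp
        show "lpnorm p (mul (\<lambda>_. c) x) = 1 \<and> T (cut (- G) (mul (\<lambda>_. c) x)) i =
           of_real (norm (T (cut (- G) (mul (\<lambda>_. c) x)) i)) \<and> L - d < norm (T (cut (- G) (mul (\<lambda>_. c) x)) i)"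
          unfolding Tc using x xp nc w by (auto simp: lpnorm_scale norm_divide field_simps w_def)
      qed
    qed
    obtain r where r: "r \<in> E" "r < L + d"
      using cInf_lessD[OF E(1), of "L + d"] d by (auto simp: L_def)
    then obtain G where G: "finite G" "B G r" by (auto simp: E_def)
    obtain x where x: "x \<in> lp p" "lpnorm p x = 1" "T (cut (- G) x) i = of_real (norm (T (cut (- G) x) i))"
      "L - d < norm (T (cut (- G) x) i)" using witness[OF G(1)] by blast
    have "0 < d / (C + 1)" using d C by simp
    from lp_tail_small[OF x(1) this] obtain G' where G': "finite G'" "lpnorm p (cut (- G') x) \<le> d / (C + 1)"
      by blast
    \<comment> \<open>Enlarging \<open>G\<close> by \<open>G'\<close> makes the second vector
      disjoint from the bulk \<open>x1\<close> of the first, while dropping the rest of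
      \<open>x\<close> costs at most \<open>d\<close>.\<close>
    define H where "H = G \<union> G'"
    have H: "finite H" using G G' by (simp add: H_def)
    obtain y where y: "y \<in> lp p" "lpnorm p y = 1" "T (cut (- H) y) i = of_real (norm (T (cut (- H) y) i))"
      "L - d < norm (T (cut (- H) y) i)" using witness[OF H] by blast
    define x1 where "x1 = cut (H - G) x"
    define y1 where "y1 = cut (- H) y"
    have lp1: "x1 \<in> lp p" "y1 \<in> lp p" using x y by (simp_all add: x1_def y1_def lp_cut)
    have split: "cut (- G) x = x1 + cut (- H) x" by (auto simp: x1_def cut_def fun_eq_iff H_def)
    have "norm (T (cut (- H) x) i) \<le> C * lpnorm p (cut (- H) x)" using phi lp_cut(1)[OF x(1)] by blast
    also have "\<dots> \<le> C * (d / (C + 1))"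
    proof (rule mult_left_mono[OF _ C])
      have "cut (- H) x = cut (- H) (cut (- G') x)" by (auto simp: cut_def H_def fun_eq_iff)
      then show "lpnorm p (cut (- H) x) \<le> d / (C + 1)"
        using lp_cut(2)[OF lp_cut(1)[OF x(1)], of "- H" "- G'"] G'(2) by simp
    qed
    also have "\<dots> \<le> d" using C d by (simp add: field_simps)
    finally have small: "norm (T (cut (- H) x) i) \<le> d" .
    have Tx1: "T x1 i = T (cut (- G) x) i - T (cut (- H) x) i"
      using opb_add[OF T lp1(1) lp_cut(1)[OF x(1)], of "- H"] by (simp add: split)
    have Ry: "L - d < Re (T y1 i)" using y(3,4) by (metis y1_def Re_complex_of_real)
    have "Re (T (cut (- G) x) i) = norm (T (cut (- G) x) i)" using x(3) by (metis Re_complex_of_real)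
    then have Rx: "L - 2 * d < Re (T x1 i)"
      using small x(4) complex_Re_le_cmod[of "T (cut (- H) x) i"] by (simp add: Tx1)
    have "lpnorm p (x1 + y1) powr p \<le> lpnorm p x1 powr p + lpnorm p y1 powr p"
      by (rule lp_disjoint_add[OF lp1]) (auto simp: x1_def y1_def cut_def)
    also have "\<dots> \<le> 1 powr p + 1 powr p"
      using lp_cut(2)[OF x(1), of "H - G"] lp_cut(2)[OF y(1), of "- H"] x(2) y(2) p_pos
      by (intro add_mono powr_mono2) (auto simp: x1_def y1_def)
    finally have "lpnorm p (x1 + y1) powr p \<le> 2" by simp
    then have "lpnorm p (x1 + y1) \<le> q"
      using powr_mono2[of "1 / p" "lpnorm p (x1 + y1) powr p" 2] p_pos by (simp add: q_def)
    moreover have "cut (- G) (x1 + y1) = x1 + y1"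
      by (auto simp: x1_def y1_def cut_def fun_eq_iff H_def)
    ultimately have "norm (T (x1 + y1) i) \<le> r * q"
      using G(2) lp_add(1)[OF lp1] r(1) unfolding B_def E_def
      by (metis (no_types, lifting) mem_Collect_eq mult_left_mono order_trans)
    moreover have "Re (T (x1 + y1) i) = Re (T x1 i) + Re (T y1 i)"
      by (simp add: opb_add[OF T lp1])
    ultimately have "2 * L - 3 * d < r * q"
      using Rx Ry complex_Re_le_cmod[of "T (x1 + y1) i"] by simp
    also have "r * q \<le> (L + d) * q" using r(2) q by simp
    finally have "(2 - q) * L < (3 + q) * d" by (simp add: algebra_simps)
    moreover have "(3 + q) * d < 6 * d" using q d by simp
    ultimately show False by (simp add: d_def)
  qed
  then have "Inf E < e" using e by (simp add: L_def)
  then obtain r where "r \<in> E" "r < e" using cInf_lessD[OF E(1)] by blast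
  then obtain G where "finite G" "B G r" by (auto simp: E_def)
  moreover have "r * lpnorm p x \<le> e * lpnorm p x" for x :: "'a \<Rightarrow> complex" using \<open>r < e\<close> by (simp add: mult_right_mono)
  ultimately show ?thesis unfolding B_def using order_trans by blast
qed

lemma row_tail:
  assumes T: "opb C T" and F: "finite F" and e: "0 < e"
  shows "\<exists>G. finite G \<and> opb e (\<lambda>x. cut F (T (cut (- G) x)))"
  using F e
proof (induction F arbitrary: e rule: finite_induct)
  case empty
  then have "opb e (\<lambda>x. cut {} (T (cut (- {}) x)))"
    unfolding cut_empty using opb_mono[OF opb_zero_op, of e] by simp
  then show ?case by blast
next
  case (insert i F)
  then obtain G where G: "finite G" "opb (e / 2) (\<lambda>x. cut F (T (cut (- G) x)))"
    by (meson half_gt_zero)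
  obtain G' where G': "finite G'" "\<And>x. x \<in> lp p \<Longrightarrow> norm (T (cut (- G') x) i) \<le> e / 2 * lpnorm p x"
    using row_tail_functional[OF T, of "e / 2" i] insert.prems by auto
  define H where "H = G \<union> G'"
  have cuts: "cut (- H) x = cut (- G) (cut (- H) x)" "cut (- H) x = cut (- G') (cut (- H) x)" for x :: "'a \<Rightarrow> complex"
    by (auto simp: cut_def H_def fun_eq_iff)
  have 1: "opb (e / 2 * 1) (\<lambda>x. cut F (T (cut (- H) x)))"
    using opb_comp[OF G(2) opb_cut[of "- H"]] cuts(1) by (simp flip: cuts(1))
  have 2: "opb (e / 2) (\<lambda>x. cut {i} (T (cut (- H) x)))"
  proof -
    have *: "opb (1 * (C * 1)) (\<lambda>x. cut {i} (T (cut (- H) x)))"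
      by (intro opb_comp[OF opb_cut] opb_comp[OF T] opb_cut)
    have bd: "lpnorm p (cut {i} (T (cut (- H) x))) \<le> e / 2 * lpnorm p x" if x: "x \<in> lp p" for x
    proof (rule lp_boundedI)
      fix A :: "'b set" assume A: "finite A"
      have "norm (T (cut (- H) x) i) \<le> e / 2 * lpnorm p (cut (- H) x)"
        using G'(2)[OF lp_cut(1)[OF x], of "- H"] cuts(2)[of x] by simp
      also have "\<dots> \<le> e / 2 * lpnorm p x" using lp_cut(2)[OF x, of "- H"] insert.prems by simp
      finally have le: "norm (T (cut (- H) x) i) \<le> e / 2 * lpnorm p x" .
      have "(\<Sum>j\<in>A. norm (cut {i} (T (cut (- H) x)) j) powr p) = (\<Sum>j\<in>A \<inter> {i}. norm (T (cut (- H) x) j) powr p)"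
        by (rule sum.mono_neutral_cong_right) (use A p_pos in \<open>auto simp: cut_def\<close>)
      also have "\<dots> \<le> norm (T (cut (- H) x) i) powr p" by (cases "i \<in> A") auto
      also have "\<dots> \<le> (e / 2 * lpnorm p x) powr p" using le p_pos by (intro powr_mono2) auto
      finally show "(\<Sum>j\<in>A. norm (cut {i} (T (cut (- H) x)) j) powr p) \<le> (e / 2 * lpnorm p x) powr p" .
    qed (use insert.prems in auto)
    show ?thesis
      by (rule opbI[OF _ opb_lp[OF *] bd opb_add[OF *] opb_scale[OF *]]) (use insert.prems in auto)
  qed
  have eq: "cut (insert i F) y = cut F y + cut {i} y" for y :: "'b \<Rightarrow> complex"
    using insert.hyps by (auto simp: cut_def fun_eq_iff)
  have "opb e (\<lambda>x. cut (insert i F) (T (cut (- H) x)))"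
    using opb_plus[OF 1 2] by (simp add: eq)
  then show ?case using G(1) G'(1) by (auto simp: H_def)
qed

text \<open>Compactness controls the rows outside a finite set \<open>F\<close>, and
  \<open>row_tail\<close> controls the finitely many rows in \<open>F\<close>.\<close>

lemma cpt_right_tail:
  assumes "cpt K" "0 < e"
  shows "\<exists>G. finite G \<and> opb e (\<lambda>x. K (cut (- G) x))"
proof -
  obtain C where C: "opb C K" using assms(1) cpt_opb by blast
  have e2: "0 < e / 2" using assms(2) by simp
  obtain F where F: "finite F" "opb (e / 2) (\<lambda>x. cut (- F) (K x))"
    using assms(1) e2 unfolding cpt_def by blast
  obtain G where G: "finite G" "opb (e / 2) (\<lambda>x. cut F (K (cut (- G) x)))"
    using row_tail[OF C F(1) e2] by blast
  have "opb (e / 2 + e / 2 * 1) (\<lambda>x. cut F (K (cut (- G) x)) + cut (- F) (K (cut (- G) x)))"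
    by (intro opb_plus G opb_comp[OF F(2)] opb_cut)
  then show ?thesis using G(1) by (auto simp: cut_add_compl)
qed

end

section \<open>Direct sums of operators\<close>

context lp_exponent
begin

lemma sum_lpnorm_powr_le:
  assumes "finite A" "\<And>n. n \<in> A \<Longrightarrow> x n \<in> lp p" "y \<in> lp p"
    "\<And>i. (\<Sum>n\<in>A. norm (x n i) powr p) \<le> c * norm (y i) powr p"
  shows "(\<Sum>n\<in>A. lpnorm p (x n) powr p) \<le> c * lpnorm p y powr p"
proof -
  have "((\<lambda>i. \<Sum>n\<in>A. norm (x n i) powr p) has_sum (\<Sum>n\<in>A. lpnorm p (x n) powr p)) UNIV"
    using assms(1,2)
    by (induction rule: finite_induct) (auto simp: lpnorm_powr intro!: has_sum_add has_sum_infsum lp_summable)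
  moreover have "((\<lambda>i. c * norm (y i) powr p) has_sum (c * lpnorm p y powr p)) UNIV"
    unfolding lpnorm_powr by (intro has_sum_cmult_right has_sum_infsum lp_summable assms)
  ultimately show ?thesis by (rule has_sum_mono) (use assms(4) in auto)
qed

lemma sum_fun_apply: "(\<Sum>n\<in>A. f n) i = (\<Sum>n\<in>A. f n i)"
  by (induction A rule: infinite_finite_induct) auto

text \<open>The bound does not depend on the number of summands. At most two terms meet at an output
  coordinate, which costs \<open>2 powr p\<close> in the sum of \<open>p\<close>-th powers, and
  every input coordinate is counted at most twice, which is absorbed by
  \<open>2 \<le> 2 powr p\<close>. The \<open>p\<close>-th root of the product of both factors is
  \<open>4\<close>.\<close>

lemma opb_overlapping_sum:
  fixes J :: "nat \<Rightarrow> 'i set" and B :: "nat \<Rightarrow> ('i \<Rightarrow> complex) \<Rightarrow> 'i \<Rightarrow> complex"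
  assumes A: "finite A" and B: "\<And>n. n \<in> A \<Longrightarrow> opb e (B n)"
    and loc: "\<And>n x. n \<in> A \<Longrightarrow> x \<in> lp p \<Longrightarrow> B n x = cut (J n) (B n (cut (J n) x))"
    and mult: "\<And>i. \<exists>a. {n\<in>A. i \<in> J n} \<subseteq> {a, Suc a}"
    and e: "0 \<le> e"
  shows "opb (4 * e) (\<lambda>x. \<Sum>n\<in>A. B n x)"
proof -
  have *: "opb (\<Sum>n\<in>A. e) (\<lambda>x. \<Sum>n\<in>A. B n x)" by (intro opb_sum_op A B)
  have 2: "(2::real) \<le> 2 powr p" using powr_mono[of 1 p 2] p_gt_1 by simp
  have "lpnorm p (\<Sum>n\<in>A. B n x) \<le> 4 * e * lpnorm p x" if x: "x \<in> lp p" for x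
  proof (rule lp_boundedI)
    fix F :: "'i set" assume F: "finite F"
    have lpB: "B n x \<in> lp p" if "n \<in> A" for n using opb_lp[OF B[OF that] x] .
    have pt: "norm ((\<Sum>n\<in>A. B n x) i) powr p \<le> 2 powr p * (\<Sum>n\<in>A. norm (B n x i) powr p)" for i
    proof -
      obtain a where a: "{n\<in>A. i \<in> J n} \<subseteq> {a, Suc a}" using mult by blast
      \<comment> \<open>Terms outside \<open>A\<close> are set to zero, so that the sum can be
        written over \<open>{a, Suc a}\<close> whether or not these indices belong to
        \<open>A\<close>.\<close>
      define b where "b n = (if n \<in> A then norm (B n x i) else 0)" for n
      have z: "b n = 0" if "n \<notin> {a, Suc a}" for n
        using that a loc[of n x] x by (auto simp: b_def cut_def fun_eq_iff)
      have supp: "(\<Sum>n\<in>A. f (b n)) = f (b a) + f (b (Suc a))" if "f 0 = 0" for f :: "real \<Rightarrow> real"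
      proof -
        have "(\<Sum>n\<in>A. f (b n)) = (\<Sum>n\<in>A \<union> {a, Suc a}. f (b n))"
          using A that by (intro sum.mono_neutral_left) (auto simp: b_def)
        also have "\<dots> = (\<Sum>n\<in>{a, Suc a}. f (b n))"
          using A that z by (intro sum.mono_neutral_right) auto
        finally show ?thesis by simp
      qed
      have b0: "0 \<le> b n" for n by (simp add: b_def)
      have "norm ((\<Sum>n\<in>A. B n x) i) \<le> (\<Sum>n\<in>A. b n)"
        unfolding sum_fun_apply by (rule order_trans[OF norm_sum sum_mono]) (auto simp: b_def)
      also have "\<dots> = b a + b (Suc a)" using supp[of "\<lambda>t. t"] by simp
      also have "\<dots> \<le> 2 * max (b a) (b (Suc a))" by auto
      finally have "norm ((\<Sum>n\<in>A. B n x) i) powr p \<le> (2 * max (b a) (b (Suc a))) powr p"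
        using p_pos by (intro powr_mono2) auto
      also have "\<dots> = 2 powr p * max (b a) (b (Suc a)) powr p" by (rule powr_mult)
      also have "\<dots> \<le> 2 powr p * (b a powr p + b (Suc a) powr p)"
        by (intro mult_left_mono) (auto simp: max_def)
      also have "b a powr p + b (Suc a) powr p = (\<Sum>n\<in>A. norm (B n x i) powr p)"
        using supp[of "\<lambda>t. t powr p"] p_pos by (simp add: b_def)
      finally show ?thesis .
    qed
    have "(\<Sum>i\<in>F. norm ((\<Sum>n\<in>A. B n x) i) powr p) \<le> (\<Sum>i\<in>F. 2 powr p * (\<Sum>n\<in>A. norm (B n x i) powr p))"
      by (intro sum_mono pt)
    also have "\<dots> = 2 powr p * (\<Sum>n\<in>A. \<Sum>i\<in>F. norm (B n x i) powr p)"
      by (simp only: sum_distrib_left[symmetric] sum.swap[of _ F A])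
    also have "\<dots> \<le> 2 powr p * (\<Sum>n\<in>A. (e * lpnorm p (cut (J n) x)) powr p)"
    proof (intro mult_left_mono sum_mono)
      fix n assume n: "n \<in> A"
      have "lpnorm p (B n x) \<le> lpnorm p (B n (cut (J n) x))"
        using loc[OF n x] lp_cut(2)[OF opb_lp[OF B[OF n] lp_cut(1)[OF x]]] by metis
      also have "\<dots> \<le> e * lpnorm p (cut (J n) x)" using opb_bound[OF B[OF n] lp_cut(1)[OF x]] .
      finally have "lpnorm p (B n x) powr p \<le> (e * lpnorm p (cut (J n) x)) powr p"
        using p_pos by (intro powr_mono2) auto
      with sum_le_lpnorm[OF lpB[OF n] F]
      show "(\<Sum>i\<in>F. norm (B n x i) powr p) \<le> (e * lpnorm p (cut (J n) x)) powr p" by simp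
    qed simp
    also have "\<dots> = 2 powr p * e powr p * (\<Sum>n\<in>A. lpnorm p (cut (J n) x) powr p)"
      by (simp add: powr_mult sum_distrib_left mult.assoc)
    also have "\<dots> \<le> 2 powr p * e powr p * (2 * lpnorm p x powr p)"
    proof (intro mult_left_mono sum_lpnorm_powr_le A lp_cut(1) x)
      fix i
      obtain a where a: "{n\<in>A. i \<in> J n} \<subseteq> {a, Suc a}" using mult by blast
      have "(\<Sum>n\<in>A. norm (cut (J n) x i) powr p) = (\<Sum>n\<in>{n\<in>A. i \<in> J n}. norm (x i) powr p)"
        using A p_pos by (intro sum.mono_neutral_cong_right) (auto simp: cut_def)
      also have "\<dots> \<le> (\<Sum>n\<in>{a, Suc a}. norm (x i) powr p)" by (intro sum_mono2 a) auto
      finally show "(\<Sum>n\<in>A. norm (cut (J n) x i) powr p) \<le> 2 * norm (x i) powr p" by simp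
    qed auto
    also have "\<dots> \<le> 2 powr p * e powr p * (2 powr p * lpnorm p x powr p)"
      by (intro mult_left_mono mult_right_mono 2) auto
    also have "\<dots> = (4 * e * lpnorm p x) powr p"
      by (simp add: powr_mult[symmetric] mult.assoc)
    finally show "(\<Sum>i\<in>F. norm ((\<Sum>n\<in>A. B n x) i) powr p) \<le> (4 * e * lpnorm p x) powr p" .
  qed (use e in auto)
  then show ?thesis
    by (intro opbI opb_lp[OF *] opb_add[OF *] opb_scale[OF *]) (use e in auto)
qed

lemma lp_slice: "x \<in> lp p \<Longrightarrow> (\<lambda>j. x (k, j)) \<in> lp p"
  using lp_reindex(1)[of x "Pair k"] by (simp add: comp_def inj_def)

lemma sum_slices_le:
  assumes x: "x \<in> lp p" and K: "finite K"
  shows "(\<Sum>k\<in>K. lpnorm p (\<lambda>j. x (k, j)) powr p) \<le> lpnorm p x powr p"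
proof -
  have "lpnorm p (\<lambda>j. x (k, j)) powr p = infsum (\<lambda>kj. norm (x kj) powr p) (Pair k ` UNIV)" for k
    unfolding lpnorm_powr by (subst infsum_reindex) (auto simp: inj_def o_def)
  then have "(\<Sum>k\<in>K. lpnorm p (\<lambda>j. x (k, j)) powr p)
      = (\<Sum>k\<in>K. infsum (\<lambda>kj. norm (x kj) powr p) (Pair k ` UNIV))" by simp
  also have "\<dots> = infsum (\<lambda>kj. norm (x kj) powr p) (\<Union>k\<in>K. Pair k ` UNIV)"
    by (rule sum_infsum[OF K lp_summable[OF x]]) auto
  also have "\<dots> \<le> lpnorm p x powr p"
    unfolding lpnorm_powr by (rule infsum_mono2) (auto intro!: lp_summable x)
  finally show ?thesis .
qed

lemma opb_bigsum:
  assumes T: "\<And>k. opb C (T k)"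
  shows "opb C (bigsum T)"
proof (rule opbI)
  show C: "0 \<le> C" using opb_const_nonneg[OF T] .
  have main: "bigsum T x \<in> lp p \<and> lpnorm p (bigsum T x) \<le> C * lpnorm p x" if x: "x \<in> lp p" for x
  proof -
    have "(\<Sum>kj\<in>F. norm (bigsum T x kj) powr p) \<le> (C * lpnorm p x) powr p" if F: "finite F" for F
    proof -
      have "(\<Sum>kj\<in>F. norm (bigsum T x kj) powr p) \<le> (\<Sum>kj\<in>fst ` F \<times> snd ` F. norm (bigsum T x kj) powr p)"
        using F by (intro sum_mono2) (auto simp: image_iff, (metis fst_conv snd_conv)+)
      also have "\<dots> = (\<Sum>k\<in>fst ` F. \<Sum>j\<in>snd ` F. norm (T k (\<lambda>j. x (k, j)) j) powr p)"
        by (simp add: sum.cartesian_product bigsum_def split_def)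
      also have "\<dots> \<le> (\<Sum>k\<in>fst ` F. C powr p * lpnorm p (\<lambda>j. x (k, j)) powr p)"
      proof (rule sum_mono)
        fix k
        have "(\<Sum>j\<in>snd ` F. norm (T k (\<lambda>j. x (k, j)) j) powr p) \<le> lpnorm p (T k (\<lambda>j. x (k, j))) powr p"
          using F by (intro sum_le_lpnorm opb_lp[OF T] lp_slice x) auto
        also have "\<dots> \<le> (C * lpnorm p (\<lambda>j. x (k, j))) powr p"
          using p_pos by (intro powr_mono2 opb_bound[OF T] lp_slice x) auto
        finally show "(\<Sum>j\<in>snd ` F. norm (T k (\<lambda>j. x (k, j)) j) powr p) \<le> C powr p * lpnorm p (\<lambda>j. x (k, j)) powr p"
          by (simp add: powr_mult)
      qed
      also have "\<dots> \<le> C powr p * lpnorm p x powr p"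
        unfolding sum_distrib_left[symmetric] using F by (intro mult_left_mono sum_slices_le x) auto
      finally show ?thesis by (simp add: powr_mult)
    qed
    from lp_boundedI[OF this] C show ?thesis by auto
  qed
  show "bigsum T x \<in> lp p" "lpnorm p (bigsum T x) \<le> C * lpnorm p x" if "x \<in> lp p" for x
    using main[OF that] by auto
  show "bigsum T (x + y) = bigsum T x + bigsum T y" if "x \<in> lp p" "y \<in> lp p" for x y
    using opb_add[OF T lp_slice[OF that(1)] lp_slice[OF that(2)]]
    by (auto simp: bigsum_def fun_eq_iff plus_fun_def)
  show "bigsum T (mul (\<lambda>_. c) x) = mul (\<lambda>_. c) (bigsum T x)" if "x \<in> lp p" for c x
    using opb_scale[OF T lp_slice[OF that]] by (auto simp: bigsum_def fun_eq_iff mul_def)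
qed

lemma opb_uniform_finite:
  assumes "finite \<T>" "\<And>T. T \<in> \<T> \<Longrightarrow> \<exists>C. opb C T"
  shows "\<exists>C. 0 \<le> C \<and> (\<forall>T\<in>\<T>. opb C T)"
  using assms
proof (induction rule: finite_induct)
  case (insert T \<T>)
  then obtain C D where C: "0 \<le> C" "\<forall>T\<in>\<T>. opb C T" and D: "opb D T" by blast
  have "\<forall>T\<in>insert T \<T>. opb (max C D) T"
    using C(2) opb_mono[of C _ "max C D"] opb_mono[OF D, of "max C D"] by auto
  then show ?case using C(1) by (intro exI[of _ "max C D"]) auto
qed auto

text \<open>Compact blocks alone do not suffice; their norms must tend to zero. Then only the first
  \<open>n\<close> blocks need a truncation, and the truncated operator is again a direct sum
  \<open>T'\<close>, bounded block by block.\<close>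

lemma cpt_bigsum:
  assumes K: "\<And>k. cpt (T k)" and small: "\<And>e. 0 < e \<Longrightarrow> eventually (\<lambda>k. opb e (T k)) sequentially"
  shows "cpt (bigsum T)"
  unfolding cpt_def
proof (intro conjI allI impI)
  obtain n1 where n1: "\<And>k. n1 \<le> k \<Longrightarrow> opb 1 (T k)" using small[of 1] by (auto simp: eventually_sequentially)
  obtain C where C: "0 \<le> C" "\<And>S. S \<in> T ` {..<n1} \<Longrightarrow> opb C S"
    using opb_uniform_finite[of "T ` {..<n1}"] cpt_opb[OF K] by blast
  have "opb (C + 1) (T k)" for k
    using opb_mono[OF n1, of k "C + 1"] opb_mono[OF C(2), of "T k" "C + 1"] C(1) by (cases "k < n1") auto
  then show "\<exists>C. opb C (bigsum T)" using opb_bigsum by blast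
  fix e :: real assume e: "0 < e"
  then obtain n where n: "\<And>k. n \<le> k \<Longrightarrow> opb e (T k)" using small by (auto simp: eventually_sequentially)
  have "\<forall>k. \<exists>F. finite F \<and> opb e (\<lambda>x. cut (- F) (T k x))" using K e unfolding cpt_def by blast
  from choice[OF this] obtain F where F: "\<And>k. finite (F k)" "\<And>k. opb e (\<lambda>x. cut (- F k) (T k x))"
    by blast
  define G where "G = Sigma {..<n} F"
  define T' where "T' k x = (if k < n then cut (- F k) (T k x) else T k x)" for k x
  have "opb e (T' k)" for k
    using F(2)[of k] n[of k] by (cases "k < n") (auto simp: T'_def[abs_def])
  then have T': "opb e (bigsum T')" by (rule opb_bigsum)
  have "bigsum T' x = cut (- G) (bigsum T x)" for x
    by (auto simp: bigsum_def T'_def cut_def G_def fun_eq_iff)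
  then have "opb e (\<lambda>x. cut (- G) (bigsum T x))" by (intro opb_cong[OF T']) simp
  then show "\<exists>F. finite F \<and> opb e (\<lambda>x. cut (- F) (bigsum T x))"
    using F(1) by (intro exI[of _ G]) (simp add: G_def)
qed

text \<open>Written with embeddings and restrictions, direct sums inherit bounds and compactness
  from the composition lemmas.\<close>

lemma dsum_eq_extend: "dsum T S x = extend Inl (T (x \<circ> Inl)) + extend Inr (S (x \<circ> Inr))"
proof
  fix k show "dsum T S x k = (extend Inl (T (x \<circ> Inl)) + extend Inr (S (x \<circ> Inr))) k"
  proof (cases k)
    case (Inl i)
    then show ?thesis using extend_apply[of Inl] by (auto simp: dsum_def extend_def comp_def)
  next
    case (Inr i)
    then show ?thesis using extend_apply[of Inr] by (auto simp: dsum_def extend_def comp_def)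
  qed
qed

lemma opb_extend_comp: "inj f \<Longrightarrow> opb C T \<Longrightarrow> inj g \<Longrightarrow> opb C (\<lambda>x. extend f (T (x \<circ> g)))"
  using opb_comp[OF opb_extend opb_comp[OF _ opb_reindex], of f C T g] by simp

lemma cpt_extend_comp: "inj f \<Longrightarrow> cpt T \<Longrightarrow> inj g \<Longrightarrow> cpt (\<lambda>x. extend f (T (x \<circ> g)))"
  using cpt_comp_left[OF opb_extend cpt_comp_right[OF _ opb_reindex], of f T g] by simp

lemma opb_dsum: "opb C T \<Longrightarrow> opb D S \<Longrightarrow> opb (C + D) (dsum T S)"
  unfolding dsum_eq_extend[abs_def] by (intro opb_plus opb_extend_comp) auto

section \<open>The operator norm, and the two descriptions of compactness\<close>

lemma opb_normalized_bound:
  assumes "opb C T" "0 \<le> D" "\<And>x. x \<in> lp p \<Longrightarrow> lpnorm p x = 1 \<Longrightarrow> lpnorm p (T x) \<le> D"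
  shows "opb D T"
proof (rule opbI)
  show "lpnorm p (T x) \<le> D * lpnorm p x" if x: "x \<in> lp p" for x
  proof (cases "lpnorm p x = 0")
    case True
    then show ?thesis using opb_bound[OF assms(1) x] by simp
  next
    case False
    then have pos: "0 < lpnorm p x" using lpnorm_nonneg[of x] by linarith
    define y where "y = mul (\<lambda>_. of_real (1 / lpnorm p x)) x"
    have "lpnorm p y = 1" using x pos by (simp add: y_def lpnorm_scale norm_divide)
    then have "lpnorm p (T y) \<le> D" using assms(3)[of y] x by (simp add: y_def)
    moreover have "lpnorm p (T y) = lpnorm p (T x) / lpnorm p x"
      unfolding y_def opb_scale[OF assms(1) x] lpnorm_scale[OF opb_lp[OF assms(1) x]] using pos by (simp add: norm_divide)
    ultimately show ?thesis using pos by (simp add: field_simps)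
  qed
qed (use assms(2) opb_lp[OF assms(1)] opb_add[OF assms(1)] opb_scale[OF assms(1)] in auto)

lemma opnorm_le:
  assumes "opb C T" shows "opnorm p T \<le> C"
  unfolding opnorm_def
proof (rule cSup_least)
  show "{lpnorm p (T x) |x. x \<in> lp p \<and> lpnorm p x \<le> 1} \<noteq> {}"
    by (auto intro!: exI[of _ 0])
  fix s assume "s \<in> {lpnorm p (T x) |x. x \<in> lp p \<and> lpnorm p x \<le> 1}"
  then obtain x where x: "x \<in> lp p" "lpnorm p x \<le> 1" "s = lpnorm p (T x)" by auto
  then have "s \<le> C * lpnorm p x" using opb_bound[OF assms] by blast
  also have "\<dots> \<le> C" using x(2) opb_const_nonneg[OF assms] by (simp add: mult_left_le)
  finally show "s \<le> C" .
qed

text \<open>The a priori bound \<open>C\<close> makes the set under \<open>Sup\<close> bounded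
  above, without which \<open>opnorm\<close> carries no information.\<close>

lemma opb_opnorm:
  assumes "opb C T" "opnorm p T \<le> D" shows "opb D T"
proof (rule opb_normalized_bound[OF assms(1)])
  let ?S = "{lpnorm p (T x) |x. x \<in> lp p \<and> lpnorm p x \<le> 1}"
  have "bdd_above ?S"
  proof (rule bdd_aboveI)
    fix s assume "s \<in> ?S"
    then obtain x where x: "x \<in> lp p" "lpnorm p x \<le> 1" "s = lpnorm p (T x)" by auto
    then have "s \<le> C * lpnorm p x" using opb_bound[OF assms(1)] by blast
    also have "\<dots> \<le> C" using x(2) opb_const_nonneg[OF assms(1)] by (simp add: mult_left_le)
    finally show "s \<le> C" .
  qed
  then have up: "lpnorm p (T x) \<le> opnorm p T" if "x \<in> lp p" "lpnorm p x \<le> 1" for x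
    unfolding opnorm_def using that by (intro cSup_upper) auto
  have "lpnorm p (T 0) \<le> opnorm p T" by (rule up) simp_all
  then show "0 \<le> D" using assms(2) lpnorm_nonneg[of "T 0"] by linarith
  show "lpnorm p (T x) \<le> D" if "x \<in> lp p" "lpnorm p x = 1" for x
    using up[of x] that assms(2) by simp
qed

lemma lpnorm_cut_le_sum:
  assumes "finite F" shows "lpnorm p (cut F z) \<le> (\<Sum>i\<in>F. norm (z i))"
  using assms
proof (induction F rule: finite_induct)
  case empty
  then show ?case unfolding cut_empty lp_zero by simp
next
  case (insert i F)
  have eq: "cut (insert i F) z = mul (\<lambda>_. z i) (cut {i} (\<lambda>_. 1)) + cut F z"
    using insert.hyps by (auto simp: cut_def mul_def fun_eq_iff)
  have "lpnorm p (cut {i} (\<lambda>_. 1)) \<le> 1"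
  proof (rule lp_boundedI)
    fix A :: "'a set" assume A: "finite A"
    have "(\<Sum>j\<in>A. norm (cut {i} (\<lambda>_. 1) j) powr p) = (\<Sum>j\<in>A \<inter> {i}. 1)"
      by (rule sum.mono_neutral_cong_right) (use A p_pos in \<open>auto simp: cut_def\<close>)
    also have "\<dots> \<le> 1" by (cases "i \<in> A") auto
    finally show "(\<Sum>j\<in>A. norm (cut {i} (\<lambda>_. 1) j) powr p) \<le> 1 powr p" by simp
  qed simp
  then have "lpnorm p (mul (\<lambda>_. z i) (cut {i} (\<lambda>_. 1))) \<le> norm (z i)"
    by (simp add: lpnorm_scale lp_finite_support mult_left_le)
  then have "lpnorm p (mul (\<lambda>_. z i) (cut {i} (\<lambda>_. 1)) + cut F z) \<le> (\<Sum>i\<in>insert i F. norm (z i))"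
    using lp_add(2)[of "mul (\<lambda>_. z i) (cut {i} (\<lambda>_. 1))" "cut F z"] insert
    by (simp add: lp_finite_support)
  then show ?case by (subst eq)
qed

text \<open>In place of a diagonal argument: a product of closed discs is compact by Tychonoff, and
  countability of the index type turns this into sequential compactness.\<close>

lemma bounded_pointwise_subsequence:
  fixes y :: "nat \<Rightarrow> 'j::countable \<Rightarrow> complex"
  assumes "\<And>n j. norm (y n j) \<le> M"
  obtains r l where "strict_mono r" "\<And>j. (\<lambda>n. y (r n) j) \<longlonglongrightarrow> l j"
proof -
  have "compactin (product_topology (\<lambda>_. euclidean) UNIV) (PiE UNIV (\<lambda>_::'j. cball (0::complex) M))"
    by (simp add: compactin_PiE)
  then have "compact (PiE UNIV (\<lambda>_::'j. cball (0::complex) M))"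
    by (simp add: euclidean_product_topology)
  then have "seq_compact (PiE UNIV (\<lambda>_::'j. cball (0::complex) M))"
    by (rule compact_imp_seq_compact)
  moreover have "\<forall>n. y n \<in> PiE UNIV (\<lambda>_. cball 0 M)" using assms by auto
  ultimately obtain l r where lr: "strict_mono r" "(y \<circ> r) \<longlonglongrightarrow> l"
    by (elim seq_compactE)
  have "(\<lambda>n. y (r n) j) \<longlonglongrightarrow> l j" for j
    using continuous_on_tendsto_compose[OF continuous_on_product_coordinates lr(2), of j] by (simp add: comp_def)
  with lr(1) that show thesis by blast
qed

text \<open>A subsequence of the images converges in every coordinate. The tails outside a finite
  set are uniformly small on bounded sequences, so the convergence is in norm.\<close>

lemma compact_op_if_cpt:
  fixes T :: "('j::countable \<Rightarrow> complex) \<Rightarrow> 'j \<Rightarrow> complex"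
  assumes T: "cpt T"
  shows "compact_op p T"
  unfolding compact_op_def
proof (intro conjI allI impI)
  obtain C where C: "opb C T" using T cpt_opb by blast
  then show "bop p T" by (auto simp: bop_iff_opb)
  fix x :: "nat \<Rightarrow> 'j \<Rightarrow> complex"
  assume "(\<forall>n. x n \<in> lp p) \<and> (\<exists>M. \<forall>n. lpnorm p (x n) \<le> M)"
  then obtain M where x: "\<And>n. x n \<in> lp p" and M: "\<And>n. lpnorm p (x n) \<le> M" by blast
  have M0: "0 \<le> M" using M[of 0] lpnorm_nonneg[of "x 0"] by linarith
  have y: "T (x n) \<in> lp p" for n using opb_lp[OF C x] .
  have yb: "lpnorm p (T (x n)) \<le> C * M" for n
    by (rule order_trans[OF opb_bound[OF C x] mult_left_mono[OF M opb_const_nonneg[OF C]]])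
  have bd: "norm (T (x n) j) \<le> C * M" for n j
    by (rule order_trans[OF norm_le_lpnorm[OF y] yb])
  obtain r l where r: "strict_mono r" and l: "\<And>j. (\<lambda>n. T (x (r n)) j) \<longlonglongrightarrow> l j"
    by (rule bounded_pointwise_subsequence[of "\<lambda>n. T (x n)", OF bd]) blast
  have lp: "l \<in> lp p" by (rule lp_pointwise_limit(1)[OF y yb l])
  have "(\<lambda>n. lpnorm p (T (x (r n)) - l)) \<longlonglongrightarrow> 0"
  proof (rule LIMSEQ_I)
    fix e :: real assume e: "0 < e"
    \<comment> \<open>Two tails and the finitely many remaining coordinates contribute at most
      \<open>e / 4\<close> each.\<close>
    define d where "d = e / (4 * (M + 1))"
    have d: "0 < d" and dM: "d * M \<le> e / 4" using e M0 by (auto simp: d_def field_simps)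
    obtain F where F: "finite F" "opb d (\<lambda>x. cut (- F) (T x))" using T d unfolding cpt_def by blast
    have t1: "lpnorm p (cut (- F) (T (x n))) \<le> e / 4" for n
      using opb_bound[OF F(2) x[of n]] mult_left_mono[OF M[of n], of d] d dM by linarith
    have t2: "lpnorm p (cut (- F) l) \<le> e / 4"
      by (rule lp_pointwise_limit(2)[OF lp_cut(1)[OF y] t1]) (use l in \<open>auto simp: cut_def\<close>)
    have "(\<lambda>n. \<Sum>j\<in>F. norm ((T (x (r n)) - l) j)) \<longlonglongrightarrow> (\<Sum>j\<in>F. 0)"
      by (intro tendsto_sum) (use l in \<open>auto simp: tendsto_norm_zero_iff LIM_zero_iff\<close>)
    then have "eventually (\<lambda>n. (\<Sum>j\<in>F. norm ((T (x (r n)) - l) j)) < e / 4) sequentially"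
      using e by (intro order_tendstoD(2)) auto
    then obtain N where N: "\<And>n. N \<le> n \<Longrightarrow> (\<Sum>j\<in>F. norm ((T (x (r n)) - l) j)) < e / 4"
      by (auto simp: eventually_sequentially)
    have "lpnorm p (T (x (r n)) - l) < e" if "N \<le> n" for n
    proof -
      let ?z = "T (x (r n)) - l"
      have z: "?z \<in> lp p" using y lp by (simp add: lp_diff)
      have "lpnorm p ?z \<le> lpnorm p (cut F ?z) + lpnorm p (cut (- F) ?z)"
        using lp_add(2)[OF lp_cut(1)[OF z] lp_cut(1)[OF z], of F "- F"] by (simp add: cut_add_compl)
      also have "lpnorm p (cut (- F) ?z) \<le> lpnorm p (cut (- F) (T (x (r n)))) + lpnorm p (cut (- F) l)"
        unfolding cut_diff by (rule lp_diff(2)[OF lp_cut(1)[OF y] lp_cut(1)[OF lp]])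
      finally show ?thesis
        using t1[of "r n"] t2 lpnorm_cut_le_sum[OF F(1), of ?z] N[OF that] e by linarith
    qed
    then show "\<exists>N. \<forall>n\<ge>N. norm (lpnorm p (T (x (r n)) - l) - 0) < e" by auto
  qed
  then show "\<exists>r y. strict_mono r \<and> y \<in> lp p \<and> (\<lambda>n. lpnorm p (\<lambda>i. T (x (r n)) i - y i)) \<longlonglongrightarrow> 0"
    using r lp by (intro exI[of _ r] exI[of _ l]) (simp add: fun_diff_def)
qed

text \<open>If no finite set of rows suffices, there are unit vectors whose images keep norm above
  \<open>e\<close> outside each member of an exhausting sequence of finite sets. This contradicts
  the small tails of a norm limit of these images.\<close>

lemma cpt_if_compact_op:
  fixes T :: "('j::countable \<Rightarrow> complex) \<Rightarrow> 'j \<Rightarrow> complex"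
  assumes "compact_op p T"
  shows "cpt T"
proof -
  obtain C where C: "opb C T" using assms by (auto simp: compact_op_def bop_iff_opb)
  show ?thesis
    unfolding cpt_def
  proof (intro conjI allI impI)
    show "\<exists>C. opb C T" using C by blast
    fix e :: real assume e: "0 < e"
    show "\<exists>F. finite F \<and> opb e (\<lambda>x. cut (- F) (T x))"
    proof (rule ccontr)
      assume no: "\<not> ?thesis"
      define F where "F n = {j::'j. to_nat j < n}" for n
      have fin: "finite (F n)" for n
        unfolding F_def using finite_vimageI[OF finite_lessThan[of n] inj_to_nat] by (simp add: vimage_def)
      have "\<exists>x. x \<in> lp p \<and> lpnorm p x = 1 \<and> e < lpnorm p (cut (- F n) (T x))" for n
      proof (rule ccontr)
        assume "\<not> ?thesis"
        then have "opb e (\<lambda>x. cut (- F n) (T x))"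
          using opb_normalized_bound[OF opb_comp[OF opb_cut C], of e "- F n"] e by (auto simp: not_less)
        with no fin show False by blast
      qed
      then have "\<forall>n. \<exists>x. x \<in> lp p \<and> lpnorm p x = 1 \<and> e < lpnorm p (cut (- F n) (T x))" ..
      from choice[OF this] obtain x where x: "\<And>n. x n \<in> lp p" "\<And>n. lpnorm p (x n) = 1"
        "\<And>n. e < lpnorm p (cut (- F n) (T (x n)))" by blast
      have "(\<forall>n. x n \<in> lp p) \<and> (\<exists>M. \<forall>n. lpnorm p (x n) \<le> M)"
        using x(1,2) by (auto intro!: exI[of _ 1])
      then obtain r y where r: "strict_mono r" and y: "y \<in> lp p"
        and "(\<lambda>n. lpnorm p (\<lambda>i. T (x (r n)) i - y i)) \<longlonglongrightarrow> 0"
        using assms unfolding compact_op_def by blast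
      then have "(\<lambda>n. lpnorm p (T (x (r n)) - y)) \<longlonglongrightarrow> 0" by (simp add: fun_diff_def)
      then have "eventually (\<lambda>n. lpnorm p (T (x (r n)) - y) < e / 2) sequentially"
        using e by (intro order_tendstoD(2)) auto
      then obtain N where N: "\<And>n. N \<le> n \<Longrightarrow> lpnorm p (T (x (r n)) - y) < e / 2"
        by (auto simp: eventually_sequentially)
      obtain G where G: "finite G" "lpnorm p (cut (- G) y) \<le> e / 2"
        using lp_tail_small[OF y, of "e / 2"] e by auto
      obtain m where m: "\<And>j. j \<in> G \<Longrightarrow> to_nat j < m"
        using finite_nat_set_iff_bounded[of "to_nat ` G"] G(1) by auto
      define n where "n = max N m"
      have "m \<le> r n" using seq_suble[OF r, of n] by (simp add: n_def)
      then have "G \<subseteq> F (r n)" using m by (force simp: F_def)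
      then have "cut (- F (r n)) y = cut (- F (r n)) (cut (- G) y)" by (auto simp: cut_def fun_eq_iff)
      then have a: "lpnorm p (cut (- F (r n)) y) \<le> e / 2"
        using lp_cut(2)[OF lp_cut(1)[OF y, of "- G"], of "- F (r n)"] G(2) by simp
      have z: "T (x (r n)) - y \<in> lp p" using opb_lp[OF C x(1)] y by (simp add: lp_diff)
      have "lpnorm p (cut (- F (r n)) (T (x (r n)))) = lpnorm p (cut (- F (r n)) (T (x (r n)) - y) + cut (- F (r n)) y)"
        by (simp add: cut_add[symmetric])
      also have "\<dots> \<le> lpnorm p (cut (- F (r n)) (T (x (r n)) - y)) + lpnorm p (cut (- F (r n)) y)"
        by (intro lp_add(2) lp_cut(1) z y)
      also have "\<dots> < e / 2 + e / 2"
        using a N[of n] lp_cut(2)[OF z, of "- F (r n)"] by (simp add: n_def)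
      finally show False using x(3)[of "r n"] by simp
    qed
  qed
qed

end

section \<open>Quasicentral unitaries\<close>

lemma norm_cis_diff_le: "norm (cis a - cis b) \<le> \<bar>a - b\<bar>"
proof -
  have "cis a - cis b = cis b * (cis (a - b) - 1)" by (simp add: algebra_simps cis_mult)
  then have "norm (cis a - cis b) = norm (cis (a - b) - 1)" by (simp add: norm_mult)
  also have "\<dots> = 2 * \<bar>sin ((a - b) / 2)\<bar>" using dist_exp_i_1[of "a - b"] by (simp add: cis_conv_exp)
  also have "\<dots> \<le> \<bar>a - b\<bar>" using abs_sin_x_le_abs_x[of "(a - b) / 2"] by simp
  finally show ?thesis .
qed

context lp_exponent
begin

text \<open>One corner is small by the row tails, hence by \<open>1 < p\<close>; the other because
  \<open>T\<close> on finitely many coordinates has finite rank.\<close>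

lemma block_tails_small:
  fixes T :: "(nat \<Rightarrow> complex) \<Rightarrow> nat \<Rightarrow> complex"
  assumes T: "opb C T" and e: "0 < e"
  shows "eventually (\<lambda>m. opb e (\<lambda>x. cut {..<d} (T (cut {m..} x))) \<and>
      opb e (\<lambda>x. cut {m..} (T (cut {..<d} x)))) sequentially"
proof -
  obtain G where G: "finite G" "opb e (\<lambda>x. cut {..<d} (T (cut (- G) x)))"
    using row_tail[OF T _ e, of "{..<d}"] by auto
  obtain F where F: "finite F" "opb e (\<lambda>x. cut (- F) (T (cut {..<d} x)))"
    using cpt_comp_cut[OF T, of "{..<d}"] e unfolding cpt_def by auto
  obtain n where n: "\<And>i. i \<in> G \<union> F \<Longrightarrow> i < n"
    using finite_nat_set_iff_bounded[of "G \<union> F"] F(1) G(1) by auto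
  show ?thesis
    unfolding eventually_sequentially
  proof (intro exI[of _ n] allI impI conjI)
    fix m assume m: "n \<le> m"
    have "i \<notin> G \<and> i \<notin> F" if "m \<le> i" for i using n[of i] that m by force
    then have 1: "cut {m..} x = cut (- G) (cut {m..} x)" "cut {m..} x = cut {m..} (cut (- F) x)"
      for x :: "nat \<Rightarrow> complex"
      by (auto simp: cut_def fun_eq_iff)
    show "opb e (\<lambda>x. cut {..<d} (T (cut {m..} x)))"
      by (rule opb_cong[OF opb_mono[OF opb_comp[OF G(2) opb_cut[of "{m..}"]]]]) (use 1(1) in auto)
    show "opb e (\<lambda>x. cut {m..} (T (cut {..<d} x)))"
      by (rule opb_cong[OF opb_mono[OF opb_comp[OF opb_cut[of "{m..}"] F(2)]]]) (use 1(2) in auto)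
  qed
qed

text \<open>For \<open>1 < p\<close> finitely many operators are almost block tridiagonal with respect to a suitable
  sequence of cut points, hence almost commute with a diagonal unitary that moves from \<open>1\<close> to \<open>-1\<close>
  in small steps located at the cut points.\<close>

lemma quasicentral_unitary:
  fixes \<T> :: "((nat \<Rightarrow> complex) \<Rightarrow> nat \<Rightarrow> complex) set"
  assumes fin: "finite \<T>" and bdd: "\<And>T. T \<in> \<T> \<Longrightarrow> \<exists>C. opb C T" and e: "0 < e"
  shows "\<exists>c'>c. \<exists>u. (\<forall>i. norm (u i) = 1) \<and> (\<forall>i<c. u i = 1) \<and> (\<forall>i\<ge>c'. u i = - 1) \<and>
    (\<forall>T\<in>\<T>. opb e (\<lambda>x. mul u (T x) - T (mul u x)))"
proof -
  obtain C where C: "0 \<le> C" "\<And>T. T \<in> \<T> \<Longrightarrow> opb C T" using opb_uniform_finite[OF fin bdd] by blast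
  \<comment> \<open>\<open>M\<close> is the number of steps of the half turn. It bounds the
    overlapping main terms by \<open>8 * C * pi / M \<le> e / 2\<close>. The choice of
    \<open>dl\<close> below lets the \<open>M\<close> remainders, each at most
    \<open>4 * dl * pi / M\<close>, contribute the other \<open>e / 2\<close>.\<close>
  obtain M where M: "16 * C * pi / e < real M" using reals_Archimedean2 by blast
  have M0: "0 < M"
  proof (rule ccontr)
    assume "\<not> 0 < M"
    moreover have "0 \<le> 16 * C * pi / e" using C e by simp
    ultimately show False using M by simp
  qed
  define dl where "dl = e / (8 * pi)"
  have dl: "0 < dl" using e by (simp add: dl_def)
  define good where "good T d d' \<longleftrightarrow> opb dl (\<lambda>x. cut {..<d} (T (cut {d'..} x))) \<and>
      opb dl (\<lambda>x. cut {d'..} (T (cut {..<d} x)))" for T and d d' :: nat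
  \<comment> \<open>Each cut point lies so far beyond the previous one that both off-diagonal
    corners between them are below \<open>dl\<close>.\<close>
  have "\<exists>d. \<forall>n. (n = 0 \<longrightarrow> d n = c) \<and> (d n < d (Suc n) \<and> (\<forall>T\<in>\<T>. good T (d n) (d (Suc n))))"
  proof (rule dependent_nat_choice)
    fix x n :: nat
    have "eventually (\<lambda>m. \<forall>T\<in>\<T>. good T x m) sequentially"
      unfolding good_def by (intro eventually_ball_finite[OF fin] ballI block_tails_small[OF C(2) dl])
    then have "eventually (\<lambda>m. x < m \<and> (\<forall>T\<in>\<T>. good T x m)) sequentially"
      by (intro eventually_conj eventually_gt_at_top)
    then show "\<exists>y. (Suc n = 0 \<longrightarrow> y = c) \<and> x < y \<and> (\<forall>T\<in>\<T>. good T x y)"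
      by (auto simp: eventually_sequentially)
  qed auto
  then obtain d where d0: "d 0 = c" and dS: "\<And>n. d n < d (Suc n)"
    and good: "\<And>n T. T \<in> \<T> \<Longrightarrow> good T (d n) (d (Suc n))" by blast
  have smono: "strict_mono d" using dS by (simp add: strict_mono_Suc_iff)
  \<comment> \<open>Increments of the half turn: \<open>u i\<close> is \<open>1\<close> plus all
    \<open>w j\<close> whose cut point \<open>d (Suc j)\<close> has been passed. Such a sum
    telescopes to some \<open>cis (pi * l / M)\<close>, hence has modulus one.\<close>
  define w where "w j = cis (pi * real (Suc j) / real M) - cis (pi * real j / real M)" for j
  have w: "norm (w j) \<le> pi / real M" for j
    using norm_cis_diff_le[of "pi * real (Suc j) / real M" "pi * real j / real M"] M0
    by (simp add: w_def field_simps)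
  have tel: "(\<Sum>j<n. w j) = cis (pi * real n / real M) - 1" for n
    using sum_lessThan_telescope[of "\<lambda>j. cis (pi * real j / real M)" n] by (simp add: w_def)
  define u where "u i = 1 + (\<Sum>j<M. w j * of_bool (d (Suc j) \<le> i))" for i
  have part: "\<exists>l. 1 + (\<Sum>j<m. w j * of_bool (d (Suc j) \<le> i)) = cis (pi * real l / real M)" for m i
  proof (induction m)
    case 0
    show ?case by (auto intro!: exI[of _ 0])
  next
    case (Suc m)
    show ?case
    proof (cases "d (Suc m) \<le> i")
      case True
      have "d (Suc j) \<le> i" if "j < Suc m" for j
        using that True strict_mono_mono[OF smono] by (meson Suc_leI Suc_le_mono less_Suc_eq_le monoD order_trans)
      then have "(\<Sum>j<Suc m. w j * of_bool (d (Suc j) \<le> i)) = (\<Sum>j<Suc m. w j)" by (intro sum.cong) auto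
      then show ?thesis unfolding tel by (intro exI[of _ "Suc m"]) simp
    qed (use Suc in auto)
  qed
  have nu: "norm (u i) = 1" for i unfolding u_def using part[of i M] by (metis norm_cis)
  have u1: "u i = 1" if "i < c" for i
  proof -
    have "\<not> d (Suc j) \<le> i" for j using that d0 smono[THEN strict_monoD, of 0 "Suc j"] by simp
    then show ?thesis by (simp add: u_def)
  qed
  have u2: "u i = - 1" if "d M \<le> i" for i
  proof -
    have "d (Suc j) \<le> i" if "j < M" for j
      using that \<open>d M \<le> i\<close> strict_mono_mono[OF smono] by (meson Suc_leI monoD order_trans)
    then have "u i = 1 + (\<Sum>j<M. w j)" unfolding u_def by (intro arg_cong2[where f = "(+)"] sum.cong) auto
    then show ?thesis unfolding tel using M0 by (simp add: cis_pi)
  qed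
  have mulu: "mul u x = x + (\<Sum>j<M. mul (\<lambda>_. w j) (cut {d (Suc j)..} x))" for x
  proof
    fix i
    have "(\<Sum>j<M. mul (\<lambda>_. w j) (cut {d (Suc j)..} x)) i = (\<Sum>j<M. w j * of_bool (d (Suc j) \<le> i)) * x i"
      unfolding sum_fun_apply sum_distrib_right by (intro sum.cong) (auto simp: mul_def cut_def)
    then show "mul u x i = (x + (\<Sum>j<M. mul (\<lambda>_. w j) (cut {d (Suc j)..} x))) i"
      unfolding plus_fun_apply by (simp only: mul_def u_def distrib_right mult_1_left)
  qed
  have comm: "opb e (\<lambda>x. mul u (T x) - T (mul u x))" if T: "T \<in> \<T>" for T
  proof -
    have CT: "opb C T" using C(2)[OF T] .
    define K where "K j x = cut {d (Suc j)..} (T x) - T (cut {d (Suc j)..} x)" for j x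
    \<comment> \<open>Up to small corners, the commutator with the projection onto
      \<open>{d (Suc j)..}\<close> lives on the two blocks adjacent to \<open>d (Suc j)\<close>.
      Every coordinate is in at most two of the sets \<open>J j\<close>.\<close>
    define J where "J j = {d j..<d (Suc (Suc j))}" for j
    define Bj where "Bj j x = cut (J j) (mul (\<lambda>_. w j) (K j (cut (J j) x)))" for j x
    have Kb: "opb (C + C) (K j)" for j
      unfolding K_def[abs_def] using opb_minus[OF opb_comp[OF opb_cut CT] opb_comp[OF CT opb_cut]] by simp
    have eq: "mul u (T x) - T (mul u x) = (\<Sum>j<M. mul (\<lambda>_. w j) (K j x))" if x: "x \<in> lp p" for x
    proof -
      have "T (mul u x) = T x + (\<Sum>j<M. mul (\<lambda>_. w j) (T (cut {d (Suc j)..} x)))"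
        unfolding mulu by (simp add: opb_add[OF CT] opb_sum[OF CT] opb_scale[OF CT] x lp_sum lp_cut)
      moreover have "mul u (T x) = T x + (\<Sum>j<M. mul (\<lambda>_. w j) (cut {d (Suc j)..} (T x)))"
        by (rule mulu)
      moreover have "mul (\<lambda>_. w j) (K j x)
          = mul (\<lambda>_. w j) (cut {d (Suc j)..} (T x)) - mul (\<lambda>_. w j) (T (cut {d (Suc j)..} x))" for j
        by (auto simp: K_def mul_def fun_eq_iff algebra_simps)
      ultimately show ?thesis by (simp only: sum_subtractf add_diff_cancel_left)
    qed
    have wop: "opb (pi / real M) (mul (\<lambda>_. w j))" for j using w by (intro opb_mul)
    have B: "opb (4 * (pi / real M * (C + C))) (\<lambda>x. \<Sum>j<M. Bj j x)"
    proof (rule opb_overlapping_sum[where J = J])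
      show "opb (pi / real M * (C + C)) (Bj j)" for j
        unfolding Bj_def[abs_def]
        using opb_comp[OF opb_cut opb_comp[OF wop opb_comp[OF Kb opb_cut]]] by simp
      show "Bj j x = cut (J j) (Bj j (cut (J j) x))" for j x
        by (simp add: Bj_def cut_cut)
      show "\<exists>a. {n \<in> {..<M}. i \<in> J n} \<subseteq> {a, Suc a}" for i
      proof (cases "{n \<in> {..<M}. i \<in> J n} = {}")
        case False
        define a where "a = (LEAST n. i \<in> J n)"
        have a: "i \<in> J a" unfolding a_def using False by (auto intro: LeastI)
        have "n = a \<or> n = Suc a" if "i \<in> J n" for n
        proof -
          have "a \<le> n" unfolding a_def using that by (rule Least_le)
          have "d n < d (Suc (Suc a))" using a that by (auto simp: J_def)
          then have "n < Suc (Suc a)" using smono by (simp add: strict_mono_less)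
          with \<open>a \<le> n\<close> show ?thesis by auto
        qed
        then show ?thesis by blast
      qed auto
    qed (use C in auto)
    \<comment> \<open>What remains of \<open>K j\<close> after compression to \<open>J j\<close>,
      expressed by the four corners that the choice of \<open>d\<close> made small.\<close>
    define R where "R j x = cut {d (Suc (Suc j))..} (T (cut {..<d (Suc j)} x))
        - cut {..<d j} (T (cut {d (Suc j)..} x))
        + (cut (J j) (cut {d (Suc j)..} (T (cut {..<d j} x)))
        - cut (J j) (cut {..<d (Suc j)} (T (cut {d (Suc (Suc j))..} x))))" for j x
    have R: "opb (dl + dl + (1 * dl + 1 * dl)) (R j)" for j
      unfolding R_def[abs_def] using good[OF T, of j] good[OF T, of "Suc j"]
      by (intro opb_plus opb_minus opb_comp[OF opb_cut]) (auto simp: good_def)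
    define R' where "R' j x = mul (\<lambda>_. w j) (R j x)" for j x
    have R'_eq: "mul (\<lambda>_. w j) (K j x) = Bj j x + R' j x" if x: "x \<in> lp p" for j x
    proof -
      have lt: "d j < d (Suc j)" "d (Suc j) < d (Suc (Suc j))" by (rule dS)+
      have split: "T y = T (cut A y) + T (cut (- A) y)" if "y \<in> lp p" for y A
        using opb_add[OF CT lp_cut(1)[OF that] lp_cut(1)[OF that], of A "- A"] by (simp add: cut_add_compl)
      have 1: "K j (cut (- J j) x) = cut {d (Suc j)..} (T (cut {..<d j} x))
          - cut {..<d (Suc j)} (T (cut {d (Suc (Suc j))..} x))"
      proof -
        have "- J j = {..<d j} \<union> {d (Suc (Suc j))..}" by (auto simp: J_def)
        then have "cut {..<d j} (cut (- J j) x) = cut {..<d j} x"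
          "cut (- {..<d j}) (cut (- J j) x) = cut {d (Suc (Suc j))..} x"
          "cut {d (Suc j)..} (cut (- J j) x) = cut {d (Suc (Suc j))..} x"
          using lt by (auto simp: cut_def fun_eq_iff)
        then have "K j (cut (- J j) x) = cut {d (Suc j)..} (T (cut {..<d j} x) + T (cut {d (Suc (Suc j))..} x))
            - T (cut {d (Suc (Suc j))..} x)"
          using split[OF lp_cut(1)[OF x], of "- J j" "{..<d j}"] by (simp add: K_def)
        then show ?thesis by (auto simp: cut_def fun_eq_iff)
      qed
      have 2: "cut (- J j) (K j x) = cut {d (Suc (Suc j))..} (T (cut {..<d (Suc j)} x))
          - cut {..<d j} (T (cut {d (Suc j)..} x))"
      proof -
        have "- {..<d (Suc j)} = {d (Suc j)..}" by auto
        then have "T x = T (cut {..<d (Suc j)} x) + T (cut {d (Suc j)..} x)"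
          using split[OF x, of "{..<d (Suc j)}"] by simp
        then have "K j x = cut {d (Suc j)..} (T (cut {..<d (Suc j)} x) + T (cut {d (Suc j)..} x))
            - T (cut {d (Suc j)..} x)" by (simp add: K_def)
        then show ?thesis using lt by (auto simp: cut_def fun_eq_iff J_def)
      qed
      have "K j x = cut (J j) (K j (cut (J j) x)) + (cut (- J j) (K j x) + cut (J j) (K j (cut (- J j) x)))"
      proof -
        have "K j x = K j (cut (J j) x) + K j (cut (- J j) x)"
          using opb_add[OF Kb lp_cut(1)[OF x] lp_cut(1)[OF x], of j "J j" "- J j"] by (simp add: cut_add_compl)
        then have "cut (J j) (K j x) = cut (J j) (K j (cut (J j) x)) + cut (J j) (K j (cut (- J j) x))"
          by (simp add: cut_add[symmetric])
        then show ?thesis using cut_add_compl[of "J j" "K j x"] by (simp add: algebra_simps)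
      qed
      then have "K j x = cut (J j) (K j (cut (J j) x)) + R j x"
        unfolding 1 2 R_def cut_diff by simp
      then have "mul (\<lambda>_. w j) (K j x) = mul (\<lambda>_. w j) (cut (J j) (K j (cut (J j) x))) + R' j x"
        unfolding R'_def mul_add[symmetric] by simp
      then show ?thesis by (simp add: Bj_def cut_scale)
    qed
    have "opb (pi / real M * (dl + dl + (1 * dl + 1 * dl))) (R' j)" for j
      unfolding R'_def[abs_def] by (intro opb_comp wop R)
    then have "opb (\<Sum>j<M. pi / real M * (dl + dl + (1 * dl + 1 * dl))) (\<lambda>x. \<Sum>j<M. R' j x)"
      by (intro opb_sum_op) auto
    from opb_plus[OF B this]
    have tot: "opb (4 * (pi / real M * (C + C)) + (\<Sum>j<M. pi / real M * (dl + dl + (1 * dl + 1 * dl))))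
        (\<lambda>x. mul u (T x) - T (mul u x))"
      by (rule opb_cong) (simp only: eq R'_eq sum.distrib)
    have "4 * (pi / real M * (C + C)) \<le> e / 2"
      using M M0 e by (simp add: field_simps)
    moreover have "(\<Sum>j<M. pi / real M * (dl + dl + (1 * dl + 1 * dl))) = e / 2"
      using M0 by (simp add: dl_def)
    ultimately show ?thesis using opb_mono[OF tot] by simp
  qed
  show ?thesis
    using strict_monoD[OF smono M0] d0 nu u1 u2 comm by (intro exI[of _ "d M"] conjI exI[of _ u]) auto
qed

end

text \<open>The uniform boundedness principle via Baire: continuity in \<open>t\<close> on a compact
  interval gives pointwise bounds, so some \<open>X n\<close> contains a ball.\<close>

lemma bounded_linear_family_uniform_bound:
  fixes \<tau> :: "real \<Rightarrow> 'a::banach \<Rightarrow> 'b::real_normed_vector"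
  assumes lin: "\<And>t. t \<in> {0..1} \<Longrightarrow> bounded_linear (\<tau> t)"
    and cont: "\<And>a. continuous_on {0..1} (\<lambda>t. \<tau> t a)"
  shows "\<exists>C\<ge>0. \<forall>t\<in>{0..1}. \<forall>a. norm (\<tau> t a) \<le> C * norm a"
proof -
  define X where "X n = {a. \<forall>t\<in>{0..1}. norm (\<tau> t a) \<le> real n}" for n
  have cl: "closed (X n)" for n
  proof -
    have "X n = (\<Inter>t\<in>{0..1}. {a. norm (\<tau> t a) \<le> real n})" by (auto simp: X_def)
    moreover have "closed {a. norm (\<tau> t a) \<le> real n}" if "t \<in> {0..1}" for t
      by (intro closed_Collect_le continuous_on_norm linear_continuous_on lin that continuous_on_const)
    ultimately show ?thesis by auto
  qed
  have un: "\<Union>(range X) = UNIV"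
  proof -
    have "\<exists>n. a \<in> X n" for a
    proof -
      have "compact ((\<lambda>t. \<tau> t a) ` {0..1})" by (intro compact_continuous_image cont) auto
      then have "bounded ((\<lambda>t. \<tau> t a) ` {0..1})" by (rule compact_imp_bounded)
      then obtain B where B: "\<And>t. t \<in> {0..1} \<Longrightarrow> norm (\<tau> t a) \<le> B"
        unfolding bounded_iff by blast
      obtain n where n: "B \<le> real n" using real_arch_simple by blast
      have "a \<in> X n" unfolding X_def using order_trans[OF B n] by simp
      then show ?thesis ..
    qed
    then show ?thesis by auto
  qed
  have "\<exists>n. interior (X n) \<noteq> {}"
  proof (rule ccontr)
    assume "\<not> ?thesis"
    then have "euclidean interior_of \<Union>(range X) = {}"
      by (intro Baire_category_alt) (auto simp: cl completely_metrizable_space_euclidean)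
    then show False by (simp add: un)
  qed
  then obtain n a0 where "a0 \<in> interior (X n)" by blast
  then obtain r where r: "0 < r" "ball a0 r \<subseteq> X n" by (auto simp: mem_interior)
  show ?thesis
  \<comment> \<open>A vector of length \<open>r / 2\<close> is a difference of two elements of the
    ball, whose images have norm at most \<open>n\<close> each; the constant is \<open>2 * n\<close>
    divided by \<open>r / 2\<close>.\<close>
  proof (intro exI[of _ "4 * real n / r"] conjI ballI allI)
    fix t :: real and a assume t: "t \<in> {0..1}"
    show "norm (\<tau> t a) \<le> 4 * real n / r * norm a"
    proof (cases "a = 0")
      case True
      then show ?thesis using linear_0[OF bounded_linear.linear[OF lin[OF t]]] by simp
    next
      case False
      define s where "s = r / (2 * norm a)"
      have s: "0 < s" using r False by (simp add: s_def)
      have "a0 + s *\<^sub>R a \<in> ball a0 r" "a0 \<in> ball a0 r" using r False by (auto simp: dist_norm s_def)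
      then have "a0 + s *\<^sub>R a \<in> X n" "a0 \<in> X n" using r(2) by blast+
      then have b: "norm (\<tau> t (a0 + s *\<^sub>R a)) \<le> real n" "norm (\<tau> t a0) \<le> real n"
        using t by (simp_all add: X_def)
      interpret bounded_linear "\<tau> t" by (rule lin[OF t])
      have "s *\<^sub>R \<tau> t a = \<tau> t (a0 + s *\<^sub>R a) - \<tau> t a0" by (simp add: add scaleR)
      then have "s * norm (\<tau> t a) = norm (\<tau> t (a0 + s *\<^sub>R a) - \<tau> t a0)" using s by (metis abs_of_pos norm_scaleR)
      also have "\<dots> \<le> 2 * real n" using norm_triangle_ineq4[of "\<tau> t (a0 + s *\<^sub>R a)" "\<tau> t a0"] b by simp
      finally show ?thesis using r False by (simp add: s_def field_simps)
    qed
  qed (use r in auto)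
qed

section \<open>Interpolating cyclic permutations\<close>

text \<open>Slot \<open>k\<close> carries the parameter \<open>vdc k\<close> (van der Corput sequence), and \<open>cyc n\<close> is the cyclic
  permutation of the slots below \<open>2 ^ n\<close> in the order of their parameters. Passing from \<open>n\<close> to \<open>n + 1\<close> inserts the
  slot \<open>2 ^ n + j\<close> directly after the slot \<open>j\<close>, which halves every gap. Slot \<open>0\<close> has
  parameter \<open>0\<close> as a source but \<open>1\<close> as a target, see \<open>vdc_end\<close>.\<close>

primrec cyc :: "nat \<Rightarrow> nat \<Rightarrow> nat" where
  "cyc 0 k = k"
| "cyc (Suc n) k = (if k < 2 ^ n then k + 2 ^ n else if k < 2 ^ Suc n then cyc n (k - 2 ^ n) else k)"

primrec cyc_inv :: "nat \<Rightarrow> nat \<Rightarrow> nat" where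
  "cyc_inv 0 k = k"
| "cyc_inv (Suc n) k = (if k < 2 ^ n then cyc_inv n k + 2 ^ n else if k < 2 ^ Suc n then k - 2 ^ n else k)"

lemma cyc_fixed: "2 ^ n \<le> k \<Longrightarrow> cyc n k = k"
  by (cases n) auto

lemma cyc_inv_fixed: "2 ^ n \<le> k \<Longrightarrow> cyc_inv n k = k"
  by (cases n) auto

lemma cyc_less: "k < 2 ^ n \<Longrightarrow> cyc n k < 2 ^ n"
proof (induction n arbitrary: k)
  case (Suc n)
  show ?case
  proof (cases "k < 2 ^ n")
    case False
    then have "cyc n (k - 2 ^ n) < 2 ^ n" using Suc.prems by (intro Suc.IH) auto
    then show ?thesis using False Suc.prems by simp
  qed auto
qed simp

lemma cyc_inv_less: "k < 2 ^ n \<Longrightarrow> cyc_inv n k < 2 ^ n"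
proof (induction n arbitrary: k)
  case (Suc n)
  show ?case using Suc.IH[of k] Suc.prems by auto
qed simp

lemma cyc_inv_cyc [simp]: "cyc_inv n (cyc n k) = k"
proof (induction n arbitrary: k)
  case (Suc n)
  have "cyc n (k - 2 ^ n) < 2 ^ n" if "\<not> k < 2 ^ n" "k < 2 ^ Suc n" using that by (intro cyc_less) auto
  then show ?case using Suc by auto
qed simp

lemma cyc_cyc_inv [simp]: "cyc n (cyc_inv n k) = k"
proof (induction n arbitrary: k)
  case (Suc n)
  show ?case using Suc cyc_inv_less[of k n] by auto
qed simp

text \<open>Both sides exchange \<open>j\<close> and \<open>2 ^ n + j\<close> for
  \<open>j < 2 ^ n\<close> and fix the rest. They are inverse to each other by construction, so
  their equality says that this swap is an involution.\<close>

lemma cyc_inv_Suc_cyc: "cyc_inv (Suc n) (cyc n k) = cyc_inv n (cyc (Suc n) k)"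
  using cyc_less[of k n] by (auto simp: cyc_fixed cyc_inv_fixed not_less)

lemma cyc_Suc_cyc_inv: "cyc (Suc n) (cyc_inv n k) = cyc n (cyc_inv (Suc n) k)"
  using cyc_inv_less[of k n] by (auto simp: cyc_fixed cyc_inv_fixed not_less)

fun vdc :: "nat \<Rightarrow> real" where
  "vdc k = (if k = 0 then 0 else (of_bool (odd k) + vdc (k div 2)) / 2)"

declare vdc.simps [simp del]

lemma vdc_0 [simp]: "vdc 0 = 0"
  by (simp add: vdc.simps)

lemma vdc_range: "0 \<le> vdc k \<and> vdc k < 1"
proof (induction k rule: vdc.induct)
  case (1 k)
  then show ?case by (subst (1 2) vdc.simps) auto
qed

lemma vdc_dyadic: "dyadic (vdc k)"
proof (induction k rule: vdc.induct)
  case (1 k)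
  show ?case
  proof (cases "k = 0")
    case True
    then show ?thesis by (auto simp: dyadic_def intro!: exI[of _ 0])
  next
    case False
    then obtain m n where "vdc (k div 2) = real m / 2 ^ n" using 1 by (auto simp: dyadic_def)
    then have "vdc k = real (of_bool (odd k) * 2 ^ n + m) / 2 ^ Suc n"
      using False by (subst vdc.simps) (simp add: field_simps)
    then show ?thesis unfolding dyadic_def by blast
  qed
qed

text \<open>Bit reversal: the binary digit of weight \<open>2 ^ n\<close> becomes the digit of
  weight \<open>1 / 2 ^ Suc n\<close>.\<close>

lemma vdc_add_power: "j < 2 ^ n \<Longrightarrow> vdc (j + 2 ^ n) = vdc j + 1 / 2 ^ Suc n"
proof (induction n arbitrary: j)
  case 0
  then show ?case by (simp add: vdc.simps[of "Suc 0"])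
next
  case (Suc n)
  have "(j + 2 ^ Suc n) div 2 = j div 2 + 2 ^ n" by simp
  moreover have "vdc (j div 2 + 2 ^ n) = vdc (j div 2) + 1 / 2 ^ Suc n" using Suc by (intro Suc.IH) auto
  moreover have "vdc j = (of_bool (odd j) + vdc (j div 2)) / 2"
    by (cases "j = 0") (simp_all add: vdc.simps[of j])
  moreover have "vdc (j + 2 ^ Suc n) = (of_bool (odd j) + vdc ((j + 2 ^ Suc n) div 2)) / 2"
    by (subst vdc.simps) simp
  ultimately show ?case by (simp only: add_divide_distrib) simp
qed

definition vdc_end :: "nat \<Rightarrow> real" where
  "vdc_end k = (if k = 0 then 1 else vdc k)"

text \<open>In the induction an old slot moves to its new right neighbour, half the old gap away;
  the new slot after \<open>j\<close>, already half a gap ahead, moves to the old successor of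
  \<open>j\<close>. The last slot reaches slot \<open>0\<close>, which therefore needs the value
  \<open>1\<close> as a target.\<close>

lemma vdc_end_cyc: "k < 2 ^ n \<Longrightarrow> vdc_end (cyc n k) = vdc k + 1 / 2 ^ n"
proof (induction n arbitrary: k)
  case 0
  then show ?case by (simp add: vdc_end_def)
next
  case (Suc n)
  show ?case
  proof (cases "k < 2 ^ n")
    case True
    then show ?thesis by (simp add: vdc_end_def vdc_add_power)
  next
    case False
    define j where "j = k - 2 ^ n"
    have j: "j < 2 ^ n" "k = j + 2 ^ n" using False Suc.prems by (auto simp: j_def)
    then show ?thesis using Suc.IH[OF j(1)] vdc_add_power[OF j(1)] by simp
  qed
qed

text \<open>Pull-back form: the value at \<open>j\<close> is read off at two source points, so the
  contents move by the inverses of the maps \<open>g\<close>. The stage \<open>N j\<close> may vary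
  with the point.\<close>

definition interp :: "('j \<Rightarrow> nat) \<Rightarrow> ('j \<Rightarrow> complex) \<Rightarrow> (nat \<Rightarrow> 'j \<Rightarrow> 'j) \<Rightarrow> ('j \<Rightarrow> complex) \<Rightarrow> 'j \<Rightarrow> complex" where
  "interp N u g x j = (1 + u j) / 2 * x (g (N j) j) + (1 - u j) / 2 * x (g (Suc (N j)) j)"

text \<open>Consecutive permutations differ by an involution, so that the coefficients
  \<open>(1 + u) / 2\<close> and \<open>(1 - u) / 2\<close>, \<open>norm u = 1\<close>, interpolate between them by unitaries.\<close>

locale interpolation =
  fixes N :: "'j \<Rightarrow> nat" and u :: "'j \<Rightarrow> complex" and g h :: "nat \<Rightarrow> 'j \<Rightarrow> 'j"
  assumes gh [simp]: "g n (h n j) = j" and hg [simp]: "h n (g n j) = j"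
    and Ng [simp]: "N (g n j) = N j" and Nh [simp]: "N (h n j) = N j"
    and ug [simp]: "u (g n j) = u j" and uh [simp]: "u (h n j) = u j"
    and gSh: "g (Suc n) (h n j) = g n (h (Suc n) j)"
    and hSg: "h (Suc n) (g n j) = h n (g (Suc n) j)"
    and norm_u: "norm (u j) = 1"
begin

lemma cnj_u: "cnj (u j) * u j = 1"
  using norm_u[of j] by (metis complex_norm_square mult.commute of_real_1 one_power2)

text \<open>By \<open>gSh\<close> the two mixed terms meet at the same point, with coefficient
  \<open>2 - 2 * (cnj u * u) = 0\<close>, while the diagonal coefficients add up to
  \<open>2 + 2 * (cnj u * u) = 4\<close>.\<close>

lemma interp_inverse: "interp N (\<lambda>j. cnj (u j)) h (interp N u g x) = x"
proof
  fix j
  have "4 * interp N (\<lambda>j. cnj (u j)) h (interp N u g x) j =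
    ((1 + cnj (u j)) * (1 + u j) + (1 - cnj (u j)) * (1 - u j)) * x j
    + ((1 + cnj (u j)) * (1 - u j) + (1 - cnj (u j)) * (1 + u j)) * x (g (N j) (h (Suc (N j)) j))"
    by (simp add: interp_def gSh field_simps)
  also have "\<dots> = 4 * x j + (2 - 2 * (cnj (u j) * u j)) * x (g (N j) (h (Suc (N j)) j)) + (2 * (cnj (u j) * u j) - 2) * x j"
    by (simp add: algebra_simps)
  also have "\<dots> = 4 * x j" by (simp add: cnj_u)
  finally show "interp N (\<lambda>j. cnj (u j)) h (interp N u g x) j = x j" by simp
qed

lemma dual: "interpolation N (\<lambda>j. cnj (u j)) h g"
  by unfold_locales (simp_all add: gSh hSg norm_u)

lemma interp_inverse': "interp N u g (interp N (\<lambda>j. cnj (u j)) h x) = x"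
  using interpolation.interp_inverse[OF dual] by simp

lemma inj_stage: "inj (\<lambda>j. g (N j) j)" "inj (\<lambda>j. g (Suc (N j)) j)"
  by (rule inj_on_inverseI[where g = "\<lambda>j. h (N j) j"], simp)
    (rule inj_on_inverseI[where g = "\<lambda>j. h (Suc (N j)) j"], simp)

lemma bij_stage: "bij (\<lambda>j. g (N j) j)" "bij (\<lambda>j. g (Suc (N j)) j)"
proof -
  have "surj (\<lambda>j. g (N j) j)" by (rule surjI[where f = "\<lambda>j. h (N j) j"]) simp
  moreover have "surj (\<lambda>j. g (Suc (N j)) j)" by (rule surjI[where f = "\<lambda>j. h (Suc (N j)) j"]) simp
  ultimately show "bij (\<lambda>j. g (N j) j)" "bij (\<lambda>j. g (Suc (N j)) j)"
    using inj_stage by (simp_all add: bij_def)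
qed

lemma opb_interp: assumes "lp_exponent p" shows "lp_exponent.opb p 2 (interp N u g)"
proof -
  interpret lp_exponent p by fact
  have b: "norm ((1 + u j) / 2) \<le> 1" "norm ((1 - u j) / 2) \<le> 1" for j
    using norm_triangle_ineq[of 1 "u j"] norm_triangle_ineq4[of 1 "u j"] by (simp_all add: norm_u norm_divide)
  have "opb 2 (\<lambda>x. mul (\<lambda>j. (1 + u j) / 2) (x \<circ> (\<lambda>j. g (N j) j))
      + mul (\<lambda>j. (1 - u j) / 2) (x \<circ> (\<lambda>j. g (Suc (N j)) j)))"
    using opb_plus[OF opb_comp[OF opb_mul[OF b(1)] opb_reindex[OF inj_stage(1)]]
      opb_comp[OF opb_mul[OF b(2)] opb_reindex[OF inj_stage(2)]]] by simp
  then show ?thesis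
  proof (rule opb_cong)
    show "interp N u g x = mul (\<lambda>j. (1 + u j) / 2) (x \<circ> (\<lambda>j. g (N j) j))
      + mul (\<lambda>j. (1 - u j) / 2) (x \<circ> (\<lambda>j. g (Suc (N j)) j))" for x
      by (auto simp: interp_def mul_def fun_eq_iff)
  qed
qed

text \<open>The involution \<open>?w\<close> interchanges the two points sampled by
  \<open>interp\<close>, so the parallelogram law applies to the values at \<open>j\<close> and
  \<open>?w j\<close>. Summing over all \<open>j\<close> counts everything twice on both
  sides.\<close>

lemma lpnorm_2_interp: assumes x: "x \<in> lp 2" shows "lpnorm 2 (interp N u g x) = lpnorm 2 x"
proof -
  interpret lp_exponent 2 by unfold_locales simp
  let ?S = "interp N u g x" and ?w = "\<lambda>j. h (N j) (g (Suc (N j)) j)"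
  have Sx: "?S \<in> lp 2" using opb_lp[OF opb_interp[OF lp_exponent_axioms] x] .
  have w1: "g (N j) (?w j) = g (Suc (N j)) j" "g (Suc (N j)) (?w j) = g (N j) j" for j
    by (simp, metis gh hSg)
  have "?w (?w j) = j" for j using w1[of j] by simp
  then have w: "bij ?w" by (intro o_bij[where g = ?w]) (auto simp: fun_eq_iff)
  have reindex: "((\<lambda>j. norm (y (f j)) powr 2) has_sum (lpnorm 2 y powr 2)) UNIV"
    if "bij f" "y \<in> lp 2" for f :: "'j \<Rightarrow> 'j" and y
  proof -
    have "((\<lambda>j. norm (y j) powr 2) has_sum (lpnorm 2 y powr 2)) (f ` UNIV)"
      using that has_sum_infsum[OF lp_summable[OF that(2)]] by (simp add: lpnorm_powr bij_def)
    then show ?thesis using that(1) by (subst (asm) has_sum_reindex) (auto simp: bij_def comp_def)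
  qed
  have pt: "norm (?S j) powr 2 + norm (?S (?w j)) powr 2
      = norm (x (g (N j) j)) powr 2 + norm (x (g (Suc (N j)) j)) powr 2" for j
  proof -
    have par: "norm ((1 + v) / 2 * a + (1 - v) / 2 * b) ^ 2 + norm ((1 + v) / 2 * b + (1 - v) / 2 * a) ^ 2
        = norm a ^ 2 + norm b ^ 2" if "norm v = 1" for v a b :: complex
    proof -
      define s t where "s = (a + b) / 2" and "t = v * (a - b) / 2"
      have "norm (s + t) ^ 2 + norm (s - t) ^ 2 = 2 * norm s ^ 2 + 2 * norm t ^ 2"
        unfolding cmod_power2 by (simp add: power2_eq_square algebra_simps)
      also have "\<dots> = 2 * norm ((a + b) / 2) ^ 2 + 2 * norm ((a - b) / 2) ^ 2"
        using that by (simp add: s_def t_def norm_mult norm_divide)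
      also have "\<dots> = norm a ^ 2 + norm b ^ 2"
        unfolding cmod_power2 by (simp add: field_simps power2_eq_square)
      finally show ?thesis by (simp add: s_def t_def field_simps)
    qed
    show ?thesis using par[OF norm_u[of j], of "x (g (N j) j)" "x (g (Suc (N j)) j)"] w1[of j]
      by (simp add: interp_def)
  qed
  have "((\<lambda>j. norm (?S j) powr 2 + norm (?S (?w j)) powr 2) has_sum (lpnorm 2 ?S powr 2 + lpnorm 2 ?S powr 2)) UNIV"
    by (intro has_sum_add reindex[OF w Sx] reindex[OF bij_id Sx, unfolded id_apply])
  moreover have "((\<lambda>j. norm (x (g (N j) j)) powr 2 + norm (x (g (Suc (N j)) j)) powr 2)
      has_sum (lpnorm 2 x powr 2 + lpnorm 2 x powr 2)) UNIV"
    by (intro has_sum_add reindex[OF bij_stage(1) x] reindex[OF bij_stage(2) x])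
  ultimately have "lpnorm 2 ?S powr 2 + lpnorm 2 ?S powr 2 = lpnorm 2 x powr 2 + lpnorm 2 x powr 2"
    unfolding pt by (rule has_sum_unique)
  then show ?thesis by simp
qed

end

section \<open>Compactness of the intertwining error\<close>

declare cyc.simps(2) [simp del] cyc_inv.simps(2) [simp del]

text \<open>Stage \<open>n\<close> is the interval of coordinates from \<open>c n\<close> up to
  \<open>c (Suc n)\<close>, across which \<open>U n\<close> turns from \<open>1\<close> to
  \<open>- 1\<close>, that is, from the permutation of level \<open>n\<close> to that of level
  \<open>n + 1\<close>.\<close>

locale lp_stages = lp_exponent +
  fixes c :: "nat \<Rightarrow> nat" and U :: "nat \<Rightarrow> nat \<Rightarrow> complex"
  assumes c_0: "c 0 = 0" and c_Suc: "c n < c (Suc n)"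
    and norm_U: "norm (U n i) = 1"
    and U_before: "i < c n \<Longrightarrow> U n i = 1"
    and U_after: "c (Suc n) \<le> i \<Longrightarrow> U n i = - 1"
begin

lemma c_strict_mono: "strict_mono c"
  using c_Suc by (simp add: strict_mono_Suc_iff)

lemma c_ge: "n \<le> c n"
  using strict_mono_imp_increasing[OF c_strict_mono] .

definition stage :: "nat \<Rightarrow> nat" where
  "stage i = (LEAST n. i < c (Suc n))"

lemma stage_upper: "i < c (Suc (stage i))"
  unfolding stage_def by (rule LeastI[of _ i]) (use c_ge[of "Suc i"] in simp)

lemma stage_less_iff: "stage i < n \<longleftrightarrow> i < c n"
proof
  assume "stage i < n"
  then have "c (Suc (stage i)) \<le> c n" using c_strict_mono by (simp add: strict_mono_less_eq)
  then show "i < c n" using stage_upper[of i] by simp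
next
  assume i: "i < c n"
  then obtain m where m: "n = Suc m" using c_0 by (cases n) auto
  then have "stage i \<le> m" unfolding stage_def using i by (intro Least_le) simp
  then show "stage i < n" using m by simp
qed

text \<open>The share of the passage from level \<open>n\<close> to level \<open>n + 1\<close>
  already carried out at coordinate \<open>i\<close>: zero before stage \<open>n\<close>, one after
  it, complex in between.\<close>

definition gam :: "nat \<Rightarrow> nat \<Rightarrow> complex" where
  "gam n i = (1 - U n i) / 2"

lemma gam_before: "stage i < n \<Longrightarrow> gam n i = 0"
  by (simp add: gam_def U_before stage_less_iff)

lemma gam_after: "n < stage i \<Longrightarrow> gam n i = 1"
  using U_after[of n i] stage_less_iff[of i "Suc n"] by (simp add: gam_def)

lemma norm_gam: "norm (gam n i) \<le> 1"
  using norm_triangle_ineq4[of 1 "U n i"] by (simp add: gam_def norm_divide norm_U)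

definition uu :: "nat \<Rightarrow> complex" where
  "uu i = U (stage i) i"

definition rot :: "(nat \<times> nat \<Rightarrow> complex) \<Rightarrow> nat \<times> nat \<Rightarrow> complex" where
  "rot = interp (\<lambda>(k, i). stage i) (\<lambda>(k, i). uu i) (\<lambda>n (k, i). (cyc_inv n k, i))"

definition perm :: "nat \<Rightarrow> (nat \<times> nat \<Rightarrow> complex) \<Rightarrow> nat \<times> nat \<Rightarrow> complex" where
  "perm n x = (\<lambda>(k, i). x (cyc_inv n k, i))"

lemma rot_interpolation:
  "interpolation (\<lambda>(k, i). stage i) (\<lambda>(k, i). uu i) (\<lambda>n (k, i). (cyc_inv n k, i)) (\<lambda>n (k, i). (cyc n k, i))"
  by unfold_locales
    (auto simp: split_def uu_def norm_U intro: cyc_inv_Suc_cyc cyc_Suc_cyc_inv)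

lemma opb_rot: "opb 2 rot"
  unfolding rot_def by (rule interpolation.opb_interp[OF rot_interpolation lp_exponent_axioms])

lemma opb_perm: "opb 1 (perm n)"
proof -
  have "inj (\<lambda>(k, i). (cyc_inv n k, i::nat))"
    by (rule inj_on_inverseI[where g = "\<lambda>(k, i). (cyc n k, i)"]) auto
  from opb_reindex[OF this] show ?thesis
    by (rule opb_cong) (auto simp: perm_def fun_eq_iff)
qed

definition coord :: "(nat \<Rightarrow> complex) \<Rightarrow> nat \<times> nat \<Rightarrow> complex" where
  "coord f = (\<lambda>(k, i). f i)"

lemma opb_coord: "(\<And>i. norm (f i) \<le> C) \<Longrightarrow> opb C (mul (coord f))"
  by (intro opb_mul) (auto simp: coord_def)

lemma perm_coord: "perm n (mul (coord f) x) = mul (coord f) (perm n x)"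
  by (auto simp: perm_def mul_def coord_def fun_eq_iff)

text \<open>Partial sums of the telescoping expansion of \<open>rot\<close>, starting from
  \<open>perm 0\<close>, the identity. They turn the intertwining error into a series that can be
  treated stage by stage.\<close>

definition prot :: "nat \<Rightarrow> (nat \<times> nat \<Rightarrow> complex) \<Rightarrow> nat \<times> nat \<Rightarrow> complex" where
  "prot M x = x + (\<Sum>n<M. mul (coord (gam n)) (perm (Suc n) x - perm n x))"

lemma prot_eq: "prot M x (k, i) = (if stage i < M then rot x (k, i) else perm M x (k, i))"
proof (induction M)
  case 0
  show ?case by (simp add: prot_def perm_def)
next
  case (Suc M)
  have *: "prot (Suc M) x (k, i) = prot M x (k, i) + gam M i * (perm (Suc M) x (k, i) - perm M x (k, i))"
    by (simp add: prot_def mul_def coord_def)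
  show ?case
  proof (cases "stage i" M rule: linorder_cases)
    case less
    then show ?thesis using * Suc gam_before[OF less] by simp
  next
    case equal
    then have P: "prot M x (k, i) = perm M x (k, i)" using Suc by simp
    show ?thesis unfolding * P using equal by (simp add: rot_def interp_def perm_def gam_def uu_def field_simps)
  next
    case greater
    then show ?thesis using * Suc gam_after[OF greater] by simp
  qed
qed

lemma cut_coordinates_tendsto_0:
  assumes "y \<in> lp p"
  shows "(\<lambda>M. lpnorm p (cut {(k :: nat, i). c M \<le> i} y)) \<longlonglongrightarrow> 0"
proof (rule LIMSEQ_I)
  fix e :: real assume e: "0 < e"
  then obtain F where F: "finite F" "lpnorm p (cut (- F) y) \<le> e / 2"
    using lp_tail_small[OF assms, of "e / 2"] by auto
  obtain m where m: "\<And>i. i \<in> snd ` F \<Longrightarrow> i < m"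
    using finite_nat_set_iff_bounded[of "snd ` F"] F(1) by auto
  have "norm (lpnorm p (cut {(k, i). c M \<le> i} y) - 0) < e" if "m \<le> M" for M
  proof -
    have "(k, i) \<notin> F" if "c M \<le> i" for k i
      using m[of i] that \<open>m \<le> M\<close> c_ge[of M] by (force simp: image_iff)
    then have "cut {(k, i). c M \<le> i} y = cut {(k, i). c M \<le> i} (cut (- F) y)"
      by (auto simp: cut_def fun_eq_iff)
    then have "lpnorm p (cut {(k, i). c M \<le> i} y) \<le> e / 2"
      using lp_cut(2)[OF lp_cut(1)[OF assms], of "{(k, i). c M \<le> i}" "- F"] F(2) by simp
    then show ?thesis using e by simp
  qed
  then show "\<exists>m. \<forall>M\<ge>m. norm (lpnorm p (cut {(k, i). c M \<le> i} y) - 0) < e" by blast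
qed

text \<open>The partial sums agree with \<open>rot\<close> below coordinate \<open>c M\<close>.
  Beyond it, the norms of \<open>rot x\<close> and of the permuted \<open>x\<close> tend to
  zero.\<close>

lemma prot_tendsto:
  assumes x: "x \<in> lp p" and T: "opb C T"
  shows "(\<lambda>M. T (prot M x) j) \<longlonglongrightarrow> T (rot x) j"
proof -
  let ?A = "\<lambda>M. {(k::nat, i). c M \<le> i}"
  have rx: "rot x \<in> lp p" using opb_lp[OF opb_rot x] .
  have px: "perm M x \<in> lp p" for M using opb_lp[OF opb_perm x] .
  have diff: "rot x - prot M x = cut (?A M) (rot x) - perm M (cut (?A M) x)" for M
    by (auto simp: fun_eq_iff prot_eq cut_def perm_def stage_less_iff)
  have lpc: "cut (?A M) (rot x) \<in> lp p" "perm M (cut (?A M) x) \<in> lp p" for M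
    by (intro lp_cut rx opb_lp[OF opb_perm] x)+
  have lpd: "rot x - prot M x \<in> lp p" for M unfolding diff by (intro lp_diff lpc)
  have lpp: "prot M x \<in> lp p" for M using lp_diff(1)[OF rx lpd[of M]] by simp
  have bound: "norm (T (prot M x) j - T (rot x) j) \<le> C * (lpnorm p (cut (?A M) (rot x)) + lpnorm p (cut (?A M) x))" for M
  proof -
    have "T (rot x) j - T (prot M x) j = T (rot x - prot M x) j"
      using opb_diff[OF T rx lpp] by simp
    then have "norm (T (prot M x) j - T (rot x) j) = norm (T (rot x - prot M x) j)"
      by (metis norm_minus_commute)
    also have "\<dots> \<le> lpnorm p (T (rot x - prot M x))"
      by (intro norm_le_lpnorm opb_lp[OF T] lpd)
    also have "\<dots> \<le> C * lpnorm p (rot x - prot M x)" by (intro opb_bound[OF T] lpd)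
    also have "\<dots> \<le> C * (lpnorm p (cut (?A M) (rot x)) + lpnorm p (perm M (cut (?A M) x)))"
      unfolding diff by (intro mult_left_mono lp_diff lpc opb_const_nonneg[OF T])
    also have "\<dots> \<le> C * (lpnorm p (cut (?A M) (rot x)) + lpnorm p (cut (?A M) x))"
      using opb_bound[OF opb_perm lp_cut(1)[OF x]]
      by (intro mult_left_mono add_left_mono opb_const_nonneg[OF T]) simp
    finally show ?thesis .
  qed
  have "(\<lambda>M. C * (lpnorm p (cut (?A M) (rot x)) + lpnorm p (cut (?A M) x))) \<longlonglongrightarrow> C * (0 + 0)"
    by (intro tendsto_intros cut_coordinates_tendsto_0 rx x)
  then have "(\<lambda>M. C * (lpnorm p (cut (?A M) (rot x)) + lpnorm p (cut (?A M) x))) \<longlonglongrightarrow> 0" by simp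
  then have "(\<lambda>M. T (prot M x) j - T (rot x) j) \<longlonglongrightarrow> 0"
    by (rule Lim_null_comparison[rotated]) (use bound in auto)
  then show ?thesis by (simp add: LIM_zero_iff)
qed

definition comm :: "(nat \<Rightarrow> complex) \<Rightarrow> ((nat \<Rightarrow> complex) \<Rightarrow> nat \<Rightarrow> complex) \<Rightarrow> (nat \<Rightarrow> complex) \<Rightarrow> nat \<Rightarrow> complex" where
  "comm f T x = mul f (T x) - T (mul f x)"

lemma bigsum_comm:
  "mul (coord f) (bigsum T x) - bigsum T (mul (coord f) x) = bigsum (\<lambda>k. comm f (T k)) x"
  by (auto simp: fun_eq_iff mul_def coord_def bigsum_def comm_def)

lemma opb_comm:
  assumes "opb C T" "\<And>i. norm (f i) \<le> D" shows "opb (D * C + C * D) (comm f T)"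
  unfolding comm_def[abs_def] by (intro opb_minus opb_comp[OF opb_mul] opb_comp[OF _ opb_mul] assms)

lemma comm_gam:
  assumes T: "opb C T" and x: "x \<in> lp p"
  shows "comm (gam n) T x = mul (\<lambda>_. - 1 / 2) (comm (U n) T x)"
proof -
  have m: "mul (U n) x \<in> lp p" using lp_mul(1)[OF x, of "U n" 1] by (simp add: norm_U)
  have g: "mul (gam n) y = mul (\<lambda>_. 1 / 2) (y - mul (U n) y)" for y
    by (auto simp: mul_def gam_def fun_eq_iff field_simps)
  have eq: "T (mul (gam n) x) = mul (\<lambda>_. 1 / 2) (T x - T (mul (U n) x))"
    unfolding g using m x by (simp add: opb_scale[OF T] opb_diff[OF T] lp_diff)
  show ?thesis
    unfolding comm_def eq g[of "T x"] by (auto simp: mul_def fun_eq_iff field_simps)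
qed

lemma opb_comm_gam:
  assumes T: "opb C T" and e: "opb e (comm (U n) T)"
  shows "opb e (comm (gam n) T)"
proof -
  have "opb (1 * e) (\<lambda>x. mul (\<lambda>_. - 1 / 2) (comm (U n) T x))"
    by (intro opb_comp[OF opb_mul] e) (simp add: norm_divide)
  then show ?thesis using opb_cong[OF _ comm_gam[OF T]] by simp
qed

lemma cpt_finite_mul:
  fixes n :: nat
  assumes T: "opb C T" and f: "\<And>i. n \<le> i \<Longrightarrow> f i = 0" "\<And>i. norm (f i) \<le> D"
  shows "cpt (\<lambda>x. mul f (T x))" "cpt (\<lambda>x. T (mul f x))"
proof -
  have f1: "\<not> i < n \<Longrightarrow> f i = 0" for i using f(1)[of i] by simp
  have eq: "mul f y = cut {..<n} (mul f y)" for y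
    using f1 by (auto simp: mul_def cut_def fun_eq_iff)
  show "cpt (\<lambda>x. mul f (T x))"
    by (rule cpt_cong[OF cpt_cut_comp[OF opb_comp[OF opb_mul[OF f(2)] T] finite_lessThan] eq])
  show "cpt (\<lambda>x. T (mul f x))"
    by (rule cpt_cong[OF cpt_comp_right[OF cpt_comp_cut[OF T finite_lessThan] opb_mul[OF f(2)]]
        arg_cong[where f = T, OF eq]])
qed

text \<open>\<open>1 - gam n\<close> vanishes from \<open>c (Suc n)\<close> on, and the constant
  \<open>1\<close> commutes with \<open>T\<close>, so both halves of the commutator factor through
  finitely many coordinates.\<close>

lemma cpt_comm_gam:
  assumes T: "opb C T"
  shows "cpt (comm (gam n) T)"
proof -
  let ?f = "\<lambda>i. 1 - gam n i"
  have f: "?f i = 0" if "c (Suc n) \<le> i" for i using that by (simp add: gam_def U_after)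
  have f2: "norm (?f i) \<le> 2" for i using norm_triangle_ineq4[of 1 "gam n i"] norm_gam[of n i] by simp
  have "cpt (\<lambda>x. T (mul ?f x) - mul ?f (T x))"
    by (intro cpt_minus cpt_finite_mul[OF T f f2])
  then show ?thesis
  proof (rule cpt_cong)
    fix x :: "nat \<Rightarrow> complex" assume x: "x \<in> lp p"
    have m: "mul (gam n) x \<in> lp p" using lp_mul(1)[OF x norm_gam] .
    have e: "mul ?f y = y - mul (gam n) y" for y by (auto simp: mul_def fun_eq_iff algebra_simps)
    have "T (mul ?f x) = T x - T (mul (gam n) x)" unfolding e by (rule opb_diff[OF T x m])
    then show "comm (gam n) T x = T (mul ?f x) - mul ?f (T x)" unfolding comm_def e[of "T x"] by simp
  qed
qed

lemma cpt_bigsum_finite: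
  assumes "\<And>k. k < m \<Longrightarrow> cpt (T k)" "\<And>k. m \<le> k \<Longrightarrow> T k = (\<lambda>x. 0)"
  shows "cpt (bigsum T)"
proof -
  have "opb e (T k)" if "0 < e" "m \<le> k" for e k
    unfolding assms(2)[OF that(2)] using that(1) by (intro opb_mono[OF opb_zero_op]) simp
  then have "eventually (\<lambda>k. opb e (T k)) sequentially" if "0 < e" for e
    using that by (auto simp: eventually_sequentially)
  moreover have "cpt (T k)" for k using assms cpt_zero by (cases "k < m") auto
  ultimately show ?thesis by (intro cpt_bigsum)
qed

text \<open>\<open>\<theta>0\<close> and \<open>\<theta>1\<close> are the slot operators before and
  after the move. Summation by parts writes the error as a series of compact operators
  \<open>T n = R n + Cn n + Bn n\<close>. The first two come from commutators and are geometrically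
  small; \<open>Bn n\<close> is only as small as the jumps, but sits on two stages. Hence the tails
  of the series are small in norm.\<close>

lemma cpt_rot_intertwines:
  fixes \<theta>0 \<theta>1 :: "nat \<Rightarrow> (nat \<Rightarrow> complex) \<Rightarrow> nat \<Rightarrow> complex"
  assumes b0: "\<And>k. opb C (\<theta>0 k)" and b1: "\<And>k. opb C (\<theta>1 k)"
    and same: "\<And>k. 0 < k \<Longrightarrow> \<theta>1 k = \<theta>0 k"
    and gap: "\<And>e. 0 < e \<Longrightarrow>
      eventually (\<lambda>n. \<forall>k<2 ^ n. opb e (\<lambda>x. \<theta>1 (cyc n k) x - \<theta>0 k x)) sequentially"
    and c0: "\<And>n k. m \<le> n \<Longrightarrow> k < 2 ^ Suc n \<Longrightarrow> opb ((1 / 2) ^ n) (comm (U n) (\<theta>0 k))"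
    and c1: "\<And>n k. m \<le> n \<Longrightarrow> k < 2 ^ Suc n \<Longrightarrow> opb ((1 / 2) ^ n) (comm (U n) (\<theta>1 k))"
  shows "cpt (\<lambda>x. bigsum \<theta>1 (rot x) - rot (bigsum \<theta>0 x))"
proof -
  let ?\<rho>0 = "bigsum \<theta>0" and ?\<rho>1 = "bigsum \<theta>1"
  have \<rho>0: "opb C ?\<rho>0" and \<rho>1: "opb C ?\<rho>1" by (intro opb_bigsum b0 b1)+
  define E where "E x = ?\<rho>1 (rot x) - rot (?\<rho>0 x)" for x
  have Eb: "opb (C * 2 + 2 * C) E" 
    unfolding E_def[abs_def] by (rule opb_minus[OF opb_comp[OF \<rho>1 opb_rot] opb_comp[OF opb_rot \<rho>0]])
  \<comment> \<open>The jump when slot \<open>k\<close> moves to its successor. Slots from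
    \<open>2 ^ n\<close> on are not moved and differ from slot \<open>0\<close>, so they contribute
    nothing to the error \<open>D n\<close> of the permutation of level \<open>n\<close>.\<close>
  define \<delta> where "\<delta> n k = (if k < 2 ^ n then (\<lambda>x. \<theta>1 (cyc n k) x - \<theta>0 k x) else (\<lambda>x. 0))" for n k
  define D where "D n x = perm n (bigsum (\<delta> n) x)" for n x
  have D_eq: "?\<rho>1 (perm n x) - perm n (?\<rho>0 x) = D n x" for n x
  proof -
    have *: "\<theta>1 k y - \<theta>0 (cyc_inv n k) y = \<delta> n (cyc_inv n k) y" for k y
    proof (cases "k < 2 ^ n")
      case True
      then show ?thesis using cyc_inv_less[OF True] by (simp add: \<delta>_def)
    next
      case False
      then have "0 < k" by (metis gr0I zero_less_numeral zero_less_power)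
      then show ?thesis using False same[of k] by (simp add: \<delta>_def cyc_inv_fixed)
    qed
    show ?thesis by (auto simp: D_def perm_def bigsum_def fun_eq_iff *[symmetric])
  qed
  \<comment> \<open>Index shift for the summation by parts: the weight \<open>\<kappa> n\<close> of
    \<open>D n\<close> is \<open>gam (n - 1) - gam n\<close>, with \<open>1\<close> in place of
    \<open>gam (n - 1)\<close> when \<open>n = 0\<close>. It vanishes off the stages
    \<open>n - 1\<close> and \<open>n\<close>.\<close>
  define G where "G n = (case n of 0 \<Rightarrow> (\<lambda>_. 1) | Suc n \<Rightarrow> gam n)" for n
  define \<kappa> where "\<kappa> n i = G n i - G (Suc n) i" for n i
  have nG: "norm (G n i) \<le> 1" for n i using norm_gam by (cases n) (auto simp: G_def)
  have n\<kappa>: "norm (\<kappa> n i) \<le> 2" for n i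
    using norm_triangle_ineq4[of "G n i" "G (Suc n) i"] nG[of n i] nG[of "Suc n" i] by (simp add: \<kappa>_def)
  have G_before: "G n i = 0" if "Suc (stage i) < n" for n i
    using that gam_before[of i "n - 1"] by (cases n) (auto simp: G_def)
  have G_after: "G n i = 1" if "n \<le> stage i" for n i
    using that gam_after[of "n - 1" i] by (cases n) (auto simp: G_def)
  have \<kappa>0: "\<kappa> n i = 0" if "stage i \<noteq> n" "Suc (stage i) \<noteq> n" for n i
    using that G_before[of i n] G_before[of i "Suc n"] G_after[of n i] G_after[of "Suc n" i]
    by (cases "n < stage i") (auto simp: \<kappa>_def)
  have \<kappa>_fin: "\<kappa> n i = 0" if "c (Suc n) \<le> i" for n i
    using that stage_less_iff[of i "Suc n"] by (intro \<kappa>0) auto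
  \<comment> \<open>Consecutive permutations agree on slots from \<open>2 ^ Suc n\<close> on, so
    only finitely many commutators enter; this makes \<open>R n\<close> compact.\<close>
  define R where "R n x = - bigsum (\<lambda>k. if k < 2 ^ Suc n then comm (gam n) (\<theta>1 k) else (\<lambda>x. 0)) (perm (Suc n) x - perm n x)" for n x
  define T where "T n x = R n x + mul (coord (\<kappa> n)) (D n x)" for n x
  have R_eq: "R n x = ?\<rho>1 (mul (coord (gam n)) (perm (Suc n) x - perm n x))
      - mul (coord (gam n)) (?\<rho>1 (perm (Suc n) x - perm n x))" if x: "x \<in> lp p" for n x
  proof -
    let ?y = "perm (Suc n) x - perm n x"
    have y0: "(\<lambda>j. ?y (k, j)) = 0" if "\<not> k < 2 ^ Suc n" for k
    proof -
      have "2 ^ n \<le> k" using that by simp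
      then have "cyc_inv (Suc n) k = k" "cyc_inv n k = k"
        using that by (auto intro!: cyc_inv_fixed)
      then show ?thesis by (simp add: perm_def fun_eq_iff)
    qed
    have z: "comm (gam n) (\<theta>1 k) 0 = 0" for k
      using opb_zero[OF opb_comm[OF b1 norm_gam]] .
    have "bigsum (\<lambda>k. if k < 2 ^ Suc n then comm (gam n) (\<theta>1 k) else (\<lambda>x. 0)) ?y
        = bigsum (\<lambda>k. comm (gam n) (\<theta>1 k)) ?y"
    proof
      fix kj :: "nat \<times> nat"
      obtain k j where [simp]: "kj = (k, j)" by fastforce
      show "bigsum (\<lambda>k. if k < 2 ^ Suc n then comm (gam n) (\<theta>1 k) else (\<lambda>x. 0)) ?y kj
          = bigsum (\<lambda>k. comm (gam n) (\<theta>1 k)) ?y kj"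
        using y0[of k] z[of k] by (cases "k < 2 ^ Suc n") (auto simp add: bigsum_def simp del: power_Suc)
    qed
    then show ?thesis unfolding R_def bigsum_comm[symmetric] by simp
  qed
  \<comment> \<open>The last summand is the boundary term; at a fixed coordinate it vanishes for
    large \<open>M\<close>, because \<open>G M\<close> does.\<close>
  have partial: "?\<rho>1 (prot M x) - prot M (?\<rho>0 x) = (\<Sum>n<M. T n x) + mul (coord (G M)) (D M x)"
    if x: "x \<in> lp p" for M x
  proof (induction M)
    case 0
    have "mul (coord (G 0)) (D 0 x) = D 0 x" by (auto simp: mul_def coord_def G_def fun_eq_iff)
    moreover have "perm 0 y = y" for y by (auto simp: perm_def fun_eq_iff)
    ultimately show ?case using D_eq[of 0 x] by (simp add: prot_def)
  next
    case (Suc M)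
    let ?d = "\<lambda>y. mul (coord (gam M)) (perm (Suc M) y - perm M y)"
    have lpd: "?d y \<in> lp p" if "y \<in> lp p" for y
      by (intro opb_lp[OF opb_coord[OF norm_gam]] lp_diff opb_lp[OF opb_perm] that)
    have step: "prot (Suc M) y = prot M y + ?d y" for y by (simp add: prot_def add.assoc)
    have lpprot: "prot M x \<in> lp p"
      unfolding prot_def
      by (intro lp_add x lp_sum opb_lp[OF opb_coord[OF norm_gam]] lp_diff opb_lp[OF opb_perm] finite_lessThan)
    have px: "perm n x \<in> lp p" for n by (rule opb_lp[OF opb_perm x])
    have 1: "?\<rho>1 (prot (Suc M) x) = ?\<rho>1 (prot M x) + ?\<rho>1 (?d x)"
      unfolding step by (rule opb_add[OF \<rho>1 lpprot lpd[OF x]])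
    have 2: "?\<rho>1 (?d x) - ?d (?\<rho>0 x) = R M x + mul (coord (gam M)) (D (Suc M) x - D M x)"
      unfolding R_eq[OF x] D_eq[symmetric] opb_diff[OF \<rho>1 px px]
      by (auto simp: mul_def fun_eq_iff algebra_simps)
    have 3: "mul (coord (gam M)) (D (Suc M) x - D M x) + mul (coord (G M)) (D M x)
       = mul (coord (\<kappa> M)) (D M x) + mul (coord (G (Suc M))) (D (Suc M) x)"
      by (auto simp: mul_def coord_def fun_eq_iff \<kappa>_def G_def algebra_simps)
    have "?\<rho>1 (prot (Suc M) x) - prot (Suc M) (?\<rho>0 x)
        = (?\<rho>1 (prot M x) - prot M (?\<rho>0 x)) + (?\<rho>1 (?d x) - ?d (?\<rho>0 x))"
      unfolding 1 step[of "?\<rho>0 x"] by simp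
    also have "\<dots> = (\<Sum>n<M. T n x) + R M x
        + (mul (coord (gam M)) (D (Suc M) x - D M x) + mul (coord (G M)) (D M x))"
      unfolding Suc 2 by simp
    also have "\<dots> = (\<Sum>n<Suc M. T n x) + mul (coord (G (Suc M))) (D (Suc M) x)"
      unfolding 3 by (simp add: T_def add.assoc)
    finally show ?case .
  qed
  have lim: "(\<lambda>M. (\<Sum>n<M. T n x) j) \<longlonglongrightarrow> E x j" if x: "x \<in> lp p" for x j
  proof -
    obtain k i where [simp]: "j = (k, i)" by fastforce
    have "(\<lambda>M. ?\<rho>1 (prot M x) j - rot (?\<rho>0 x) j) \<longlonglongrightarrow> ?\<rho>1 (rot x) j - rot (?\<rho>0 x) j"
      by (intro tendsto_diff tendsto_const prot_tendsto[OF x \<rho>1])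
    moreover have "eventually (\<lambda>M. ?\<rho>1 (prot M x) j - rot (?\<rho>0 x) j = (\<Sum>n<M. T n x) j) sequentially"
      unfolding eventually_sequentially
    proof (intro exI[of _ "Suc (Suc (stage i))"] allI impI)
      fix M assume M: "Suc (Suc (stage i)) \<le> M"
      have "prot M (?\<rho>0 x) j = rot (?\<rho>0 x) j" using M by (simp add: prot_eq)
      moreover have "mul (coord (G M)) (D M x) j = 0" using M G_before[of i M] by (simp add: mul_def coord_def)
      ultimately show "?\<rho>1 (prot M x) j - rot (?\<rho>0 x) j = (\<Sum>n<M. T n x) j"
        using fun_cong[OF partial[OF x, of M], of j] by simp
    qed
    ultimately have "(\<lambda>M. (\<Sum>n<M. T n x) j) \<longlonglongrightarrow> ?\<rho>1 (rot x) j - rot (?\<rho>0 x) j"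
      by (rule Lim_transform_eventually)
    then show ?thesis by (simp add: E_def)
  qed
  have \<delta>_b: "opb (C + C) (\<delta> n k)" for n k
    using opb_minus[OF b1[of "cyc n k"] b0[of k]] opb_mono[OF opb_zero_op, of "C + C"] opb_const_nonneg[OF b0]
    by (auto simp: \<delta>_def)
  have \<Delta>_b: "opb (C + C) (bigsum (\<delta> n))" for n by (intro opb_bigsum \<delta>_b)
  have cptR: "cpt (R n)" for n
  proof -
    have "cpt (bigsum (\<lambda>k. if k < 2 ^ Suc n then comm (gam n) (\<theta>1 k) else (\<lambda>x. 0)))"
      by (rule cpt_bigsum_finite[of "2 ^ Suc n"]) (auto intro: cpt_comm_gam[OF b1])
    from cpt_neg[OF cpt_comp_right[OF this opb_minus[OF opb_perm[of "Suc n"] opb_perm[of n]]]]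
    show ?thesis by (simp add: R_def[abs_def])
  qed
  have \<kappa>D: "mul (coord (\<kappa> n)) (D n x) = perm n (mul (coord (\<kappa> n)) (bigsum (\<delta> n) x))" for n x
    by (simp add: D_def perm_coord)
  have cptD: "cpt (\<lambda>x. mul (coord (\<kappa> n)) (D n x))" for n
  proof -
    have "cpt (bigsum (\<lambda>k x. mul (\<kappa> n) (\<delta> n k x)))"
    proof (rule cpt_bigsum_finite[of "2 ^ n"])
      show "cpt (\<lambda>x. mul (\<kappa> n) (\<delta> n k x))" for k by (rule cpt_finite_mul(1)[OF \<delta>_b \<kappa>_fin n\<kappa>])
      show "(\<lambda>x. mul (\<kappa> n) (\<delta> n k x)) = (\<lambda>x. 0)" if "2 ^ n \<le> k" for k
        using that by (auto simp: \<delta>_def mul_def fun_eq_iff)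
    qed
    from cpt_comp_left[OF opb_perm this, of n] show ?thesis
      by (rule cpt_cong) (unfold \<kappa>D, rule arg_cong[where f = "perm n"],
        auto simp: bigsum_def mul_def coord_def fun_eq_iff)
  qed
  have cptT: "cpt (T n)" for n unfolding T_def[abs_def] by (intro cpt_plus cptR cptD)
  define I where "I n = {(k::nat, i). stage i = n \<or> Suc (stage i) = n}" for n
  define Bn where "Bn n x = perm n (mul (coord (\<kappa> n)) (bigsum (\<delta> n) (cut (I n) x)))" for n x
  \<comment> \<open>On inputs killed by the weight, weight times jump is a commutator; it is small
    although its input is not confined to two stages.\<close>
  define Cn where "Cn n x = perm n (bigsum (\<lambda>k. comm (\<kappa> n) (\<delta> n k)) (cut (- I n) x))" for n x
  have T_eq: "T n x = R n x + Cn n x + Bn n x" if x: "x \<in> lp p" for n x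
  proof -
    have z: "mul (coord (\<kappa> n)) (cut (- I n) x) = 0"
      using \<kappa>0 by (auto simp: mul_def coord_def cut_def I_def fun_eq_iff)
    have "bigsum (\<delta> n) (mul (coord (\<kappa> n)) (cut (- I n) x)) = 0"
      unfolding z by (rule opb_zero[OF \<Delta>_b])
    then have 1: "bigsum (\<lambda>k. comm (\<kappa> n) (\<delta> n k)) (cut (- I n) x) = mul (coord (\<kappa> n)) (bigsum (\<delta> n) (cut (- I n) x))"
      by (simp add: bigsum_comm[symmetric])
    have lpz: "mul (coord (\<kappa> n)) (bigsum (\<delta> n) (cut A x)) \<in> lp p" for A
      by (intro opb_lp[OF opb_coord[OF n\<kappa>]] opb_lp[OF \<Delta>_b] lp_cut x)
    have "bigsum (\<delta> n) x = bigsum (\<delta> n) (cut (- I n) x) + bigsum (\<delta> n) (cut (I n) x)"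
      using opb_add[OF \<Delta>_b lp_cut(1)[OF x] lp_cut(1)[OF x], of n "- I n" "I n"] cut_add_compl[of "- I n" x]
      by simp
    then have "mul (coord (\<kappa> n)) (D n x) = Cn n x + Bn n x"
      unfolding \<kappa>D Cn_def Bn_def 1 using opb_add[OF opb_perm lpz lpz, of n "- I n" "I n"]
      by (simp add: mul_add)
    then show ?thesis by (simp add: T_def add.assoc)
  qed
  have R_b: "opb (2 * (1 / 2) ^ n) (R n)" if n: "m \<le> n" for n
  proof -
    have "opb ((1 / 2) ^ n) (bigsum (\<lambda>k. if k < 2 ^ Suc n then comm (gam n) (\<theta>1 k) else (\<lambda>x. 0)))"
    proof (rule opb_bigsum)
      fix k
      show "opb ((1 / 2) ^ n) (if k < 2 ^ Suc n then comm (gam n) (\<theta>1 k) else (\<lambda>x. 0))"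
        using opb_comm_gam[OF b1 c1[OF n]]
        by (cases "k < 2 ^ Suc n") (auto simp del: power_Suc intro!: opb_mono[OF opb_zero_op])
    qed
    from opb_neg[OF opb_comp[OF this opb_minus[OF opb_perm[of "Suc n"] opb_perm[of n]]]]
    show ?thesis by (simp add: R_def[abs_def] mult.commute)
  qed
  \<comment> \<open>The weight involves \<open>gam (n - 1)\<close> and \<open>gam n\<close>, the
    jump two operators: \<open>2 * (1 / 2) ^ (n - 1) + 2 * (1 / 2) ^ n\<close> is the constant.
    \<open>Suc m \<le> n\<close> makes the estimates available at \<open>n - 1\<close>.\<close>
  have C_b: "opb (6 * (1 / 2) ^ n) (Cn n)" if n: "Suc m \<le> n" for n
  proof -
    obtain n' where n': "n = Suc n'" "m \<le> n'" using n by (cases n) auto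
    have "opb (6 * (1 / 2) ^ n) (comm (\<kappa> n) (\<delta> n k))" for k
    proof (cases "k < 2 ^ n")
      case False
      then have "comm (\<kappa> n) (\<delta> n k) = (\<lambda>x. 0)" by (auto simp: \<delta>_def comm_def mul_def fun_eq_iff)
      then show ?thesis using opb_mono[OF opb_zero_op, of "6 * (1 / 2) ^ n"] by simp
    next
      case True
      have k: "k < 2 ^ Suc n'" "cyc n k < 2 ^ Suc n'" "k < 2 ^ Suc n" "cyc n k < 2 ^ Suc n"
        using True cyc_less[OF True] n'(1) by auto
      have mn: "m \<le> n" using n by simp
      have "opb ((1 / 2) ^ n' + (1 / 2) ^ n' + ((1 / 2) ^ n + (1 / 2) ^ n))
        (\<lambda>x. comm (gam n') (\<theta>1 (cyc n k)) x - comm (gam n') (\<theta>0 k) x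
          - (comm (gam n) (\<theta>1 (cyc n k)) x - comm (gam n) (\<theta>0 k) x))"
        using k n'(2) mn by (intro opb_minus opb_comm_gam[OF b1] opb_comm_gam[OF b0] c0 c1)
      moreover have "(1 / 2) ^ n' + (1 / 2) ^ n' + ((1 / 2) ^ n + (1 / 2) ^ n) = 6 * (1 / 2 :: real) ^ n"
        by (simp add: n'(1))
      ultimately have "opb (6 * (1 / 2) ^ n) (\<lambda>x. comm (gam n') (\<theta>1 (cyc n k)) x - comm (gam n') (\<theta>0 k) x
          - (comm (gam n) (\<theta>1 (cyc n k)) x - comm (gam n) (\<theta>0 k) x))" by simp
      then show ?thesis
      proof (rule opb_cong)
        fix x :: "nat \<Rightarrow> complex" assume x: "x \<in> lp p"
        have g: "mul (gam l) x \<in> lp p" for l by (rule lp_mul(1)[OF x norm_gam])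
        have \<kappa>_eq: "mul (\<kappa> n) y = mul (gam n') y - mul (gam n) y" for y
          by (auto simp: mul_def \<kappa>_def G_def n'(1) fun_eq_iff algebra_simps)
        show "comm (\<kappa> n) (\<delta> n k) x = comm (gam n') (\<theta>1 (cyc n k)) x - comm (gam n') (\<theta>0 k) x
          - (comm (gam n) (\<theta>1 (cyc n k)) x - comm (gam n) (\<theta>0 k) x)"
          unfolding comm_def \<kappa>_eq using True
          by (simp add: \<delta>_def opb_diff[OF b1 g g] opb_diff[OF b0 g g])
            (auto simp: mul_def fun_eq_iff algebra_simps)
      qed
    qed
    then have "opb (6 * (1 / 2) ^ n) (bigsum (\<lambda>k. comm (\<kappa> n) (\<delta> n k)))" by (rule opb_bigsum)
    from opb_comp[OF opb_perm[of n] opb_comp[OF this opb_cut[of "- I n"]]]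
    show ?thesis by (simp add: Cn_def[abs_def])
  qed
  have B_b: "opb (2 * s) (Bn n)" if "\<forall>k<2 ^ n. opb s (\<lambda>x. \<theta>1 (cyc n k) x - \<theta>0 k x)" "0 \<le> s" for n s
  proof -
    have "opb s (\<delta> n k)" for k
      using that(1) opb_mono[OF opb_zero_op that(2)] by (auto simp: \<delta>_def)
    then have "opb s (bigsum (\<delta> n))" by (rule opb_bigsum)
    from opb_comp[OF opb_perm[of n] opb_comp[OF opb_coord[OF n\<kappa>[of n]] opb_comp[OF this opb_cut[of "I n"]]]]
    show ?thesis by (simp add: Bn_def[abs_def])
  qed
  have "cpt E"
  proof (rule cpt_approx[OF Eb])
    fix e :: real assume e: "0 < e"
    \<comment> \<open>The \<open>Bn\<close> part of a tail is then at most
      \<open>4 * (2 * s) = e / 2\<close>, which leaves \<open>e / 2\<close> for the geometric part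
      \<open>16 * (1 / 2) ^ n0\<close>.\<close>
    define s where "s = e / 16"
    have s: "0 < s" using e by (simp add: s_def)
    have "eventually (\<lambda>n. \<forall>k<2 ^ n. opb s (\<lambda>x. \<theta>1 (cyc n k) x - \<theta>0 k x)) sequentially"
      using s by (rule gap)
    moreover have "(\<lambda>n. 16 * (1 / 2 :: real) ^ n) \<longlonglongrightarrow> 16 * 0"
      by (intro tendsto_mult tendsto_const LIMSEQ_realpow_zero) auto
    then have "eventually (\<lambda>n. 16 * (1 / 2 :: real) ^ n < e / 2) sequentially"
      using e by (intro order_tendstoD(2)[of _ "16 * 0"]) auto
    ultimately have "eventually (\<lambda>n. (\<forall>k<2 ^ n. opb s (\<lambda>x. \<theta>1 (cyc n k) x - \<theta>0 k x)) \<and> 16 * (1 / 2 :: real) ^ n < e / 2) sequentially"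
      by (rule eventually_conj)
    then obtain n1 where n1: "\<And>n. n1 \<le> n \<Longrightarrow> (\<forall>k<2 ^ n. opb s (\<lambda>x. \<theta>1 (cyc n k) x - \<theta>0 k x)) \<and> 16 * (1 / 2 :: real) ^ n < e / 2"
      by (auto simp: eventually_sequentially)
    define n0 where "n0 = max n1 (Suc m)"
    have tail: "opb e (\<lambda>x. \<Sum>n=n0..<M. T n x)" for M
    proof -
      have 1: "opb (\<Sum>n=n0..<M. 8 * (1 / 2) ^ n) (\<lambda>x. \<Sum>n=n0..<M. R n x + Cn n x)"
      proof (rule opb_sum_op)
        fix n assume "n \<in> {n0..<M}"
        then have "opb (2 * (1 / 2) ^ n + 6 * (1 / 2) ^ n) (\<lambda>x. R n x + Cn n x)"
          by (intro opb_plus R_b C_b) (auto simp: n0_def)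
        then show "opb (8 * (1 / 2) ^ n) (\<lambda>x. R n x + Cn n x)" by simp
      qed simp
      have 2: "opb (4 * (2 * s)) (\<lambda>x. \<Sum>n=n0..<M. Bn n x)"
      proof (rule opb_overlapping_sum[where J = I])
        show "opb (2 * s) (Bn n)" if "n \<in> {n0..<M}" for n
          using n1[of n] that s by (intro B_b) (auto simp: n0_def)
        show "Bn n x = cut (I n) (Bn n (cut (I n) x))" for n x
          using \<kappa>0 by (auto simp: Bn_def cut_cut) (auto simp: cut_def perm_def mul_def coord_def I_def fun_eq_iff)
        show "\<exists>a. {n \<in> {n0..<M}. i \<in> I n} \<subseteq> {a, Suc a}" for i
          by (intro exI[of _ "stage (snd i)"]) (auto simp: I_def)
      qed (use s in auto)
      have geo: "(\<Sum>n=n0..<M. 8 * (1 / 2 :: real) ^ n) \<le> 16 * (1 / 2) ^ n0"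
      proof (cases "n0 \<le> M")
        case True
        then have "(\<Sum>n=n0..<M. 8 * (1 / 2 :: real) ^ n) = 16 * (1 / 2) ^ n0 - 16 * (1 / 2) ^ M"
          by (induction rule: dec_induct) auto
        then show ?thesis by simp
      qed auto
      have "opb ((\<Sum>n=n0..<M. 8 * (1 / 2) ^ n) + 4 * (2 * s)) (\<lambda>x. \<Sum>n=n0..<M. T n x)"
        by (rule opb_cong[OF opb_plus[OF 1 2]]) (simp add: T_eq sum.distrib)
      moreover have "(\<Sum>n=n0..<M. 8 * (1 / 2) ^ n) + 4 * (2 * s) \<le> e"
        using geo n1[of n0] by (simp add: s_def n0_def)
      ultimately show ?thesis by (rule opb_mono)
    qed
    have "opb e (\<lambda>x. E x - (\<Sum>n<n0. T n x))"
    proof (rule opb_limit[where T = "\<lambda>M x. \<Sum>n=n0..<M. T n x", OF tail])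
      fix x :: "nat \<times> nat \<Rightarrow> complex" and j assume x: "x \<in> lp p"
      have "(\<lambda>M. (\<Sum>n<M. T n x) j - (\<Sum>n<n0. T n x) j) \<longlonglongrightarrow> E x j - (\<Sum>n<n0. T n x) j"
        by (intro tendsto_diff lim[OF x] tendsto_const)
      moreover have "eventually (\<lambda>M. (\<Sum>n<M. T n x) j - (\<Sum>n<n0. T n x) j = (\<Sum>n=n0..<M. T n x) j) sequentially"
        unfolding eventually_sequentially
      proof (intro exI[of _ n0] allI impI)
        fix M assume "n0 \<le> M"
        then have "(\<Sum>n<M. T n x) = (\<Sum>n<n0. T n x) + (\<Sum>n=n0..<M. T n x)"
          using sum.atLeastLessThan_concat[of 0 n0 M "\<lambda>n. T n x"] by (simp add: lessThan_atLeast0)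
        then show "(\<Sum>n<M. T n x) j - (\<Sum>n<n0. T n x) j = (\<Sum>n=n0..<M. T n x) j" by simp
      qed
      ultimately have "(\<lambda>M. (\<Sum>n=n0..<M. T n x) j) \<longlonglongrightarrow> E x j - (\<Sum>n<n0. T n x) j"
        by (rule Lim_transform_eventually)
      then show "(\<lambda>M. (\<Sum>n=n0..<M. T n x) j) \<longlonglongrightarrow> (E x - (\<Sum>n<n0. T n x)) j" by simp
    qed
    moreover have "cpt (\<lambda>x. \<Sum>n<n0. T n x)" by (intro cpt_sum_op cptT) simp
    ultimately show "\<exists>K. cpt K \<and> opb e (\<lambda>x. E x - K x)" by blast
  qed
  then show ?thesis by (simp add: E_def[abs_def])
qed

end

section \<open>The intertwiner on the full direct sum\<close>

text \<open>Slot \<open>0\<close> is the summand carrying \<open>\<psi>\<close>, slot \<open>k + 1\<close> the first half of the \<open>k\<close>-th copy of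
  \<open>l\<^sup>p \<oplus> l\<^sup>p\<close>; the second halves (\<open>aux_index\<close>) are never moved.\<close>

fun slot_index :: "nat \<times> nat \<Rightarrow> nat + nat \<times> (nat + nat)" where
  "slot_index (0, i) = Inl i"
| "slot_index (Suc k, i) = Inr (k, Inl i)"

fun aux_index :: "nat \<times> nat \<Rightarrow> nat + nat \<times> (nat + nat)" where
  "aux_index (k, i) = Inr (k, Inr i)"

fun crd2 :: "nat + nat \<Rightarrow> nat" where
  "crd2 (Inl i) = i"
| "crd2 (Inr i) = i"

fun crd :: "nat + nat \<times> (nat + nat) \<Rightarrow> nat" where
  "crd (Inl i) = i"
| "crd (Inr (k, j)) = crd2 j"

text \<open>Both halves of a copy get the same slot number, so \<open>active\<close> restricts copy
  \<open>k\<close> by a condition on the coordinate alone.\<close>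

fun slot :: "nat + nat \<times> (nat + nat) \<Rightarrow> nat" where
  "slot (Inl i) = 0"
| "slot (Inr (k, j)) = Suc k"

fun move :: "(nat \<Rightarrow> nat) \<Rightarrow> nat + nat \<times> (nat + nat) \<Rightarrow> nat + nat \<times> (nat + nat)" where
  "move f (Inl i) = slot_index (f 0, i)"
| "move f (Inr (k, Inl i)) = slot_index (f (Suc k), i)"
| "move f (Inr (k, Inr i)) = Inr (k, Inr i)"

lemma index_cases:
  obtains k i where "j = slot_index (k, i)" | k i where "j = aux_index (k, i)"
  by (metis slot_index.simps aux_index.simps sum.exhaust prod.exhaust)

lemma inj_slot_index: "inj slot_index"
proof (rule injI)
  fix x y assume "slot_index x = slot_index y"
  then show "x = y" by (cases x rule: slot_index.cases; cases y rule: slot_index.cases) auto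
qed

lemma inj_aux_index: "inj aux_index"
  by (auto simp: inj_def)

lemma slot_ne_aux [simp]: "slot_index x \<noteq> aux_index y" "aux_index y \<noteq> slot_index x"
  by (cases x rule: slot_index.cases; cases y; auto)+

lemma move_slot [simp]: "move f (slot_index (k, i)) = slot_index (f k, i)"
  by (cases k) auto

lemma move_aux [simp]: "move f (aux_index (k, i)) = aux_index (k, i)"
  by simp

lemma crd_slot [simp]: "crd (slot_index (k, i)) = i" and slot_slot [simp]: "slot (slot_index (k, i)) = k"
  by (cases k; simp)+

lemma crd_aux [simp]: "crd (aux_index (k, i)) = i" and slot_aux [simp]: "slot (aux_index (k, i)) = Suc k"
  by auto

lemma crd_move [simp]: "crd (move f j) = crd j"
  by (cases j rule: index_cases) (auto simp del: aux_index.simps)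

lemma move_move: "move f (move g j) = move (\<lambda>k. f (g k)) j"
  by (cases j rule: index_cases) (auto simp del: aux_index.simps)

lemma move_id: "move (\<lambda>k. k) j = j"
  by (cases j rule: index_cases) (auto simp del: aux_index.simps)

declare aux_index.simps [simp del]

context lp_stages
begin

definition rotJ :: "(nat + nat \<times> (nat + nat) \<Rightarrow> complex) \<Rightarrow> nat + nat \<times> (nat + nat) \<Rightarrow> complex" where
  "rotJ = interp (\<lambda>j. stage (crd j)) (\<lambda>j. uu (crd j)) (\<lambda>n. move (cyc_inv n))"

definition rotJ_inv :: "(nat + nat \<times> (nat + nat) \<Rightarrow> complex) \<Rightarrow> nat + nat \<times> (nat + nat) \<Rightarrow> complex" where
  "rotJ_inv = interp (\<lambda>j. stage (crd j)) (\<lambda>j. cnj (uu (crd j))) (\<lambda>n. move (cyc n))"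

lemma rotJ_interpolation:
  "interpolation (\<lambda>j. stage (crd j)) (\<lambda>j. uu (crd j)) (\<lambda>n. move (cyc_inv n)) (\<lambda>n. move (cyc n))"
  by unfold_locales (simp_all add: move_move move_id uu_def norm_U cyc_inv_Suc_cyc cyc_Suc_cyc_inv)

lemma opb_rotJ: "opb 2 rotJ"
  unfolding rotJ_def by (rule interpolation.opb_interp[OF rotJ_interpolation lp_exponent_axioms])

lemma opb_rotJ_inv: "opb 2 rotJ_inv"
  unfolding rotJ_inv_def
  by (rule interpolation.opb_interp[OF interpolation.dual[OF rotJ_interpolation] lp_exponent_axioms])

lemma rotJ_inverse [simp]: "rotJ_inv (rotJ x) = x" "rotJ (rotJ_inv x) = x"
  unfolding rotJ_def rotJ_inv_def
  by (rule interpolation.interp_inverse[OF rotJ_interpolation] interpolation.interp_inverse'[OF rotJ_interpolation])+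

lemma rotJ_slot: "rotJ x \<circ> slot_index = rot (x \<circ> slot_index)"
  by (auto simp: rotJ_def rot_def interp_def fun_eq_iff)

lemma rotJ_aux: "rotJ x \<circ> aux_index = x \<circ> aux_index"
  by (auto simp: rotJ_def interp_def fun_eq_iff field_simps)

text \<open>Stage \<open>n\<close> mixes the permutations of levels \<open>n\<close> and
  \<open>n + 1\<close>, which move only slots below \<open>2 ^ Suc n\<close>; off this set
  \<open>rotJ\<close> is the identity.\<close>

definition active :: "(nat + nat \<times> (nat + nat)) set" where
  "active = {j. slot j < 2 ^ Suc (stage (crd j))}"

lemma active_slot: "slot_index (k, i) \<in> active \<longleftrightarrow> k < 2 ^ Suc (stage i)"
  by (simp add: active_def)

lemma active_move:
  assumes "n = stage (crd j) \<or> n = Suc (stage (crd j))"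
  shows "move (cyc_inv n) j \<in> active \<longleftrightarrow> j \<in> active" "j \<notin> active \<Longrightarrow> move (cyc_inv n) j = j"
proof -
  have le: "(2::nat) ^ n \<le> 2 ^ Suc (stage (crd j))" using assms by (intro power_increasing) auto
  have fix_: "move (cyc_inv n) j = j" if "j \<notin> active"
  proof (cases j rule: index_cases)
    case (1 k i)
    then have "2 ^ n \<le> k" using that le by (simp add: active_slot)
    then show ?thesis using 1 by (simp add: cyc_inv_fixed)
  qed simp
  show "move (cyc_inv n) j \<in> active \<longleftrightarrow> j \<in> active"
  proof (cases "j \<in> active")
    case True
    show ?thesis
    proof (cases j rule: index_cases)
      case (1 k i)
      have "cyc_inv n k < 2 ^ Suc (stage i)"
      proof (cases "k < 2 ^ n")
        case True
        then show ?thesis using cyc_inv_less[OF True] le 1 by simp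
      qed (use \<open>j \<in> active\<close> 1 in \<open>auto simp: active_slot cyc_inv_fixed\<close>)
      then show ?thesis using True 1 by (simp add: active_slot)
    qed simp
  qed (simp add: fix_)
  show "j \<notin> active \<Longrightarrow> move (cyc_inv n) j = j" by (rule fix_)
qed

lemma rotJ_cut: "rotJ (cut active x) = cut active (rotJ x)"
  by (auto simp: rotJ_def interp_def cut_def active_move fun_eq_iff)

lemma rotJ_fix: "cut (- active) (rotJ x) = cut (- active) x"
  by (auto simp: rotJ_def interp_def cut_def active_move fun_eq_iff field_simps)

lemma rotJ_diff: "rotJ x - x = cut active (rotJ x - x)" "rotJ x - x = rotJ (cut active x) - cut active x"
proof -
  have "rotJ x j = x j" if "j \<notin> active" for j
    using fun_cong[OF rotJ_fix[of x], of j] that by (simp add: cut_def)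
  then show "rotJ x - x = cut active (rotJ x - x)" by (auto simp: cut_def fun_eq_iff)
  then show "rotJ x - x = rotJ (cut active x) - cut active x"
    by (simp add: rotJ_cut cut_diff[symmetric])
qed

text \<open>The blocks \<open>T k\<close> need not get small, but \<open>rotJ\<close> moves the slot
  of copy \<open>k\<close> only at coordinates \<open>i\<close> with
  \<open>Suc k < 2 ^ Suc (stage i)\<close>, and there \<open>T k\<close> is small as input and as
  output. The commutator thus reduces to compact blocks with norms tending to zero.\<close>

lemma cpt_offdiagonal:
  fixes T :: "nat \<Rightarrow> (nat + nat \<Rightarrow> complex) \<Rightarrow> nat + nat \<Rightarrow> complex"
  assumes K: "\<And>k. cpt (T k)" and C: "\<And>k. opb C (T k)"
    and r: "\<And>n k. m \<le> n \<Longrightarrow> Suc k < 2 ^ Suc n \<Longrightarrow> opb ((1 / 2) ^ n) (\<lambda>x. T k (cut {j. c n \<le> crd2 j} x))"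
    and l: "\<And>n k. m \<le> n \<Longrightarrow> Suc k < 2 ^ Suc n \<Longrightarrow> opb ((1 / 2) ^ n) (\<lambda>x. cut {j. c n \<le> crd2 j} (T k x))"
  shows "cpt (\<lambda>x. extend Inr (bigsum T (rotJ x \<circ> Inr)) - rotJ (extend Inr (bigsum T (x \<circ> Inr))))"
proof -
  define W where "W k = {j. Suc k < 2 ^ Suc (stage (crd2 j))}" for k
  have W: "W k \<subseteq> {j. c n \<le> crd2 j}" if "2 ^ n \<le> Suc k" for n k
  proof
    fix j assume "j \<in> W k"
    then have "(2::nat) ^ n < 2 ^ Suc (stage (crd2 j))" using that by (simp add: W_def)
    then have "n < Suc (stage (crd2 j))" by (rule power_less_imp_less_exp[rotated]) simp
    then show "j \<in> {j. c n \<le> crd2 j}" using stage_less_iff[of "crd2 j" n] by auto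
  qed
  have ev: "eventually (\<lambda>k. opb e (\<lambda>x. T k (cut (W k) x)) \<and> opb e (\<lambda>x. cut (W k) (T k x))) sequentially"
    if e: "0 < e" for e
  proof -
    obtain n0 where n0: "(1 / 2 :: real) ^ n0 < e" using real_arch_pow_inv[OF e, of "1 / 2"] by auto
    show ?thesis
      unfolding eventually_sequentially
    proof (intro exI[of _ "2 ^ max n0 m"] allI impI)
      fix k :: nat assume k: "2 ^ max n0 m \<le> k"
      \<comment> \<open>\<open>n\<close> is the dyadic scale of the slot number: by the lower bound
        \<open>W k\<close> lies beyond \<open>c n\<close>, and by the upper bound the hypotheses
        apply at stage \<open>n\<close>.\<close>
      obtain n where n: "2 ^ n \<le> Suc k" "Suc k < 2 ^ Suc n"
        using ex_power_ivl1[of 2 "Suc k"] by auto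
      have "(2::nat) ^ max n0 m < 2 ^ Suc n" using k n(2) by linarith
      then have "max n0 m < Suc n" by (rule power_less_imp_less_exp[rotated]) simp
      then have mn: "m \<le> n" "n0 \<le> n" by auto
      have "(1 / 2 :: real) ^ n \<le> (1 / 2) ^ n0" using mn(2) by (intro power_decreasing) auto
      then have le: "(1 / 2 :: real) ^ n \<le> e" using n0 by linarith
      have eq: "cut (W k) x = cut {j. c n \<le> crd2 j} (cut (W k) x)" "cut (W k) x = cut (W k) (cut {j. c n \<le> crd2 j} x)"
        for x :: "nat + nat \<Rightarrow> complex"
        using W[OF n(1)] by (auto simp: cut_def fun_eq_iff)
      have "opb e (\<lambda>x. T k (cut (W k) x))"
        by (rule opb_cong[OF opb_mono[OF opb_comp[OF r[OF mn(1) n(2)] opb_cut[of "W k"]]]])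
          (use le eq(1) in auto)
      moreover have "opb e (\<lambda>x. cut (W k) (T k x))"
        by (rule opb_cong[OF opb_mono[OF opb_comp[OF opb_cut[of "W k"] l[OF mn(1) n(2)]]]])
          (use le eq(2) in auto)
      ultimately show "opb e (\<lambda>x. T k (cut (W k) x)) \<and> opb e (\<lambda>x. cut (W k) (T k x))" ..
    qed
  qed
  have 1: "cpt (bigsum (\<lambda>k x. T k (cut (W k) x)))"
  proof (rule cpt_bigsum)
    show "cpt (\<lambda>x. T k (cut (W k) x))" for k by (rule cpt_comp_right[OF K opb_cut])
    show "eventually (\<lambda>k. opb e (\<lambda>x. T k (cut (W k) x))) sequentially" if "0 < e" for e
      using ev[OF that] by (rule eventually_mono) auto
  qed
  have 2: "cpt (bigsum (\<lambda>k x. cut (W k) (T k x)))"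
  proof (rule cpt_bigsum)
    show "cpt (\<lambda>x. cut (W k) (T k x))" for k by (rule cpt_comp_left[OF opb_cut K])
    show "eventually (\<lambda>k. opb e (\<lambda>x. cut (W k) (T k x))) sequentially" if "0 < e" for e
      using ev[OF that] by (rule eventually_mono) auto
  qed
  define Om :: "(nat + nat \<times> (nat + nat) \<Rightarrow> complex) \<Rightarrow> nat + nat \<times> (nat + nat) \<Rightarrow> complex" where "Om x = extend Inr (bigsum T (x \<circ> Inr))" for x
  have Ob: "opb C Om" unfolding Om_def[abs_def] by (intro opb_extend_comp opb_bigsum C) auto
  define emb :: "((nat \<times> (nat + nat) \<Rightarrow> complex) \<Rightarrow> nat \<times> (nat + nat) \<Rightarrow> complex)
      \<Rightarrow> (nat + nat \<times> (nat + nat) \<Rightarrow> complex) \<Rightarrow> nat + nat \<times> (nat + nat) \<Rightarrow> complex"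
    where "emb S x = extend Inr (S (x \<circ> Inr))" for S x
  have O1: "cpt (emb (bigsum (\<lambda>k x. T k (cut (W k) x))))"
    and O2: "cpt (emb (bigsum (\<lambda>k x. cut (W k) (T k x))))"
    unfolding emb_def[abs_def] by (intro cpt_extend_comp 1 2; simp)+
  have slice: "(\<lambda>j'. (cut active x \<circ> Inr) (k, j')) = cut (W k) (\<lambda>j'. (x \<circ> Inr) (k, j'))"
    for x :: "nat + nat \<times> (nat + nat) \<Rightarrow> complex" and k
    by (auto simp: cut_def active_def W_def fun_eq_iff)
  have e1: "emb (bigsum (\<lambda>k x. T k (cut (W k) x))) x = Om (cut active x)" for x
    unfolding emb_def Om_def bigsum_def slice ..
  have e2: "emb (bigsum (\<lambda>k x. cut (W k) (T k x))) x = cut active (Om x)" for x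
  proof
    fix j :: "nat + nat \<times> (nat + nat)"
    show "emb (bigsum (\<lambda>k x. cut (W k) (T k x))) x j = cut active (Om x) j"
    proof (cases j)
      case (Inl i)
      then show ?thesis by (auto simp: emb_def Om_def extend_def cut_def)
    next
      case (Inr kj)
      then obtain k l where "j = Inr (k, l)" by (cases kj) auto
      then show ?thesis
        using extend_apply[of "Inr :: nat \<times> (nat + nat) \<Rightarrow> nat + nat \<times> (nat + nat)"]
        by (auto simp: emb_def Om_def cut_def bigsum_def active_def W_def)
    qed
  qed
  \<comment> \<open>The commutator is \<open>Om (rotJ - 1) - (rotJ - 1) Om\<close>, and
    \<open>rotJ - 1\<close> neither sees nor produces anything outside
    \<open>active\<close>.\<close>
  have A: "cpt (\<lambda>x. Om (cut active (rotJ x - x)))"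
    using cpt_comp_right[OF O1 opb_minus[OF opb_rotJ opb_id]] unfolding e1 .
  have B: "cpt (\<lambda>x. rotJ (cut active (Om x)) - cut active (Om x))"
    using cpt_minus[OF cpt_comp_left[OF opb_rotJ O2] O2] unfolding e2 .
  have "cpt (\<lambda>x. Om (rotJ x) - rotJ (Om x))"
  proof (rule cpt_cong[OF cpt_minus[OF A B]])
    fix x :: "nat + nat \<times> (nat + nat) \<Rightarrow> complex" assume x: "x \<in> lp p"
    have "Om (cut active (rotJ x - x)) = Om (rotJ x) - Om x"
      unfolding rotJ_diff(1)[symmetric] using opb_diff[OF Ob opb_lp[OF opb_rotJ x] x] .
    moreover have "rotJ (cut active (Om x)) - cut active (Om x) = rotJ (Om x) - Om x"
      by (rule rotJ_diff(2)[symmetric])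
    ultimately show "Om (rotJ x) - rotJ (Om x)
        = Om (cut active (rotJ x - x)) - (rotJ (cut active (Om x)) - cut active (Om x))" by simp
  qed
  then show ?thesis by (simp add: Om_def)
qed

end

section \<open>The given maps: compressions, off-diagonal parts and the choice of the stages\<close>

locale lp_homotopy = lp_exponent p for p :: real +
  fixes \<psi> \<psi>m :: "'b::banach \<Rightarrow> (nat \<Rightarrow> complex) \<Rightarrow> (nat \<Rightarrow> complex)"
    and \<eta> :: "'b \<Rightarrow> (nat + nat \<Rightarrow> complex) \<Rightarrow> (nat + nat \<Rightarrow> complex)"
    and \<tau> :: "real \<Rightarrow> 'a::banach \<Rightarrow> 'b"
  assumes sep: "separable_space (euclidean :: 'a topology)"
    and lin_\<eta>: "bounded_linear_into_B p \<eta>"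
    and lin_\<tau>: "t \<in> {0..1} \<Longrightarrow> bounded_linear (\<tau> t)"
    and compact_diff: "compact_op p (\<lambda>x i. \<eta> b x i - dsum (\<psi> b) (\<psi>m b) x i)"
    and cont_\<tau>: "continuous_on {0..1} (\<lambda>t. \<tau> t a)"
begin

definition diagl :: "'b \<Rightarrow> (nat \<Rightarrow> complex) \<Rightarrow> nat \<Rightarrow> complex" where
  "diagl b x = \<eta> b (extend Inl x) \<circ> Inl"

definition diagr :: "'b \<Rightarrow> (nat \<Rightarrow> complex) \<Rightarrow> nat \<Rightarrow> complex" where
  "diagr b x = \<eta> b (extend Inr x) \<circ> Inr"

definition off :: "'b \<Rightarrow> (nat + nat \<Rightarrow> complex) \<Rightarrow> nat + nat \<Rightarrow> complex" where
  "off b x = \<eta> b x - dsum (diagl b) (diagr b) x"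

lemma \<eta>_bound: "\<exists>C\<ge>0. \<forall>b. opb (C * norm b) (\<eta> b)"
proof -
  obtain C where C: "\<And>b. opnorm p (\<eta> b) \<le> C * norm b" using lin_\<eta> by (auto simp: bounded_linear_into_B_def)
  have "opb (max C 0 * norm b) (\<eta> b)" for b
  proof -
    obtain D where D: "opb D (\<eta> b)" using lin_\<eta> unfolding bounded_linear_into_B_def bop_iff_opb by blast
    have "opnorm p (\<eta> b) \<le> max C 0 * norm b"
      using C[of b] mult_right_mono[of C "max C 0" "norm b"] by auto
    then show ?thesis by (rule opb_opnorm[OF D])
  qed
  then show ?thesis by (intro exI[of _ "max C 0"]) auto
qed

definition C\<eta> :: real where
  "C\<eta> = (SOME C. C \<ge> 0 \<and> (\<forall>b. opb (C * norm b) (\<eta> b)))"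

lemma C\<eta>: "0 \<le> C\<eta>" "opb (C\<eta> * norm b) (\<eta> b)"
  using someI_ex[OF \<eta>_bound] unfolding C\<eta>_def by auto

definition C\<tau> :: real where
  "C\<tau> = (SOME C. C \<ge> 0 \<and> (\<forall>t\<in>{0..1}. \<forall>a. norm (\<tau> t a) \<le> C * norm a))"

lemma C\<tau>: "0 \<le> C\<tau>" "t \<in> {0..1} \<Longrightarrow> norm (\<tau> t a) \<le> C\<tau> * norm a"
  using someI_ex[OF bounded_linear_family_uniform_bound[OF lin_\<tau> cont_\<tau>]] unfolding C\<tau>_def by auto

lemma \<eta>_diff: assumes "x \<in> lp p" shows "\<eta> (a - b) x = \<eta> a x - \<eta> b x"
proof -
  have "\<eta> (a - b + b) x = (\<lambda>i. \<eta> (a - b) x i + \<eta> b x i)"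
    using lin_\<eta> assms unfolding bounded_linear_into_B_def by blast
  then show ?thesis by (auto simp: fun_eq_iff)
qed

lemma \<tau>_diff: "t \<in> {0..1} \<Longrightarrow> \<tau> t (a - b) = \<tau> t a - \<tau> t b"
  using lin_\<tau> by (intro linear_diff bounded_linear.linear)

lemma opb_diag: "opb (C\<eta> * norm b) (diagl b)" "opb (C\<eta> * norm b) (diagr b)"
  using opb_comp[OF opb_reindex[of Inl] opb_comp[OF C\<eta>(2)[of b] opb_extend[of Inl]]]
    opb_comp[OF opb_reindex[of Inr] opb_comp[OF C\<eta>(2)[of b] opb_extend[of Inr]]]
  by (simp_all add: diagl_def[abs_def] diagr_def[abs_def])

lemma diagl_diff: assumes "x \<in> lp p" shows "diagl (a - b) x = diagl a x - diagl b x"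
  unfolding diagl_def \<eta>_diff[OF lp_extend(1)[OF assms inj_Inl]] by (auto simp: fun_eq_iff)

lemma opb_off: "opb (3 * C\<eta> * norm b) (off b)"
  unfolding off_def[abs_def]
  using opb_minus[OF C\<eta>(2) opb_dsum[OF opb_diag], of b b b] by (simp add: algebra_simps)

lemma cpt_K: "cpt (\<lambda>x. \<eta> b x - dsum (\<psi> b) (\<psi>m b) x)"
  using cpt_if_compact_op[OF compact_diff] by (simp add: fun_diff_def)

lemma cpt_diagl: "cpt (\<lambda>x. \<psi> b x - diagl b x)"
proof -
  have "cpt (\<lambda>x. - ((\<eta> b (extend Inl x) - dsum (\<psi> b) (\<psi>m b) (extend Inl x)) \<circ> Inl))"
    by (intro cpt_neg cpt_comp_left[OF opb_reindex] cpt_comp_right[OF cpt_K opb_extend]) auto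
  then show ?thesis
    by (rule cpt_cong) (auto simp: diagl_def fun_eq_iff dsum_def extend_def)
qed

text \<open>Subtracting its two diagonal corners from the given compact difference cancels the block
  diagonal sum and leaves exactly the off-diagonal part of \<open>\<eta>\<close>.\<close>

lemma cpt_off: "cpt (off b)"
proof -
  let ?K = "\<lambda>x. \<eta> b x - dsum (\<psi> b) (\<psi>m b) x"
  have "cpt (\<lambda>x. ?K x - extend Inl (?K (extend Inl (x \<circ> Inl)) \<circ> Inl) - extend Inr (?K (extend Inr (x \<circ> Inr)) \<circ> Inr))"
    by (intro cpt_minus cpt_K cpt_extend_comp[where T = "\<lambda>x. ?K (extend Inl x) \<circ> Inl"]
        cpt_extend_comp[where T = "\<lambda>x. ?K (extend Inr x) \<circ> Inr"]
        cpt_comp_left[OF opb_reindex] cpt_comp_right[OF cpt_K opb_extend]) auto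
  then show ?thesis
  proof (rule cpt_cong)
    fix x :: "nat + nat \<Rightarrow> complex"
    have 1: "?K (extend Inl (x \<circ> Inl)) \<circ> Inl = diagl b (x \<circ> Inl) - \<psi> b (x \<circ> Inl)"
      unfolding dsum_eq_extend by (auto simp: diagl_def fun_eq_iff extend_def comp_def)
    have 2: "?K (extend Inr (x \<circ> Inr)) \<circ> Inr = diagr b (x \<circ> Inr) - \<psi>m b (x \<circ> Inr)"
      unfolding dsum_eq_extend by (auto simp: diagr_def fun_eq_iff extend_def comp_def)
    show "off b x = ?K x - extend Inl (?K (extend Inl (x \<circ> Inl)) \<circ> Inl) - extend Inr (?K (extend Inr (x \<circ> Inr)) \<circ> Inr)"
      unfolding 1 2 unfolding off_def dsum_eq_extend by (auto simp: fun_eq_iff extend_def)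
  qed
qed

text \<open>Shifted by one, because slot \<open>0\<close> belongs to \<open>\<psi>\<close> and copy
  \<open>k\<close> sits in slot \<open>Suc k\<close>.\<close>

definition v :: "nat \<Rightarrow> real" where
  "v k = vdc (Suc k)"

lemma v_range: "v k \<in> {0..1}"
  using vdc_range[of "Suc k"] by (auto simp: v_def)

lemma vdc_in: "vdc k \<in> {0..1}" "vdc_end k \<in> {0..1}"
  using vdc_range[of k] by (auto simp: vdc_end_def)

definition rho :: "real \<Rightarrow> 'a \<Rightarrow> (nat + nat \<times> (nat + nat) \<Rightarrow> complex) \<Rightarrow> nat + nat \<times> (nat + nat) \<Rightarrow> complex" where
  "rho t a = dsum (diagl (\<tau> t a)) (bigsum (\<lambda>k. \<eta> (\<tau> (v k) a)))"

lemma opb_rho: assumes t: "t \<in> {0..1}" shows "opb (2 * C\<eta> * C\<tau> * norm a) (rho t a)"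
proof -
  have le: "C\<eta> * norm (\<tau> s a) \<le> C\<eta> * (C\<tau> * norm a)" if "s \<in> {0..1}" for s
    using C\<tau>(2)[OF that] C\<eta>(1) by (rule mult_left_mono)
  have "opb (C\<eta> * (C\<tau> * norm a) + C\<eta> * (C\<tau> * norm a)) (rho t a)"
    unfolding rho_def
    by (intro opb_dsum opb_bigsum opb_mono[OF opb_diag(1) le] opb_mono[OF C\<eta>(2) le] t v_range)
  then show ?thesis by (simp add: algebra_simps)
qed

lemma rho_diff:
  assumes x: "x \<in> lp p" and t: "t \<in> {0..1}"
  shows "rho t (a - b) x = rho t a x - rho t b x"
proof -
  have l: "(\<lambda>i. x (Inl i)) \<in> lp p" "(\<lambda>kj. x (Inr kj)) \<in> lp p"
    using lp_reindex(1)[OF x inj_Inl] lp_reindex(1)[OF x inj_Inr] by (auto simp: comp_def)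
  have r: "(\<lambda>j. x (Inr (k, j))) \<in> lp p" for k using lp_slice[OF l(2)] .
  show ?thesis
    unfolding rho_def
    by (rule ext) (auto simp: dsum_def bigsum_def \<tau>_diff[OF t] \<tau>_diff[OF v_range] diagl_diff[OF l(1)] \<eta>_diff[OF r]
        split: sum.splits)
qed

lemma rho_decomp:
  assumes x: "x \<in> lp p" and \<theta>: "\<And>k. \<theta> k = (if k = 0 then diagl (\<tau> t a) else diagl (\<tau> (vdc k) a))"
  shows "rho t a x = extend slot_index (bigsum \<theta> (x \<circ> slot_index))
    + extend aux_index (bigsum (\<lambda>k. diagr (\<tau> (v k) a)) (x \<circ> aux_index))
    + extend Inr (bigsum (\<lambda>k. off (\<tau> (v k) a)) (x \<circ> Inr))"
proof
  fix j :: "nat + nat \<times> (nat + nat)"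
  have ns: "aux_index z \<notin> range slot_index" "slot_index z \<notin> range aux_index" for z by auto
  show "rho t a x j = (extend slot_index (bigsum \<theta> (x \<circ> slot_index))
    + extend aux_index (bigsum (\<lambda>k. diagr (\<tau> (v k) a)) (x \<circ> aux_index))
    + extend Inr (bigsum (\<lambda>k. off (\<tau> (v k) a)) (x \<circ> Inr))) j"
  proof (cases j rule: index_cases)
    case (1 k i)
    have e: "extend slot_index y j = y (k, i)" "extend aux_index y j = 0" for y
      using inj_slot_index ns(2)[of "(k, i)"] by (simp_all add: 1) (simp add: extend_def)
    show ?thesis
    proof (cases k)
      case 0
      then have "j = Inl i" using 1 by simp
      then have "extend Inr y j = 0" for y by (auto simp: extend_def)
      then show ?thesis using 0 \<open>j = Inl i\<close> e \<theta>[of 0]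
        by (simp add: rho_def dsum_def bigsum_def comp_def)
    next
      case (Suc l)
      then have j: "j = Inr (l, Inl i)" using 1 by simp
      then have "extend Inr y j = y (l, Inl i)" for y by (simp add: extend_def)
      then show ?thesis using Suc j e \<theta>[of k]
        by (simp add: rho_def dsum_def bigsum_def comp_def off_def v_def)
    qed
  next
    case (2 k i)
    have e: "extend aux_index y j = y (k, i)" "extend slot_index y j = 0" for y
      using inj_aux_index ns(1)[of "(k, i)"] by (simp_all add: 2) (simp add: extend_def)
    have j: "j = Inr (k, Inr i)" using 2 by (simp add: aux_index.simps)
    then have "extend Inr y j = y (k, Inr i)" for y by (simp add: extend_def)
    then show ?thesis using j e
      by (simp add: rho_def dsum_def bigsum_def comp_def off_def aux_index.simps)
  qed
qed

lemma dense_sequence: "\<exists>d :: nat \<Rightarrow> 'a. \<forall>a e. 0 < e \<longrightarrow> (\<exists>m. norm (a - d m) < e)"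
proof -
  obtain A :: "'a set" where A: "countable A" "closure A = UNIV"
    using sep by (auto simp: separable_space_def)
  have ne: "A \<noteq> {}" using A(2) by auto
  have "\<exists>m. norm (a - from_nat_into A m) < e" if e: "0 < e" for a e
  proof -
    have "a \<in> closure A" using A(2) by simp
    then obtain y where "y \<in> A" "dist y a < e" using e unfolding closure_approachable by blast
    moreover obtain m where "from_nat_into A m = y"
      using from_nat_into_surj[OF A(1) \<open>y \<in> A\<close>] by blast
    ultimately show ?thesis by (metis dist_commute dist_norm)
  qed
  then show ?thesis by blast
qed

definition cutc :: "nat \<Rightarrow> (nat + nat \<Rightarrow> complex) \<Rightarrow> nat + nat \<Rightarrow> complex" where
  "cutc m = cut {j. m \<le> crd2 j}"

lemma off_tails:
  assumes e: "0 < e"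
  shows "eventually (\<lambda>m. opb e (\<lambda>x. off b (cutc m x)) \<and> opb e (\<lambda>x. cutc m (off b x))) sequentially"
proof -
  obtain F where F: "finite F" "opb e (\<lambda>x. cut (- F) (off b x))" using cpt_off e unfolding cpt_def by blast
  obtain G where G: "finite G" "opb e (\<lambda>x. off b (cut (- G) x))" using cpt_right_tail[OF cpt_off e] by blast
  obtain n where n: "\<And>i. i \<in> crd2 ` (F \<union> G) \<Longrightarrow> i < n"
    using finite_nat_set_iff_bounded[of "crd2 ` (F \<union> G)"] F(1) G(1) by auto
  show ?thesis
    unfolding eventually_sequentially
  proof (intro exI[of _ n] allI impI conjI)
    fix m assume m: "n \<le> m"
    have "j \<notin> F \<and> j \<notin> G" if "m \<le> crd2 j" for j using n[of "crd2 j"] that m by force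
    then have 1: "cutc m x = cut (- G) (cutc m x)" "cutc m x = cutc m (cut (- F) x)" for x
      by (auto simp: cutc_def cut_def fun_eq_iff)
    have c: "opb 1 (cutc m)" unfolding cutc_def by (rule opb_cut)
    show "opb e (\<lambda>x. off b (cutc m x))"
      by (rule opb_cong[OF opb_mono[OF opb_comp[OF G(2) c]]]) (use 1(1) in auto)
    show "opb e (\<lambda>x. cutc m (off b x))"
      by (rule opb_cong[OF opb_mono[OF opb_comp[OF c F(2)]]]) (use 1(2) in auto)
  qed
qed

text \<open>The tolerances are summable, and stage \<open>n\<close> involves levels \<open>n\<close>
  and \<open>n + 1\<close>, hence slots below \<open>2 ^ Suc n\<close>, slot \<open>0\<close> with
  both its parameters. Stage \<open>0\<close> is exempt from the off-diagonal condition, since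
  \<open>c 0 = 0\<close> is prescribed.\<close>

lemma stages_exist:
  fixes d :: "nat \<Rightarrow> 'a"
  shows "\<exists>c U. lp_stages p c U \<and>
    (\<forall>n k m. m \<le> n \<longrightarrow> k < 2 ^ Suc n \<longrightarrow>
      opb ((1 / 2) ^ n) (\<lambda>x. mul (U n) (diagl (\<tau> (vdc k) (d m)) x) - diagl (\<tau> (vdc k) (d m)) (mul (U n) x)) \<and>
      opb ((1 / 2) ^ n) (\<lambda>x. mul (U n) (diagl (\<tau> (vdc_end k) (d m)) x) - diagl (\<tau> (vdc_end k) (d m)) (mul (U n) x))) \<and>
    (\<forall>n k m. 0 < n \<longrightarrow> m \<le> n \<longrightarrow> Suc k < 2 ^ Suc n \<longrightarrow>
      opb ((1 / 2) ^ n) (\<lambda>x. off (\<tau> (v k) (d m)) (cutc (c n) x)) \<and>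
      opb ((1 / 2) ^ n) (\<lambda>x. cutc (c n) (off (\<tau> (v k) (d m)) x)))"
proof -
  define TT where "TT n = (\<lambda>(k, m). diagl (\<tau> (vdc k) (d m))) ` ({..<2 ^ Suc n} \<times> {..n})
    \<union> (\<lambda>(k, m). diagl (\<tau> (vdc_end k) (d m))) ` ({..<2 ^ Suc n} \<times> {..n})" for n
  have TT: "finite (TT n)" "\<And>T. T \<in> TT n \<Longrightarrow> \<exists>C. opb C T" for n
    unfolding TT_def using opb_diag(1) by auto
  define offgood where "offgood n c \<longleftrightarrow> (\<forall>(k, m)\<in>{k. Suc k < 2 ^ Suc n} \<times> {..n}.
      opb ((1 / 2) ^ n) (\<lambda>x. off (\<tau> (v k) (d m)) (cutc c x)) \<and>
      opb ((1 / 2) ^ n) (\<lambda>x. cutc c (off (\<tau> (v k) (d m)) x)))" for n c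
  have offev: "eventually (offgood n) sequentially" for n
    unfolding offgood_def
  proof (rule eventually_ball_finite)
    have "{k. Suc k < 2 ^ Suc n} \<subseteq> {..<2 ^ Suc n}" by auto
    then show "finite ({k. Suc k < 2 ^ Suc n} \<times> {..n})" by (intro finite_cartesian_product) (auto intro: finite_subset)
  qed (auto intro!: off_tails)
  define P where "P n s \<longleftrightarrow> (case n of 0 \<Rightarrow> fst s = 0 | Suc _ \<Rightarrow> offgood n (fst s))"
    for n and s :: "nat \<times> (nat \<Rightarrow> complex)"
  define Q where "Q n s s' \<longleftrightarrow> fst s < fst s' \<and> (\<forall>i. norm (snd s' i) = 1) \<and> (\<forall>i<fst s. snd s' i = 1) \<and>
      (\<forall>i\<ge>fst s'. snd s' i = - 1) \<and> (\<forall>T\<in>TT n. opb ((1 / 2) ^ n) (\<lambda>x. mul (snd s' :: nat \<Rightarrow> complex) (T x) - T (mul (snd s') x)))"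
    for n and s s' :: "nat \<times> (nat \<Rightarrow> complex)"
  have "\<exists>f. \<forall>n. P n (f n) \<and> Q n (f n) (f (Suc n))"
  proof (rule dependent_nat_choice)
    show "\<exists>s. P 0 s" by (auto simp: P_def)
    fix s n assume "P n s"
    obtain N where N: "\<And>c. N \<le> c \<Longrightarrow> offgood (Suc n) c" using offev[of "Suc n"] by (auto simp: eventually_sequentially)
    have "0 < (1 / 2 :: real) ^ n" and TTn: "\<And>T. T \<in> TT n \<Longrightarrow> \<exists>C. opb C T"
      using TT(2) by (simp, blast)
    \<comment> \<open>Keeping \<open>u = 1\<close> up to \<open>N\<close> as well pushes the next
      cut point beyond \<open>N\<close>, where the off-diagonal condition of the next stage
      holds.\<close>
    from quasicentral_unitary[OF TT(1)[of n] TTn this(1), where c = "max (fst s) N"]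
    obtain c' u where "max (fst s) N < c'" "\<forall>i. norm (u i) = 1" "\<forall>i<max (fst s) N. u i = 1" "\<forall>i\<ge>c'. u i = - 1"
      "\<forall>T\<in>TT n. opb ((1 / 2) ^ n) (\<lambda>x. mul u (T x) - T (mul u x))" by blast
    then show "\<exists>s'. P (Suc n) s' \<and> Q n s s'"
      using N by (intro exI[of _ "(c', u)"]) (auto simp: P_def Q_def)
  qed
  then obtain f where P: "\<And>n. P n (f n)" and Q: "\<And>n. Q n (f n) (f (Suc n))" by blast
  define c where "c n = fst (f n)" for n
  define U where "U n = snd (f (Suc n))" for n
  have st: "lp_stages p c U"
  proof unfold_locales
    show "c 0 = 0" using P[of 0] by (simp add: P_def c_def)
    show "c n < c (Suc n)" "norm (U n i) = 1" "i < c n \<Longrightarrow> U n i = 1" "c (Suc n) \<le> i \<Longrightarrow> U n i = - 1" for n i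
      using Q[of n] by (auto simp: Q_def c_def U_def)
  qed
  have q: "opb ((1 / 2) ^ n) (\<lambda>x. mul (U n) (T x) - T (mul (U n) x))" if "T \<in> TT n" for n T
    using Q[of n] that by (auto simp: Q_def U_def)
  have og: "offgood n (c n)" if "0 < n" for n
    using P[of n] that by (cases n) (auto simp: P_def c_def)
  show ?thesis
  proof (intro exI[of _ c] exI[of _ U] conjI allI impI)
    show "lp_stages p c U" by (rule st)
    fix n k m :: nat
    show "opb ((1 / 2) ^ n) (\<lambda>x. mul (U n) (diagl (\<tau> (vdc k) (d m)) x) - diagl (\<tau> (vdc k) (d m)) (mul (U n) x))"
      if "m \<le> n" "k < 2 ^ Suc n"
      by (rule q, unfold TT_def, rule UnI1, rule image_eqI[of _ _ "(k, m)"]) (use that in auto)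
    show "opb ((1 / 2) ^ n) (\<lambda>x. mul (U n) (diagl (\<tau> (vdc_end k) (d m)) x) - diagl (\<tau> (vdc_end k) (d m)) (mul (U n) x))"
      if "m \<le> n" "k < 2 ^ Suc n"
      by (rule q, unfold TT_def, rule UnI2, rule image_eqI[of _ _ "(k, m)"]) (use that in auto)
    assume "0 < n" "m \<le> n" "Suc k < 2 ^ Suc n"
    then have "(k, m) \<in> {k. Suc k < 2 ^ Suc n} \<times> {..n}" by simp
    from bspec[OF og[OF \<open>0 < n\<close>, unfolded offgood_def] this]
    show "opb ((1 / 2) ^ n) (\<lambda>x. off (\<tau> (v k) (d m)) (cutc (c n) x))"
      "opb ((1 / 2) ^ n) (\<lambda>x. cutc (c n) (off (\<tau> (v k) (d m)) x))" by simp_all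
  qed
qed

text \<open>\<open>c\<close> and \<open>U\<close> are fixed before \<open>a\<close>. Compactness is
  shown for the dense elements \<open>d m\<close>, whose estimates hold from stage \<open>m\<close>
  on, and passes to every \<open>a\<close> because the error is additive in \<open>a\<close> with
  norm at most \<open>B * norm a\<close>.\<close>

lemma compact_perturbation_exists:
  "\<exists>c U. lp_stages p c U \<and> (\<forall>a. cpt (\<lambda>x. rho 1 a (lp_stages.rotJ c U x) - lp_stages.rotJ c U (rho 0 a x)))"
proof -
  obtain d :: "nat \<Rightarrow> 'a" where dense: "\<And>a e. 0 < e \<Longrightarrow> \<exists>m. norm (a - d m) < e" using dense_sequence by blast
  obtain c U where st: "lp_stages p c U"
    and comm: "\<And>n k m. m \<le> n \<Longrightarrow> k < 2 ^ Suc n \<Longrightarrow>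
      opb ((1 / 2) ^ n) (\<lambda>x. mul (U n) (diagl (\<tau> (vdc k) (d m)) x) - diagl (\<tau> (vdc k) (d m)) (mul (U n) x)) \<and>
      opb ((1 / 2) ^ n) (\<lambda>x. mul (U n) (diagl (\<tau> (vdc_end k) (d m)) x) - diagl (\<tau> (vdc_end k) (d m)) (mul (U n) x))"
    and off: "\<And>n k m. 0 < n \<Longrightarrow> m \<le> n \<Longrightarrow> Suc k < 2 ^ Suc n \<Longrightarrow>
      opb ((1 / 2) ^ n) (\<lambda>x. off (\<tau> (v k) (d m)) (cutc (c n) x)) \<and>
      opb ((1 / 2) ^ n) (\<lambda>x. cutc (c n) (off (\<tau> (v k) (d m)) x))"
    using stages_exist[of d] by blast
  interpret lp_stages p c U by fact
  define E where "E a x = rho 1 a (rotJ x) - rotJ (rho 0 a x)" for a x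
  \<comment> \<open>Two terms, each the bound \<open>2 * C\<eta> * C\<tau>\<close> for
    \<open>rho\<close> times the bound \<open>2\<close> for \<open>rotJ\<close>.\<close>
  define B where "B = 8 * C\<eta> * C\<tau>"
  have B0: "0 \<le> B" using C\<eta>(1) C\<tau>(1) by (simp add: B_def)
  have Eb: "opb (B * norm a) (E a)" for a
    unfolding E_def[abs_def] B_def
    using opb_minus[OF opb_comp[OF opb_rho[of 1 a] opb_rotJ] opb_comp[OF opb_rotJ opb_rho[of 0 a]]]
    by (simp add: algebra_simps)
  have Ediff: "E a x - E b x = E (a - b) x" if x: "x \<in> lp p" for a b x
  proof -
    have rx: "rotJ x \<in> lp p" "rho 0 a x \<in> lp p" "rho 0 b x \<in> lp p"
      using opb_lp[OF opb_rotJ x] opb_lp[OF opb_rho x] by auto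
    show ?thesis
      unfolding E_def using rho_diff[OF rx(1), of 1 a b] rho_diff[OF x, of 0 a b] opb_diff[OF opb_rotJ rx(2,3)]
      by simp
  qed
  have dense_cpt: "cpt (E (d m))" for m
  proof -
    define \<theta>0 where "\<theta>0 k = diagl (\<tau> (vdc k) (d m))" for k
    define \<theta>1 where "\<theta>1 k = diagl (\<tau> (vdc_end k) (d m))" for k
    have b: "opb (C\<eta> * (C\<tau> * norm (d m))) (diagl (\<tau> t (d m)))" if "t \<in> {0..1}" for t
      by (rule opb_mono[OF opb_diag(1)]) (intro mult_left_mono C\<tau> that C\<eta>(1))
    have main: "cpt (\<lambda>x. bigsum \<theta>1 (rot x) - rot (bigsum \<theta>0 x))"
    proof (rule cpt_rot_intertwines[where C = "C\<eta> * (C\<tau> * norm (d m))" and m = m])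
      show "opb (C\<eta> * (C\<tau> * norm (d m))) (\<theta>0 k)" "opb (C\<eta> * (C\<tau> * norm (d m))) (\<theta>1 k)" for k
        unfolding \<theta>0_def \<theta>1_def by (intro b vdc_in)+
      show "\<theta>1 k = \<theta>0 k" if "0 < k" for k using that by (simp add: \<theta>0_def \<theta>1_def vdc_end_def)
      show "opb ((1 / 2) ^ n) (comm (U n) (\<theta>0 k))" "opb ((1 / 2) ^ n) (comm (U n) (\<theta>1 k))"
        if "m \<le> n" "k < 2 ^ Suc n" for n k
        using comm[OF that] by (simp_all add: comm_def[abs_def] \<theta>0_def \<theta>1_def)
      fix e :: real assume e: "0 < e"
      have "uniformly_continuous_on {0..1} (\<lambda>t. \<tau> t (d m))"
        by (intro compact_uniformly_continuous cont_\<tau>) simp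
      moreover have "0 < e / (C\<eta> + 1)" using e C\<eta>(1) by simp
      ultimately obtain r where r: "0 < r" "\<And>s t. s \<in> {0..1} \<Longrightarrow> t \<in> {0..1} \<Longrightarrow> dist s t < r \<Longrightarrow>
          dist (\<tau> s (d m)) (\<tau> t (d m)) < e / (C\<eta> + 1)"
        unfolding uniformly_continuous_on_def by metis
      obtain n0 where n0: "(1 / 2 :: real) ^ n0 < r" using real_arch_pow_inv[OF r(1), of "1 / 2"] by auto
      show "eventually (\<lambda>n. \<forall>k<2 ^ n. opb e (\<lambda>x. \<theta>1 (cyc n k) x - \<theta>0 k x)) sequentially"
        unfolding eventually_sequentially
      proof (intro exI[of _ n0] allI impI)
        fix n k :: nat assume n: "n0 \<le> n" and k: "k < 2 ^ n"
        let ?s = "vdc_end (cyc n k)" and ?t = "vdc k"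
        have "dist ?s ?t = (1 / 2) ^ n" using vdc_end_cyc[OF k] by (simp add: dist_real_def power_one_over)
        also have "\<dots> \<le> (1 / 2) ^ n0" using n by (intro power_decreasing) auto
        also have "\<dots> < r" by (rule n0)
        finally have "dist (\<tau> ?s (d m)) (\<tau> ?t (d m)) < e / (C\<eta> + 1)" by (intro r vdc_in)
        then have "C\<eta> * norm (\<tau> ?s (d m) - \<tau> ?t (d m)) \<le> C\<eta> * (e / (C\<eta> + 1))"
          using C\<eta>(1) by (intro mult_left_mono) (auto simp: dist_norm)
        also have "\<dots> \<le> e" using C\<eta>(1) e by (simp add: field_simps)
        finally have "opb e (diagl (\<tau> ?s (d m) - \<tau> ?t (d m)))" by (rule opb_mono[OF opb_diag(1)])
        then show "opb e (\<lambda>x. \<theta>1 (cyc n k) x - \<theta>0 k x)"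
          by (rule opb_cong) (simp add: \<theta>0_def \<theta>1_def diagl_diff)
      qed
    qed
    define Om :: "(nat + nat \<times> (nat + nat) \<Rightarrow> complex) \<Rightarrow> nat + nat \<times> (nat + nat) \<Rightarrow> complex"
      where "Om x = extend Inr (bigsum (\<lambda>k. off (\<tau> (v k) (d m))) (x \<circ> Inr))" for x
    have bo: "opb (3 * C\<eta> * (C\<tau> * norm (d m))) (off (\<tau> (v k) (d m)))" for k
      by (rule opb_mono[OF opb_off]) (use C\<eta>(1) C\<tau>(2)[OF v_range] in \<open>auto intro!: mult_left_mono\<close>)
    \<comment> \<open>Starting at \<open>Suc m\<close> instead of \<open>m\<close> skips stage
      \<open>0\<close>, for which there is no off-diagonal estimate.\<close>
    have OmC: "cpt (\<lambda>x. Om (rotJ x) - rotJ (Om x))"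
      unfolding Om_def
      by (rule cpt_offdiagonal[where m = "Suc m", OF cpt_off bo]) (use off in \<open>auto simp: cutc_def\<close>)
    have Ob: "opb (3 * C\<eta> * (C\<tau> * norm (d m))) Om"
      unfolding Om_def[abs_def] by (intro opb_extend_comp opb_bigsum bo) auto
    define R where "R x = extend aux_index (bigsum (\<lambda>k. diagr (\<tau> (v k) (d m))) (x \<circ> aux_index))" for x
    have bd: "opb (C\<eta> * (C\<tau> * norm (d m))) (diagr (\<tau> (v k) (d m)))" for k
      by (rule opb_mono[OF opb_diag(2)]) (intro mult_left_mono C\<tau> v_range C\<eta>(1))
    have Rb: "opb (C\<eta> * (C\<tau> * norm (d m))) R"
      unfolding R_def[abs_def] by (intro opb_extend_comp opb_bigsum bd inj_aux_index)
    have b\<theta>: "opb (C\<eta> * (C\<tau> * norm (d m))) (bigsum \<theta>0)" unfolding \<theta>0_def by (intro opb_bigsum b vdc_in)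
    have "cpt (\<lambda>x. extend slot_index (bigsum \<theta>1 (rot (x \<circ> slot_index)) - rot (bigsum \<theta>0 (x \<circ> slot_index))) + (Om (rotJ x) - rotJ (Om x)))"
      using cpt_plus[OF cpt_extend_comp[OF inj_slot_index main inj_slot_index] OmC] .
    then show ?thesis
    proof (rule cpt_cong)
      fix x :: "nat + nat \<times> (nat + nat) \<Rightarrow> complex" assume x: "x \<in> lp p"
      have rx: "rotJ x \<in> lp p" using opb_lp[OF opb_rotJ x] .
      have 1: "rho 1 (d m) (rotJ x) = extend slot_index (bigsum \<theta>1 (rot (x \<circ> slot_index))) + R x + Om (rotJ x)"
        using rho_decomp[OF rx, of \<theta>1 1 "d m"]
        by (simp add: R_def Om_def rotJ_slot rotJ_aux \<theta>1_def vdc_end_def)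
      have 0: "rho 0 (d m) x = extend slot_index (bigsum \<theta>0 (x \<circ> slot_index)) + R x + Om x"
        using rho_decomp[OF x, of \<theta>0 0 "d m"] by (simp add: R_def Om_def \<theta>0_def)
      \<comment> \<open>\<open>R x\<close> is supported on the second halves, which
        \<open>rotJ\<close> fixes, so this part contributes no error.\<close>
      have "rotJ (extend slot_index y + R x) = extend slot_index (rot y) + R x" for y
      proof
        fix j
        let ?z = "extend slot_index y + R x"
        have ns: "aux_index z \<notin> range slot_index" "slot_index z \<notin> range aux_index" for z by auto
        have es: "extend slot_index w \<circ> aux_index = 0" "extend slot_index w \<circ> slot_index = w" for w
          using ns inj_slot_index by (auto simp: fun_eq_iff) (simp add: extend_def)
        have Rs: "R x \<circ> slot_index = 0" using ns by (auto simp: R_def extend_def fun_eq_iff)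
        have zs: "?z \<circ> slot_index = y" using es(2)[of y] Rs by (simp add: fun_eq_iff)
        show "rotJ ?z j = (extend slot_index (rot y) + R x) j"
        proof (cases j rule: index_cases)
          case (1 k i)
          then show ?thesis using fun_cong[OF rotJ_slot[of ?z, unfolded zs], of "(k, i)"]
              fun_cong[OF es(2)[of "rot y"], of "(k, i)"] fun_cong[OF Rs, of "(k, i)"] by simp
        next
          case (2 k i)
          then show ?thesis using fun_cong[OF rotJ_aux[of ?z], of "(k, i)"]
              fun_cong[OF es(1)[of "rot y"], of "(k, i)"] fun_cong[OF es(1)[of y], of "(k, i)"] by simp
        qed
      qed
      moreover have "extend slot_index (bigsum \<theta>0 (x \<circ> slot_index)) + R x \<in> lp p"
        by (intro lp_add lp_extend inj_slot_index opb_lp[OF b\<theta>] opb_lp[OF Rb] lp_reindex x)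
      ultimately have 2: "rotJ (rho 0 (d m) x) = extend slot_index (rot (bigsum \<theta>0 (x \<circ> slot_index))) + R x + rotJ (Om x)"
        unfolding 0 using opb_add[OF opb_rotJ _ opb_lp[OF Ob x]] by simp
      have "extend slot_index (y - z) = extend slot_index y - extend slot_index z" for y z
        by (auto simp: extend_def fun_eq_iff)
      then show "E (d m) x = extend slot_index (bigsum \<theta>1 (rot (x \<circ> slot_index)) - rot (bigsum \<theta>0 (x \<circ> slot_index)))
          + (Om (rotJ x) - rotJ (Om x))"
        unfolding E_def 1 2 by simp
    qed
  qed
  have "cpt (E a)" for a
  proof (rule cpt_approx[OF Eb])
    fix e :: real assume e: "0 < e"
    then have "0 < e / (B + 1)" using B0 by simp
    from dense[OF this] obtain m where m: "norm (a - d m) < e / (B + 1)" by blast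
    have "B * norm (a - d m) \<le> B * (e / (B + 1))" using m B0 by (intro mult_left_mono) auto
    also have "\<dots> \<le> e" using B0 e by (simp add: field_simps)
    finally have "opb e (E (a - d m))" by (rule opb_mono[OF Eb])
    then have "opb e (\<lambda>x. E a x - E (d m) x)" by (rule opb_cong) (simp add: Ediff)
    then show "\<exists>K. cpt K \<and> opb e (\<lambda>x. E a x - K x)" using dense_cpt by blast
  qed
  then show ?thesis using st by (auto simp: E_def[abs_def])
qed

end

theorem theorem7p18:
  fixes p :: real
    and \<psi> \<psi>m :: "'b::banach \<Rightarrow> (nat \<Rightarrow> complex) \<Rightarrow> (nat \<Rightarrow> complex)"
    and \<eta> :: "'b \<Rightarrow> (nat + nat \<Rightarrow> complex) \<Rightarrow> (nat + nat \<Rightarrow> complex)"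
    and \<tau> :: "real \<Rightarrow> 'a::banach \<Rightarrow> 'b"
  assumes "1 < p"
    and "separable_space (euclidean :: 'a topology)"
    and "separable_space (euclidean :: 'b topology)"
    and "\<forall>a. bop p (\<psi> a)" and "\<forall>a. bop p (\<psi>m a)"
    and "bounded_linear_into_B p \<eta>"
    and "\<forall>t\<in>{0..1}. bounded_linear (\<tau> t)"
    and "\<forall>a. compact_op p (\<lambda>x i. \<eta> a x i - dsum (\<psi> a) (\<psi>m a) x i)"
    and "\<forall>a. continuous_on {0..1} (\<lambda>t. \<tau> t a)"
  shows "\<exists>v::nat \<Rightarrow> real. (\<forall>k. dyadic (v k) \<and> v k \<in> {0..1}) \<and>
     similar_mod_compact p 16
       (\<lambda>a. dsum (\<psi> (\<tau> 0 a)) (bigsum (\<lambda>k. \<eta> (\<tau> (v k) a))))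
       (\<lambda>a. dsum (\<psi> (\<tau> 1 a)) (bigsum (\<lambda>k. \<eta> (\<tau> (v k) a)))) \<and>
     (p = 2 \<longrightarrow> unitarily_equiv_mod_compact p
       (\<lambda>a. dsum (\<psi> (\<tau> 0 a)) (bigsum (\<lambda>k. \<eta> (\<tau> (v k) a))))
       (\<lambda>a. dsum (\<psi> (\<tau> 1 a)) (bigsum (\<lambda>k. \<eta> (\<tau> (v k) a)))))"
proof -
  interpret lp_homotopy p \<psi> \<psi>m \<eta> \<tau>
    by (intro lp_homotopy.intro lp_exponent.intro lp_homotopy_axioms.intro) (use assms in auto)
  obtain c U where st: "lp_stages p c U"
    and E: "\<And>a. cpt (\<lambda>x. rho 1 a (lp_stages.rotJ c U x) - lp_stages.rotJ c U (rho 0 a x))"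
    using compact_perturbation_exists by blast
  interpret lp_stages p c U by fact
  let ?\<rho> = "\<lambda>t a. dsum (\<psi> (\<tau> t a)) (bigsum (\<lambda>k. \<eta> (\<tau> (v k) a)))"
  \<comment> \<open>The correction that restores \<open>\<psi>\<close> in slot \<open>0\<close>; it
    is compact by \<open>cpt_diagl\<close> and becomes \<open>L\<close> below.\<close>
  have \<rho>: "?\<rho> t a x = rho t a x + extend Inl (\<psi> (\<tau> t a) (x \<circ> Inl) - diagl (\<tau> t a) (x \<circ> Inl))" for t a x
    unfolding rho_def dsum_eq_extend by (auto simp: extend_def fun_eq_iff)
  have compact: "compact_op p (\<lambda>x i. ?\<rho> 1 a x i - rotJ (?\<rho> 0 a (rotJ_inv x)) i)" for a
  proof (rule compact_op_if_cpt)
    define L :: "real \<Rightarrow> (nat + nat \<times> (nat + nat) \<Rightarrow> complex) \<Rightarrow> nat + nat \<times> (nat + nat) \<Rightarrow> complex"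
      where "L t x = extend Inl (\<psi> (\<tau> t a) (x \<circ> Inl) - diagl (\<tau> t a) (x \<circ> Inl))" for t x
    have L: "cpt (L t)" for t unfolding L_def[abs_def] by (intro cpt_extend_comp cpt_diagl) auto
    then obtain D where D: "opb D (L 0)" using cpt_opb by blast
    have "cpt (\<lambda>x. (rho 1 a (rotJ (rotJ_inv x)) - rotJ (rho 0 a (rotJ_inv x))) + (L 1 x - rotJ (L 0 (rotJ_inv x))))"
      by (intro cpt_plus cpt_minus L cpt_comp_right[OF E opb_rotJ_inv] cpt_comp_left[OF opb_rotJ]
          cpt_comp_right[OF L opb_rotJ_inv])
    then show "cpt (\<lambda>x i. ?\<rho> 1 a x i - rotJ (?\<rho> 0 a (rotJ_inv x)) i)"
    proof (rule cpt_cong)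
      fix x :: "nat + nat \<times> (nat + nat) \<Rightarrow> complex" assume x: "x \<in> lp p"
      have ix: "rotJ_inv x \<in> lp p" by (rule opb_lp[OF opb_rotJ_inv x])
      have "rotJ (?\<rho> 0 a (rotJ_inv x)) = rotJ (rho 0 a (rotJ_inv x)) + rotJ (L 0 (rotJ_inv x))"
        unfolding \<rho> L_def[symmetric] using opb_add[OF opb_rotJ opb_lp[OF opb_rho ix] opb_lp[OF D ix]] by simp
      moreover have "?\<rho> 1 a x = rho 1 a x + L 1 x" unfolding \<rho> L_def ..
      ultimately show "(\<lambda>i. ?\<rho> 1 a x i - rotJ (?\<rho> 0 a (rotJ_inv x)) i)
          = (rho 1 a (rotJ (rotJ_inv x)) - rotJ (rho 0 a (rotJ_inv x))) + (L 1 x - rotJ (L 0 (rotJ_inv x)))"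
        by (auto simp: fun_eq_iff)
    qed
  qed
  have bop: "bop p rotJ" "bop p rotJ_inv" using opb_rotJ opb_rotJ_inv by (auto simp: bop_iff_opb)
  \<comment> \<open>The construction yields the similarity constant \<open>4\<close>, below the
    \<open>16\<close> of the statement.\<close>
  have "opnorm p rotJ * opnorm p rotJ_inv \<le> 2 * 2"
    by (intro mult_mono opnorm_le opb_rotJ opb_rotJ_inv opb_const_nonneg[OF opb_opnorm[OF opb_rotJ_inv order_refl]]) auto
  then have "similar_mod_compact p 16 (?\<rho> 0) (?\<rho> 1)"
    unfolding similar_mod_compact_def using bop compact by (intro exI[of _ rotJ] exI[of _ rotJ_inv]) auto
  moreover have "unitarily_equiv_mod_compact p (?\<rho> 0) (?\<rho> 1)" if "p = 2"
  proof -
    have "lpnorm p (rotJ x) = lpnorm p x" if "x \<in> lp p" for x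
      using interpolation.lpnorm_2_interp[OF rotJ_interpolation, of x] that \<open>p = 2\<close> by (simp add: rotJ_def)
    then show ?thesis
      unfolding unitarily_equiv_mod_compact_def using bop compact by (intro exI[of _ rotJ] exI[of _ rotJ_inv]) auto
  qed
  moreover have "dyadic (v k) \<and> v k \<in> {0..1}" for k using v_range vdc_dyadic by (simp add: v_def)
  ultimately show ?thesis by blast
qed

end
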